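(* Given $\mathrm{AC}(D)$ and $\mathrm{DAWG}(D)$ (with inverse suffix links), upon insertion of a pattern $p$ of length $m$ into $D$ (resp. deletion of a pattern $p\in D$ of length $m$ from $D$), the AC-automaton $\mathrm{AC}(D)$ can be updated to $\mathrm{AC}(D\cup\{p\})$ (resp. $\mathrm{AC}(D\setminus\{p\})$) in $O(m\log\sigma + u_f + u_o)$ time, where $u_f$ is the number of states whose failure link needs to be updated and $u_o$ is the number of states on which the output function needs to be updated.
   Context: Strings are over an alphabet $\Sigma$ of size $\sigma$. A dictionary is a finite set $D$ of nonempty strings; $\mathrm{Pref}(D)$ and $\mathrm{Substr}(D)$ denote the sets of all prefixes and substrings of its strings. The Aho–Corasick automaton $\mathrm{AC}(D)$ has state set $\mathrm{Pref}(D)$ (root $\varepsilon$), goto function $\mathrm{goto}(s,c)=sc$ whenever $s, sc\in\mathrm{Pref}(D)$, failure function $\mathsf{flink}(s)$ = the longest proper suffix of $s$ in $\mathrm{Pref}(D)$ (for $s\neq\varepsilon$), and output function $\mathsf{output}(s)$ = the set of patterns in $D$ that are suffixes of $s$. For a string $x$ let $\mathrm{endPos}_D(x) = \{(i,j) : x = p_i[j-|x|+1:j],\ |x|\le j\le|p_i|,\ p_i\in D\}$; for $x,y\in\mathrm{Substr}(D)$, $x\equiv_D y$ iff $\mathrm{endPos}_D(x)=\mathrm{endPos}_D(y)$, with class $[x]_D$. $\mathrm{DAWG}(D)$ has nodes $[x]_D$ for $x\in\mathrm{Substr}(D)$, edges $([x]_D,c,[xc]_D)$ for $x,xc\in\mathrm{Substr}(D)$,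 and suffix links $\mathsf{slink}([x]_D)=[y]_D$ with $y$ the longest suffix of $x$ with $y\not\equiv_D x$; the inverse suffix links of each node are stored in an ordered array. The stated time bound concerns updating the AC-automaton only (the time to update the DAWG itself is not included). *)

theory Defs
  imports Complex_Main "HOL-Library.Sublist"
begin

section \<open>Dictionaries, Aho-Corasick automata and DAWGs\<close>

text \<open>The alphabet of size \<open>\<sigma>\<close> is \<open>{..<\<sigma>}\<close>, so that characters can be stored in machine words.\<close>

type_synonym str = "nat list"

definition dictionary :: "nat \<Rightarrow> str set \<Rightarrow> bool" where
  "dictionary \<sigma> D \<longleftrightarrow> finite D \<and> (\<forall>q\<in>D. q \<noteq> [] \<and> set q \<subseteq> {..<\<sigma>})"

text \<open>Inserting the empty string matters only for the empty dictionary, whose automaton and DAWG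
  consist of the root alone. For nonempty \<open>D\<close> these are the sets of all prefixes and of all
  substrings of strings in \<open>D\<close>.\<close>

definition Pref :: "str set \<Rightarrow> str set" where
  "Pref D = insert [] {x. \<exists>q\<in>D. prefix x q}"

definition Substr :: "str set \<Rightarrow> str set" where
  "Substr D = insert [] {x. \<exists>q\<in>D. sublist x q}"

definition goto_edges :: "str set \<Rightarrow> (str \<times> nat \<times> str) set" where
  "goto_edges D = {(s, c, s @ [c]) | s c. s \<in> Pref D \<and> s @ [c] \<in> Pref D}"

definition flink :: "str set \<Rightarrow> str \<Rightarrow> str" where
  "flink D s = (ARG_MAX length t. t \<in> Pref D \<and> strict_suffix t s)"

definition outputs :: "str set \<Rightarrow> str \<Rightarrow> str set" where
  "outputs D s = {q \<in> D. suffix q s}"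

text \<open>An occurrence is identified by the pattern itself instead of by its index in \<open>D\<close>.\<close>

definition endPos :: "str set \<Rightarrow> str \<Rightarrow> (str \<times> nat) set" where
  "endPos D x = {(q, j). q \<in> D \<and> length x \<le> j \<and> j \<le> length q \<and>
                         x = take (length x) (drop (j - length x) q)}"

definition dawg_class :: "str set \<Rightarrow> str \<Rightarrow> str set" where
  "dawg_class D x = {y \<in> Substr D. endPos D y = endPos D x}"

definition dawg_nodes :: "str set \<Rightarrow> str set set" where
  "dawg_nodes D = dawg_class D ` Substr D"

definition dawg_edges :: "str set \<Rightarrow> (str set \<times> nat \<times> str set) set" where
  "dawg_edges D = {(dawg_class D x, c, dawg_class D (x @ [c])) | x c.
                     x \<in> Substr D \<and> x @ [c] \<in> Substr D}"

definition slinks :: "str set \<Rightarrow> (str set \<times> str set) set" where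
  "slinks D = {(dawg_class D x,
                dawg_class D (ARG_MAX length y. suffix y x \<and> endPos D y \<noteq> endPos D x)) | x.
                 x \<in> Substr D \<and> x \<noteq> []}"

text \<open>The numbers of states that occur before and after an update and whose failure link, resp.
  output set, differs. States that the update creates or removes are not counted. There are at most
  \<open>m\<close> of these, so counting them too would not change the bound.\<close>

definition u_f :: "str set \<Rightarrow> str set \<Rightarrow> nat" where
  "u_f D D' = card {s \<in> Pref D \<inter> Pref D'. s \<noteq> [] \<and> flink D s \<noteq> flink D' s}"

definition u_o :: "str set \<Rightarrow> str set \<Rightarrow> nat" where
  "u_o D D' = card {s \<in> Pref D \<inter> Pref D'. outputs D s \<noteq> outputs D' s}"


section \<open>A unit-cost random access machine\<close>

text \<open>The memory consists of registers and of arrays that are indexed by natural numbers.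
  Besides those holding the input and the two data structures there are scratch registers and
  scratch arrays, whose initial contents are arbitrary.

  A program mentions only finitely many registers and arrays, and the expressions in it have fixed
  sizes, so unit cost per executed command or test is time on a RAM up to a constant factor. As
  there is no addition of two registers, a value exceeds the initial ones and the constants of the
  program by at most a constant per step; this rules out packing data into huge words.\<close>

datatype reg = PatLen | Width | FreeId | AcRoot | DawgRoot | Reg nat

datatype arr =
    Pat
  | AcChild bool | Flink | OutHead | OutNext | NodeOf
  | DawgChild bool | Slink | InvStart | InvCount | InvLinks | StateOf
  | Arr nat

datatype aexp = Num nat | Var reg | Cell arr aexp | Incr aexp | Decr aexp | Half aexp | Parity aexp

datatype bexp = Equal aexp aexp | Less aexp aexp | Neg bexp | Conj bexp bexp

datatype com =
    Skip
  | Assign reg aexp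
  | Store arr aexp aexp
  | Seq com com
  | Cond bexp com com
  | While bexp com

record memory =
  regs :: "reg \<Rightarrow> nat"
  cells :: "arr \<Rightarrow> nat \<Rightarrow> nat"

primrec aval :: "aexp \<Rightarrow> memory \<Rightarrow> nat" where
  "aval (Num n) M = n"
| "aval (Var r) M = regs M r"
| "aval (Cell a e) M = cells M a (aval e M)"
| "aval (Incr e) M = aval e M + 1"
| "aval (Decr e) M = aval e M - 1"
| "aval (Half e) M = aval e M div 2"
| "aval (Parity e) M = aval e M mod 2"

primrec bval :: "bexp \<Rightarrow> memory \<Rightarrow> bool" where
  "bval (Equal e f) M \<longleftrightarrow> aval e M = aval f M"
| "bval (Less e f) M \<longleftrightarrow> aval e M < aval f M"
| "bval (Neg b) M \<longleftrightarrow> \<not> bval b M"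
| "bval (Conj b b') M \<longleftrightarrow> bval b M \<and> bval b' M"

text \<open>\<open>exec c M t M'\<close>: started in \<open>M\<close>, the program \<open>c\<close> halts in \<open>M'\<close> after \<open>t\<close> steps.\<close>

inductive exec :: "com \<Rightarrow> memory \<Rightarrow> nat \<Rightarrow> memory \<Rightarrow> bool" where
  Skip: "exec Skip M 1 M"
| Assign: "exec (Assign r e) M 1 (M\<lparr>regs := (regs M)(r := aval e M)\<rparr>)"
| Store: "exec (Store a e f) M 1
            (M\<lparr>cells := (cells M)(a := (cells M a)(aval e M := aval f M))\<rparr>)"
| Seq: "exec c M t M' \<Longrightarrow> exec d M' u M'' \<Longrightarrow> exec (Seq c d) M (t + u) M''"
| CondTrue: "bval b M \<Longrightarrow> exec c M t M' \<Longrightarrow> exec (Cond b c d) M (t + 1) M'"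
| CondFalse: "\<not> bval b M \<Longrightarrow> exec d M t M' \<Longrightarrow> exec (Cond b c d) M (t + 1) M'"
| WhileFalse: "\<not> bval b M \<Longrightarrow> exec (While b c) M 1 M"
| WhileTrue: "bval b M \<Longrightarrow> exec c M t M' \<Longrightarrow> exec (While b c) M' u M'' \<Longrightarrow>
              exec (While b c) M (t + u + 1) M''"

lemma exec_deterministic: "exec c M t M' \<Longrightarrow> exec c M u M'' \<Longrightarrow> t = u \<and> M' = M''"
proof (induction arbitrary: u M'' rule: exec.induct)
  case (Seq c M t M' d u' N)
  from Seq.prems show ?case by cases (use Seq.IH in blast)
next
  case (WhileTrue b M c t M' u' N)
  from WhileTrue.prems show ?case by cases (use WhileTrue.hyps WhileTrue.IH in blast)+
qed (erule exec.cases; force)+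


section \<open>Representation in memory\<close>

subsection \<open>Branching\<close>

text \<open>Characters are written with \<open>L \<ge> 1\<close> binary digits, least significant first. The outgoing
  edges of a node are stored in a binary digital search tree of height \<open>L\<close> on these codes. Its inner
  vertex reached from the node \<open>v\<close> by the digits \<open>w\<close> has the key \<open>(v, w)\<close>; the root
  \<open>(v, [])\<close> also serves as the address of \<open>v\<close>, and the last digit leads to the address of the
  target of the edge. The tree has no vertices besides those needed, and 0 is the null pointer.\<close>

definition code_len :: "nat \<Rightarrow> nat" where
  "code_len \<sigma> = max 1 (nat \<lceil>log 2 (real \<sigma>)\<rceil>)"

definition code :: "nat \<Rightarrow> nat \<Rightarrow> bool list" where
  "code L c = map (bit c) [0..<L]"

definition branch_keys :: "nat \<Rightarrow> 'v set \<Rightarrow> ('v \<times> nat \<times> 'v) set \<Rightarrow> ('v \<times> bool list) set" where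
  "branch_keys L V E = {(v, w). v \<in> V \<and>
     (w = [] \<or> (\<exists>c u. (v, c, u) \<in> E \<and> strict_prefix w (code L c)))}"

definition branching ::
  "nat \<Rightarrow> 'v set \<Rightarrow> ('v \<times> nat \<times> 'v) set \<Rightarrow> ('v \<times> bool list \<Rightarrow> nat) \<Rightarrow> (bool \<Rightarrow> nat \<Rightarrow> nat) \<Rightarrow> bool"
where
  "branching L V E \<nu> child \<longleftrightarrow>
     inj_on \<nu> (branch_keys L V E) \<and> 0 \<notin> \<nu> ` branch_keys L V E \<and>
     (\<forall>v w b. (v, w @ [b]) \<in> branch_keys L V E \<longrightarrow>
        child b (\<nu> (v, w)) = \<nu> (v, w @ [b])) \<and>
     (\<forall>v c u w b. (v, c, u) \<in> E \<and> code L c = w @ [b] \<longrightarrow>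
        child b (\<nu> (v, w)) = \<nu> (u, [])) \<and>
     (\<forall>v w b. (v, w) \<in> branch_keys L V E \<and> (\<nexists>c u. (v, c, u) \<in> E \<and> prefix (w @ [b]) (code L c)) \<longrightarrow>
        child b (\<nu> (v, w)) = 0)"

subsection \<open>The automaton\<close>

primrec linked_list :: "(nat \<Rightarrow> nat) \<Rightarrow> nat \<Rightarrow> nat list \<Rightarrow> bool" where
  "linked_list next a [] \<longleftrightarrow> a = 0"
| "linked_list next a (x # xs) \<longleftrightarrow> a = x \<and> linked_list next (next a) xs"

text \<open>The output set of a state is stored as a linked list by decreasing length. The cell of a
  pattern carries the address of its state; lists of different states share their common tails.
  All addresses from \<open>FreeId\<close> on are available for new vertices.\<close>

definition represents_ac :: "nat \<Rightarrow> str set \<Rightarrow> (str \<times> bool list \<Rightarrow> nat) \<Rightarrow> memory \<Rightarrow> bool" where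
  "represents_ac \<sigma> D \<nu> M \<longleftrightarrow>
     regs M Width = code_len \<sigma> \<and>
     branching (code_len \<sigma>) (Pref D) (goto_edges D) \<nu> (\<lambda>b. cells M (AcChild b)) \<and>
     (\<forall>k \<in> branch_keys (code_len \<sigma>) (Pref D) (goto_edges D). \<nu> k < regs M FreeId) \<and>
     regs M AcRoot = \<nu> ([], []) \<and>
     (\<forall>s \<in> Pref D - {[]}. cells M Flink (\<nu> (s, [])) = \<nu> (flink D s, [])) \<and>
     (\<forall>s \<in> Pref D. \<exists>qs. set qs = outputs D s \<and> sorted_wrt (\<lambda>q r. length q > length r) qs \<and>
        linked_list (cells M OutNext) (cells M OutHead (\<nu> (s, []))) (map (\<lambda>q. \<nu> (q, [])) qs))"

subsection \<open>The DAWG\<close>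

text \<open>The inverse suffix links of each node occupy a contiguous array segment. Nothing is assumed
  about the order in which they are listed there, so every choice of the order is covered.\<close>

definition represents_dawg ::
  "nat \<Rightarrow> str set \<Rightarrow> (str set \<times> bool list \<Rightarrow> nat) \<Rightarrow> memory \<Rightarrow> bool" where
  "represents_dawg \<sigma> D \<mu> M \<longleftrightarrow>
     regs M Width = code_len \<sigma> \<and>
     branching (code_len \<sigma>) (dawg_nodes D) (dawg_edges D) \<mu> (\<lambda>b. cells M (DawgChild b)) \<and>
     regs M DawgRoot = \<mu> (dawg_class D [], []) \<and>
     (\<forall>(v, u) \<in> slinks D. cells M Slink (\<mu> (v, [])) = \<mu> (u, [])) \<and>
     (\<forall>u \<in> dawg_nodes D. \<exists>vs. distinct vs \<and> set vs = {v. (v, u) \<in> slinks D} \<and>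
        cells M InvCount (\<mu> (u, [])) = length vs \<and>
        (\<forall>i < length vs. cells M InvLinks (cells M InvStart (\<mu> (u, [])) + i) = \<mu> (vs ! i, [])))"

text \<open>A state \<open>s\<close> of the automaton and the DAWG node \<open>[s]\<close> are connected by pointers in both
  directions. Each class contains at most one state, namely its longest member.\<close>

definition cross_linked ::
  "str set \<Rightarrow> (str \<times> bool list \<Rightarrow> nat) \<Rightarrow> (str set \<times> bool list \<Rightarrow> nat) \<Rightarrow> memory \<Rightarrow> bool" where
  "cross_linked D \<nu> \<mu> M \<longleftrightarrow>
     (\<forall>s \<in> Pref D. cells M NodeOf (\<nu> (s, [])) = \<mu> (dawg_class D s, []) \<and>
                   cells M StateOf (\<mu> (dawg_class D s, [])) = \<nu> (s, [])) \<and>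
     (\<forall>v \<in> dawg_nodes D. v \<inter> Pref D = {} \<longrightarrow> cells M StateOf (\<mu> (v, [])) = 0)"

definition pattern_stored :: "str \<Rightarrow> memory \<Rightarrow> bool" where
  "pattern_stored p M \<longleftrightarrow> regs M PatLen = length p \<and> (\<forall>i < length p. cells M Pat i = p ! i)"


section \<open>Updates\<close>

text \<open>Running \<open>c\<close> on representations of the automaton and the DAWG of \<open>D\<close> and on \<open>p\<close> takes at
  most \<open>B\<close> steps and turns the automaton into that of \<open>D'\<close>. It is updated in place, in that the
  surviving states keep their addresses, and the DAWG of \<open>D\<close> is left intact, so that it can be
  updated afterwards.\<close>

definition updates_ac :: "com \<Rightarrow> nat \<Rightarrow> str set \<Rightarrow> str \<Rightarrow> str set \<Rightarrow> real \<Rightarrow> bool" where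
  "updates_ac c \<sigma> D p D' B \<longleftrightarrow>
     (\<forall>M \<nu> \<mu>. represents_ac \<sigma> D \<nu> M \<and> represents_dawg \<sigma> D \<mu> M \<and> cross_linked D \<nu> \<mu> M \<and>
              pattern_stored p M \<longrightarrow>
        (\<exists>t M' \<nu>'. exec c M t M' \<and> real t \<le> B \<and>
           represents_ac \<sigma> D' \<nu>' M' \<and> (\<forall>s \<in> Pref D \<inter> Pref D'. \<nu>' (s, []) = \<nu> (s, [])) \<and>
           represents_dawg \<sigma> D \<mu> M'))"

text \<open>The factor \<open>log \<sigma>\<close> is read as at least 1, as even over a unary alphabet the pattern has to
  be read. For \<open>\<sigma> \<ge> 2\<close> the maximum is \<open>log 2 \<sigma>\<close>.\<close>

definition update_bound :: "nat \<Rightarrow> str set \<Rightarrow> str \<Rightarrow> str set \<Rightarrow> real" where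
  "update_bound \<sigma> D p D' =
     real (length p) * max 1 (log 2 (real \<sigma>)) + real (u_f D D') + real (u_o D D')"

end

theory Submission
  imports Defs
begin

text \<open>
  The states whose failure link changes after an insertion are found in the tree of suffix links of
  the DAWG. For a new prefix \<open>x\<close> of the pattern that occurs in the dictionary, they lie below the node
  of \<open>x\<close>, and every state met on the way down stops the search, as does the node of another new
  prefix, which the program marks beforehand. A node without a state represents a string that is not
  a prefix of any pattern, so that at least two different characters precede it and the node has at
  least two children; hence a search visits at most twice as many nodes as it meets states or marks.
  The failure links of the new states themselves are computed as by Aho and Corasick, with amortized
  cost. For a deletion, the failure links to a removed state \<open>x\<close> are redirected to the failure link
  of \<open>x\<close>, in the order of increasing length of \<open>x\<close>, so that the links to removed states that are
  created on the way disappear again.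

  An output list is determined by its head, and the lists share their tails. So it suffices to
  redirect, in all states having the pattern as a suffix, the pointers to the longest shorter output
  of the pattern to the pattern itself, or the other way round.
\<close>

section \<open>Longest suffixes\<close>

text \<open>All searches run in the DAWG of the dictionary before the update, which stays unchanged.
  For an insertion this loses nothing: the failure link of an old state is a substring of a pattern
  in \<open>D\<close>, so only the new prefixes in \<open>Substr D\<close>, collected in
  \<open>fresh\<close>, can become targets. The mark of a node is the address of the new state,
  written into \<open>StateOf\<close>. It cuts the other searches, which makes their regions
  disjoint so that their costs add up, and it later supplies the new link. But it hides an old state
  stored at the same node: the link of that state is therefore set while marking, and the original
  entry at the node of \<open>p\<close> is restored before outputs are redirected. For a deletion,
  the order of lengths ensures that the original links decide which states are redirected, and these
  can be read off the DAWG. The digital search trees of all states are viewed as one binary trie of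
  code words, so that an insertion adds one path and a deletion clears at most one pointer.\<close>

definition longest :: "str set \<Rightarrow> str \<Rightarrow> str" where
  "longest A s = (ARG_MAX length t. t \<in> A \<and> suffix t s)"

lemma suffix_tl_iff: "s \<noteq> [] \<Longrightarrow> suffix t (tl s) \<longleftrightarrow> strict_suffix t s"
  by (cases s) (auto simp: strict_suffix_def suffix_Cons dest: suffix_length_le)

lemma suffix_eq_length: "suffix a s \<Longrightarrow> suffix b s \<Longrightarrow> length a = length b \<Longrightarrow> a = b"
  by (metis suffix_same_cases suffix_order.order_iff_strict suffix_length_less less_irrefl)

text \<open>\<open>arg_max\<close> is meaningful only when the measure is bounded; that all
  candidates are suffixes of one string \<open>s\<close> bounds their lengths.\<close>

lemma arg_max_suffix:
  assumes "P t" "\<And>u. P u \<Longrightarrow> suffix u s"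
  shows "P (arg_max length P)" "\<And>u. P u \<Longrightarrow> length u \<le> length (arg_max length P)"
proof -
  have "P (arg_max length P) \<and> (\<forall>u. P u \<longrightarrow> length u \<le> length (arg_max length P))"
    by (rule arg_max_nat_lemma[of _ t _ "Suc (length s)"])
      (use assms in \<open>auto dest: suffix_length_le simp: less_Suc_eq_le\<close>)
  then show "P (arg_max length P)" "\<And>u. P u \<Longrightarrow> length u \<le> length (arg_max length P)" by auto
qed

lemma arg_max_suffix_eq:
  assumes "P t" "\<And>u. P u \<Longrightarrow> suffix u s" "\<And>u. P u \<Longrightarrow> length u \<le> length t"
  shows "arg_max length P = t"
proof (rule suffix_eq_length)
  note am = arg_max_suffix[of P, OF assms(1,2)]
  show "suffix (arg_max length P) s" "suffix t s" using am(1) assms by auto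
  show "length (arg_max length P) = length t" using am assms by (simp add: le_antisym)
qed

text \<open>Suffixes of one string are linearly ordered, so a longest one has all the others as
  suffixes. Failure links (\<open>A = Pref D\<close>), longest outputs
  (\<open>A = insert [] D\<close>) and the intermediate links of a deletion are instances;
  \<open>[]\<close> in \<open>A\<close> guarantees that there is a candidate.\<close>

lemma longest:
  assumes "[] \<in> A"
  shows "longest A s \<in> A" "suffix (longest A s) s"
    "\<And>t. t \<in> A \<Longrightarrow> suffix t s \<Longrightarrow> suffix t (longest A s)"
proof -
  let ?P = "\<lambda>t. t \<in> A \<and> suffix t s"
  note am = arg_max_suffix[of ?P "[]" s, folded longest_def]
  show "longest A s \<in> A" "suffix (longest A s) s" using am(1) assms by auto
  fix t assume t: "t \<in> A" "suffix t s"
  then have "length t \<le> length (longest A s)" using am(2) assms by auto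
  then show "suffix t (longest A s)"
    using t \<open>suffix (longest A s) s\<close> by (meson suffix_length_suffix)
qed

lemma longest_eqI:
  assumes "t \<in> A" "suffix t s" "\<And>u. u \<in> A \<Longrightarrow> suffix u s \<Longrightarrow> length u \<le> length t"
  shows "longest A s = t"
  unfolding longest_def by (rule arg_max_suffix_eq[of _ _ s]) (use assms in auto)

lemma longest_self: "s \<in> A \<Longrightarrow> longest A s = s"
  by (rule longest_eqI) (auto dest: suffix_length_le)

lemma longest_Nil [simp]: "[] \<in> A \<Longrightarrow> longest A [] = []"
  by (rule longest_self)

lemma longest_tl: "[] \<in> A \<Longrightarrow> s \<notin> A \<Longrightarrow> longest A (tl s) = longest A s"
proof (rule longest_eqI)
  assume A: "[] \<in> A" "s \<notin> A"
  then show "longest A s \<in> A" by (simp add: longest)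
  have "s \<noteq> []" "longest A s \<noteq> s" using A longest(1) by metis+
  then show "suffix (longest A s) (tl s)"
    using longest(2)[OF A(1), of s] by (simp add: suffix_tl_iff strict_suffix_def)
  fix u assume "u \<in> A" "suffix u (tl s)"
  then show "length u \<le> length (longest A s)"
    using longest(3)[OF A(1)] by (meson suffix_length_le suffix_order.trans suffix_tl)
qed

lemma longest_trans:
  assumes "[] \<in> A" "suffix (longest A s) t" "suffix t s"
  shows "longest A t = longest A s"
  by (rule longest_eqI) (use assms longest in \<open>auto intro!: suffix_length_le longest(3) intro: suffix_order.trans\<close>)

lemma Nil_in_Pref [simp]: "[] \<in> Pref D" by (simp add: Pref_def)
lemma Nil_in_Substr [simp]: "[] \<in> Substr D" by (simp add: Substr_def)

lemma flink_longest: "s \<noteq> [] \<Longrightarrow> flink D s = longest (Pref D) (tl s)"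
  by (simp add: flink_def longest_def suffix_tl_iff)

lemma Pref_prefix: "x \<in> Pref D \<Longrightarrow> prefix y x \<Longrightarrow> y \<in> Pref D"
  unfolding Pref_def using prefix_order.trans by (cases "x = []") auto

lemma Pref_insert: "p \<noteq> [] \<Longrightarrow> Pref (D \<union> {p}) = Pref D \<union> {x. prefix x p}"
  by (auto simp: Pref_def)

lemma Substr_sublist: "x \<in> Substr D \<Longrightarrow> sublist y x \<Longrightarrow> y \<in> Substr D"
  unfolding Substr_def using sublist_order.order.trans by (cases "x = []") auto

lemma Pref_Substr: "x \<in> Pref D \<Longrightarrow> x \<in> Substr D"
  by (auto simp: Substr_def Pref_def)

lemma finite_Pref [simp]: assumes "finite D" shows "finite (Pref D)"
proof -
  have "Pref D = insert [] (\<Union>q\<in>D. set (prefixes q))" by (auto simp: Pref_def)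
  then show ?thesis using assms by simp
qed

lemma finite_Substr [simp]: assumes "finite D" shows "finite (Substr D)"
proof -
  have "Substr D = insert [] (\<Union>q\<in>D. set (sublists q))" by (auto simp: Substr_def)
  then show ?thesis using assms by simp
qed

section \<open>Nodes of the DAWG\<close>

text \<open>An occurrence ending at \<open>j\<close> is a suffix of the prefix of length
  \<open>j\<close>. In this form the suffix order replaces arithmetic on positions.\<close>

lemma endPos_suffix: "endPos D x = {(q, j). q \<in> D \<and> j \<le> length q \<and> suffix x (take j q)}"
proof -
  have "(length x \<le> j \<and> x = take (length x) (drop (j - length x) q)) = suffix x (take j q)"
    if "j \<le> length q" for j q
  proof
    assume *: "length x \<le> j \<and> x = take (length x) (drop (j - length x) q)"
    then have "take j q = take (j - length x) q @ x"
      by (metis add_diff_inverse_nat le_add_diff_inverse2 not_less take_add)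
    then show "suffix x (take j q)" by (simp add: suffix_def)
  next
    assume "suffix x (take j q)"
    then obtain u where u: "take j q = u @ x" by (auto simp: suffix_def)
    then have len: "length u + length x = j" using that by (metis length_append length_take min.absorb2)
    have "drop (j - length x) (take j q) = x" using u len by (metis add_diff_cancel_right' append_eq_conv_conj)
    then show "length x \<le> j \<and> x = take (length x) (drop (j - length x) q)"
      using len by (simp add: drop_take)
  qed
  then show ?thesis unfolding endPos_def by blast
qed

lemma endPos_antimono: "suffix y x \<Longrightarrow> endPos D x \<subseteq> endPos D y"
  by (auto simp: endPos_suffix intro: suffix_order.trans)

lemma Substr_endPos: "x \<in> Substr D \<longleftrightarrow> x = [] \<or> endPos D x \<noteq> {}"
proof -
  have "sublist x q \<longleftrightarrow> (\<exists>j \<le> length q. suffix x (take j q))" for q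
    by (metis nle_le sublist_altdef take_all take_is_prefix append_eq_conv_conj prefix_def)
  then show ?thesis by (auto simp: Substr_def endPos_suffix)
qed

text \<open>Both strings are suffixes of the same prefix of a pattern.\<close>

lemma endPos_comparable:
  "oc \<in> endPos D x \<Longrightarrow> oc \<in> endPos D y \<Longrightarrow> suffix x y \<or> suffix y x"
  by (auto simp: endPos_suffix dest: suffix_same_cases)

text \<open>The right-hand side depends on \<open>x\<close> through its occurrences alone. Hence
  equivalent strings stay equivalent when extended on the right, and the edges of the DAWG do not
  depend on the chosen member of a class.\<close>

lemma endPos_snoc: "endPos D (x @ [c]) = {(q, Suc j) | q j. (q, j) \<in> endPos D x \<and> j < length q \<and> q ! j = c}"
proof -
  have "(j \<le> length q \<and> suffix (x @ [c]) (take j q)) \<longleftrightarrow>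
      (\<exists>i. j = Suc i \<and> suffix x (take i q) \<and> i < length q \<and> q ! i = c)" for q j
    by (cases j) (auto simp: take_Suc_conv_app_nth Suc_le_eq)
  then show ?thesis by (auto simp: endPos_suffix)
qed

text \<open>A DAWG node is represented by its longest member, the string that cannot be extended to the
  left without losing an occurrence.\<close>

definition reps :: "str set \<Rightarrow> str set" where
  "reps D = {x \<in> Substr D. \<forall>c. c # x \<in> Substr D \<longrightarrow> endPos D (c # x) \<noteq> endPos D x}"

text \<open>Otherwise \<open>x\<close> is a strict suffix of \<open>y\<close>. The suffix of
  \<open>y\<close> that is longer than \<open>x\<close> by one character is squeezed between the two
  and has the same occurrences, which contradicts that \<open>x\<close> is a representative.\<close>

lemma rep_longest:
  assumes "x \<in> reps D" "y \<in> Substr D" "endPos D y = endPos D x"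
  shows "suffix y x"
proof (cases "y = []")
  case False
  then obtain oc where o: "oc \<in> endPos D y" using assms(2) by (auto simp: Substr_endPos)
  show ?thesis
  proof (rule ccontr)
    assume n: "\<not> suffix y x"
    then have "suffix x y" "x \<noteq> y" using endPos_comparable[OF o, of x] o assms(3) by auto
    then obtain u c where u: "y = u @ c # x"
      by (metis append_Nil append_butlast_last_id append.assoc append_Cons suffix_def)
    then have s: "suffix (c # x) y" by (simp add: suffix_def)
    then have "endPos D (c # x) = endPos D x"
      using endPos_antimono[OF s, of D] endPos_antimono[of x "c # x" D] assms(3) by (auto simp: suffix_Cons)
    moreover have "c # x \<in> Substr D" using Substr_sublist[OF assms(2)] s by blast
    ultimately show False using assms(1) by (auto simp: reps_def)
  qed
qed simp

lemma reps_Substr: "x \<in> reps D \<Longrightarrow> x \<in> Substr D" by (simp add: reps_def)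

lemma dawg_class_eq: "x \<in> Substr D \<Longrightarrow> dawg_class D x = dawg_class D y \<longleftrightarrow> endPos D x = endPos D y"
  by (auto simp: dawg_class_def)

lemma dawg_class_inj: "inj_on (dawg_class D) (reps D)"
  by (rule inj_onI) (metis dawg_class_eq rep_longest reps_Substr suffix_order.antisym)

text \<open>The canonical name of the node of \<open>x\<close>. By \<open>rep_longest\<close> there
  is only one candidate, see \<open>ext_eq\<close>.\<close>

definition ext :: "str set \<Rightarrow> str \<Rightarrow> str" where
  "ext D x = (SOME z. z \<in> reps D \<and> endPos D z = endPos D x)"

lemma ext:
  assumes "finite D" "x \<in> Substr D"
  shows "ext D x \<in> reps D" "endPos D (ext D x) = endPos D x" "suffix x (ext D x)"
    "dawg_class D (ext D x) = dawg_class D x"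
proof -
  let ?P = "\<lambda>y. y \<in> Substr D \<and> endPos D y = endPos D x"
  have fin: "finite (length ` Substr D)" using assms(1) by simp
  obtain z where z: "?P z" "\<And>y. ?P y \<Longrightarrow> length y \<le> length z"
  proof (rule that)
    have "?P (arg_max length ?P) \<and> (\<forall>y. ?P y \<longrightarrow> length y \<le> length (arg_max length ?P))"
      by (rule arg_max_nat_lemma[of _ x _ "Suc (Max (length ` Substr D))"])
        (use assms fin in \<open>auto simp: less_Suc_eq_le\<close>)
    then show "?P (arg_max length ?P)" "\<And>y. ?P y \<Longrightarrow> length y \<le> length (arg_max length ?P)" by auto
  qed
  have "z \<in> reps D" unfolding reps_def
  proof (intro CollectI conjI allI impI notI)
    fix c assume "c # z \<in> Substr D" "endPos D (c # z) = endPos D z"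
    then show False using z(1) z(2)[of "c # z"] by auto
  qed (use z in auto)
  then have *: "ext D x \<in> reps D \<and> endPos D (ext D x) = endPos D x"
    unfolding ext_def using z by (metis (mono_tags, lifting) someI)
  then show "ext D x \<in> reps D" "endPos D (ext D x) = endPos D x" by auto
  show "suffix x (ext D x)" using rep_longest[of "ext D x" D x] * assms by simp
  show "dawg_class D (ext D x) = dawg_class D x" using * by (simp add: dawg_class_def)
qed

lemma ext_eq: "finite D \<Longrightarrow> z \<in> reps D \<Longrightarrow> x \<in> Substr D \<Longrightarrow> endPos D z = endPos D x \<Longrightarrow> ext D x = z"
  by (metis ext(1,2) rep_longest reps_Substr suffix_order.antisym)

text \<open>Every occurrence of \<open>z\<close> is one of \<open>x\<close> and hence of
  \<open>ext D x\<close>, so \<open>z\<close> and \<open>ext D x\<close> are comparable. If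
  \<open>z\<close> were the shorter one, it would be squeezed between \<open>x\<close> and
  \<open>ext D x\<close> and belong to their class. In the tree of suffix links this says that the
  node of \<open>x\<close> is an ancestor of the node of \<open>z\<close>, or that node
  itself.\<close>

lemma ext_suffix_rep:
  assumes "finite D" "z \<in> reps D" "suffix x z"
  shows "suffix (ext D x) z"
proof -
  have x: "x \<in> Substr D" using assms reps_Substr Substr_sublist suffix_imp_sublist by meson
  note e = ext[OF assms(1) x]
  show ?thesis
  proof (cases "z = []")
    case True
    with assms(3) e show ?thesis using rep_longest[OF assms(2), of "ext D x"] reps_Substr by force
  next
    case False
    then obtain oc where o: "oc \<in> endPos D z" using reps_Substr[OF assms(2)] by (auto simp: Substr_endPos)
    then have "oc \<in> endPos D (ext D x)" using e(2) endPos_antimono[OF assms(3)] by auto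
    with endPos_comparable[OF o] have "suffix z (ext D x) \<or> suffix (ext D x) z" by blast
    moreover have "suffix (ext D x) z" if "suffix z (ext D x)"
      using endPos_antimono[OF that, of D] endPos_antimono[OF assms(3), of D] e rep_longest[OF assms(2), of "ext D x"]
      by (auto simp: reps_Substr)
    ultimately show ?thesis by blast
  qed
qed

text \<open>An occurrence at the very beginning of a pattern cannot be extended to the left. Hence
  every state is the representative of its own node.\<close>

lemma Pref_reps: assumes "s \<in> Pref D" shows "s \<in> reps D"
proof -
  have "endPos D (c # s) \<noteq> endPos D s" if "c # s \<in> Substr D" for c
  proof -
    have "D \<noteq> {}" using that by (auto simp: Substr_def)
    then obtain q where q: "q \<in> D" "prefix s q"
      using assms by (auto simp: Pref_def)
    then have "(q, length s) \<in> endPos D s" by (auto simp: endPos_suffix prefix_def)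
    moreover have "(q, length s) \<notin> endPos D (c # s)"
      by (auto simp: endPos_suffix dest: suffix_length_le)
    ultimately show ?thesis by blast
  qed
  then show ?thesis using Pref_Substr[OF assms] by (auto simp: reps_def)
qed

lemma class_Pref: "z \<in> reps D \<Longrightarrow> s \<in> dawg_class D z \<Longrightarrow> s \<in> Pref D \<Longrightarrow> s = z"
  using rep_longest Pref_reps unfolding dawg_class_def
  by (metis (mono_tags, lifting) mem_Collect_eq reps_Substr suffix_order.antisym)

text \<open>A prefix occurs strictly to the left of any occurrence of the longer string, so the first
  occurrences of the two differ.\<close>

lemma endPos_strict_prefix:
  assumes "strict_prefix x y" "y \<in> Substr D" shows "endPos D x \<noteq> endPos D y"
proof
  assume eq: "endPos D x = endPos D y"
  obtain c u where y: "y = x @ c # u" using assms(1) by (auto elim: strict_prefixE')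
  then have "y \<noteq> []" by simp
  then obtain q j where qj: "(q, j) \<in> endPos D y" using assms(2) by (auto simp: Substr_endPos)
  have step: "\<exists>i<j. (q, i) \<in> endPos D y" if "(q, j) \<in> endPos D y" for j
  proof -
    from that obtain v where q: "q \<in> D" "j \<le> length q" "take j q = v @ x @ c # u"
      by (auto simp: endPos_suffix y suffix_def)
    let ?i = "length v + length x"
    have j: "j = ?i + Suc (length u)" using q by (metis length_append length_Cons length_take min.absorb2 add.assoc)
    then have "take ?i q = v @ x" using q(3)
      by (metis append.assoc append_eq_conv_conj length_append le_add1 min.absorb1 take_take)
    then have "(q, ?i) \<in> endPos D x" using q j by (auto simp: endPos_suffix suffix_def)
    then show ?thesis using j eq by (intro exI[of _ ?i]) auto
  qed
  have "(q, j) \<notin> endPos D y" for j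
    by (induction j rule: less_induct) (use step in blast)
  then show False using qj by blast
qed

text \<open>The children in the tree of suffix links, named by representatives: one character is
  prepended, and the result is completed to the longest member of its class.\<close>

definition kids :: "str set \<Rightarrow> str \<Rightarrow> str set" where
  "kids D z = {ext D (c # z) | c. c # z \<in> Substr D}"

text \<open>If \<open>y\<close> is the string chosen for \<open>x\<close>, then the suffix
  \<open>c # y\<close> of \<open>x\<close> is too long to be inequivalent to \<open>x\<close>, so it
  names the node of \<open>x\<close>. Conversely, \<open>z\<close> is inequivalent to
  \<open>c # z\<close> because it is a representative.\<close>

lemma slinks_to_rep:
  assumes "finite D" "z \<in> reps D"
  shows "{v. (v, dawg_class D z) \<in> slinks D} = dawg_class D ` kids D z"
proof -
  let ?P = "\<lambda>x y. suffix y x \<and> endPos D y \<noteq> endPos D x"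
  let ?am = "\<lambda>x. ARG_MAX length y. ?P x y"
  have amI: "?am x = y" if "?P x y" "\<And>u. ?P x u \<Longrightarrow> length u \<le> length y" for x y
    by (rule arg_max_suffix_eq[of "?P x" _ x]) (use that in auto)
  have to: "\<exists>c. c # z \<in> Substr D \<and> dawg_class D x = dawg_class D (c # z)"
    if x: "x \<in> Substr D" "x \<noteq> []" and eq: "dawg_class D z = dawg_class D (?am x)" for x
  proof -
    obtain q j where qj: "(q, j) \<in> endPos D x" using x by (auto simp: Substr_endPos)
    \<comment> \<open>Position 0 is an occurrence of the empty string only, so \<open>[]\<close> is
      always a candidate and the maximum is attained.\<close>
    then have "(q, 0) \<in> endPos D []" "(q, 0) \<notin> endPos D x" using x(2) by (auto simp: endPos_suffix)
    then have P0: "?P x []" by auto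
    define y where "y = ?am x"
    have am: "?P x y" "\<And>u. ?P x u \<Longrightarrow> length u \<le> length y"
      using arg_max_suffix[of "?P x" "[]" x, OF P0] by (auto simp: y_def)
    have ez: "endPos D z = endPos D y" using eq assms(2) by (simp add: y_def dawg_class_eq reps_Substr)
    obtain u where u: "x = u @ y" using am(1) by (auto simp: suffix_def)
    moreover have "u \<noteq> []" using u am(1) by (metis append_Nil)
    ultimately obtain v c where c: "x = v @ c # y" by (metis append.assoc append_Cons append_Nil rev_exhaust)
    have suf: "suffix (c # y) x" using c by (metis suffixI)
    have eqc: "endPos D (c # y) = endPos D x"
      using am(2)[of "c # y"] suf by auto
    have "suffix y z" using rep_longest[OF assms(2), of "y"] ez am(1) Substr_sublist[OF x(1)] by auto
    \<comment> \<open>\<open>z\<close> shares the occurrence \<open>(q, j)\<close> with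
      \<open>x\<close> and is comparable with it. As a suffix of \<open>x\<close> it is no longer
      than \<open>y\<close> by maximality; as an extension of \<open>x\<close> it would make
      \<open>x\<close> equivalent to \<open>y\<close>.\<close>
    moreover have "suffix z y"
    proof -
      have "(q, j) \<in> endPos D z" using ez qj am(1) endPos_antimono by blast
      then consider "suffix z x" | "suffix x z" using qj endPos_comparable by blast
      then show ?thesis
      proof cases
        case 1
        then have "length z \<le> length y" using am(2)[of z] am(1) ez by auto
        then show ?thesis using 1 am(1) by (meson suffix_length_suffix)
      next
        case 2
        then have "endPos D x = endPos D y"
          using endPos_antimono[of x z D] endPos_antimono[of "y" x D] am(1) ez by blast
        then show ?thesis using am(1) by simp
      qed
    qed
    ultimately have "y = z" by (simp add: suffix_order.antisym)
    then show ?thesis using eqc suf Substr_sublist[OF x(1)] by (metis dawg_class_eq suffix_imp_sublist x(1))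
  qed
  have of_kid: "(dawg_class D (c # z), dawg_class D z) \<in> slinks D" if "c # z \<in> Substr D" for c
  proof -
    have "?am (c # z) = z"
    proof (rule amI)
      show "?P (c # z) z" using assms(2) that by (auto simp: reps_def suffix_Cons)
      show "\<And>u. ?P (c # z) u \<Longrightarrow> length u \<le> length z"
        by (auto simp: suffix_Cons dest: suffix_length_le)
    qed
    then show ?thesis using that by (force simp: slinks_def)
  qed
  have "{v. (v, dawg_class D z) \<in> slinks D} = {dawg_class D (c # z) | c. c # z \<in> Substr D}"
  proof (intro equalityI subsetI; clarify)
    fix v assume "(v, dawg_class D z) \<in> slinks D"
    then obtain x where "x \<in> Substr D" "x \<noteq> []" "v = dawg_class D x"
        "dawg_class D z = dawg_class D (?am x)"
      unfolding slinks_def by blast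
    then show "\<exists>c. v = dawg_class D (c # z) \<and> c # z \<in> Substr D" using to by blast
  qed (rule of_kid)
  also have "\<dots> = dawg_class D ` kids D z"
    by (simp add: kids_def setcompr_eq_image image_image, rule image_cong)
      (simp_all add: ext(4)[OF assms(1)])
  finally show ?thesis .
qed

lemma kids_reps: "finite D \<Longrightarrow> y \<in> kids D z \<Longrightarrow> y \<in> reps D \<and> strict_suffix z y"
  using ext(1,3) unfolding kids_def by (fastforce dest: suffix_ConsD')

text \<open>Each occurrence has a preceding character because \<open>z\<close> is no prefix of a
  pattern. The occurrences cannot all be preceded by the same character \<open>c\<close>, since then
  \<open>c # z\<close> would be equivalent to the representative \<open>z\<close>.\<close>

lemma kids_card:
  assumes "finite D" "z \<in> reps D" "z \<notin> Pref D"
  shows "2 \<le> card (kids D z)"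
proof -
  have "z \<noteq> []" using assms(3) by auto
  have prec: "\<exists>c. (q, j) \<in> endPos D (c # z)" if "(q, j) \<in> endPos D z" for q j
  proof -
    from that obtain u where u: "q \<in> D" "j \<le> length q" "take j q = u @ z"
      by (auto simp: endPos_suffix suffix_def)
    have "u \<noteq> []"
    proof
      assume "u = []"
      then have "prefix z q" using u(3) by (metis append_Nil take_is_prefix)
      then show False using assms(3) u(1) by (auto simp: Pref_def)
    qed
    then show ?thesis using u by (cases u rule: rev_cases) (auto simp: endPos_suffix suffix_def)
  qed
  have mem: "c # z \<in> Substr D" if "(q, j) \<in> endPos D (c # z)" for q j c
    using that by (auto simp: Substr_endPos)
  obtain q j where "(q, j) \<in> endPos D z" using \<open>z \<noteq> []\<close> reps_Substr[OF assms(2)] by (auto simp: Substr_endPos)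
  with prec obtain c where c: "(q, j) \<in> endPos D (c # z)" by blast
  then have "endPos D (c # z) \<noteq> endPos D z" using assms(2) mem by (auto simp: reps_def)
  then obtain q' j' where "(q', j') \<in> endPos D z" "(q', j') \<notin> endPos D (c # z)"
    using endPos_antimono[of z "c # z" D] by (auto simp: suffix_Cons)
  with prec obtain d where d: "(q', j') \<in> endPos D (d # z)" "(q', j') \<notin> endPos D (c # z)" by blast
  have "ext D (c # z) \<noteq> ext D (d # z)" using ext(2)[OF assms(1) mem[OF c]] ext(2)[OF assms(1) mem[OF d(1)]] d by auto
  moreover have "{ext D (c # z), ext D (d # z)} \<subseteq> kids D z" using mem c d by (auto simp: kids_def)
  moreover have "finite (kids D z)"
    by (rule finite_subset[of _ "Substr D"]) (use assms kids_reps reps_Substr in auto)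
  ultimately show ?thesis by (metis card_2_iff card_mono)
qed

text \<open>Together with \<open>kids_disjoint\<close> this identifies the suffix order on
  representatives with the ancestor order of the tree.\<close>

lemma kid_below:
  assumes "finite D" "z \<in> reps D" "y \<in> reps D" "strict_suffix z y"
  shows "\<exists>w\<in>kids D z. suffix w y"
proof -
  obtain u c where u: "y = u @ c # z"
    using assms(4) by (metis append_Nil append_butlast_last_id append.assoc append_Cons suffix_def strict_suffix_def)
  then have s: "suffix (c # z) y" by (simp add: suffix_def)
  then have "c # z \<in> Substr D" using Substr_sublist[OF reps_Substr[OF assms(3)]] by blast
  moreover have "suffix (ext D (c # z)) y" by (rule ext_suffix_rep[OF assms(1,3) s])
  ultimately show ?thesis by (auto simp: kids_def)
qed

text \<open>The character in front of the suffix \<open>z\<close> of \<open>y\<close> determines the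
  child.\<close>

lemma kids_disjoint:
  assumes "finite D" "w \<in> kids D z" "w' \<in> kids D z" "suffix w y" "suffix w' y"
  shows "w = w'"
proof -
  obtain c c' where c: "c # z \<in> Substr D" "w = ext D (c # z)" "c' # z \<in> Substr D" "w' = ext D (c' # z)"
    using assms(2,3) by (auto simp: kids_def)
  then have "suffix (c # z) y" "suffix (c' # z) y" using ext(3)[OF assms(1)] assms(4,5) suffix_order.trans by blast+
  then have "c # z = c' # z" by (rule suffix_eq_length) simp
  then show ?thesis using c by simp
qed

section \<open>Depth-first search in the tree of suffix links\<close>

text \<open>\<open>dfs ct st ch ws vs\<close>: started with the stack \<open>ws\<close>, the search visits \<open>vs\<close>. The vertices with
  \<open>st v \<noteq> 0\<close> are marked, and if \<open>ct\<close> holds, the search does not descend below them.\<close>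

inductive dfs :: "bool \<Rightarrow> (nat \<Rightarrow> nat) \<Rightarrow> (nat \<Rightarrow> nat list) \<Rightarrow> nat list \<Rightarrow> nat list \<Rightarrow> bool"
  for ct st ch where
  Nil: "dfs ct st ch [] []"
| Leaf: "st w \<noteq> 0 \<Longrightarrow> ct \<Longrightarrow> dfs ct st ch ws vs \<Longrightarrow> dfs ct st ch (w # ws) (w # vs)"
| Inner: "st w = 0 \<or> \<not> ct \<Longrightarrow> dfs ct st ch (rev (ch w) @ ws) vs \<Longrightarrow> dfs ct st ch (w # ws) (w # vs)"

lemma dfs_append: "dfs ct st ch xs vs \<Longrightarrow> dfs ct st ch ys us \<Longrightarrow> dfs ct st ch (xs @ ys) (vs @ us)"
  by (induction rule: dfs.induct) (auto intro: dfs.intros)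

text \<open>An unmarked vertex replaces itself on the stack by at least two others.\<close>

lemma dfs_length:
  assumes "dfs ct st ch ws vs" "\<And>v. v \<in> set vs \<Longrightarrow> st v = 0 \<Longrightarrow> 2 \<le> length (ch v)"
  shows "length vs + length ws \<le> 2 * length (filter (\<lambda>v. st v \<noteq> 0) vs)"
  using assms
proof (induction rule: dfs.induct)
  case (Inner w ws vs)
  then show ?case by (cases "st w = 0") force+
qed auto

text \<open>What a search starting at the children of \<open>z\<close> visits. A mark at
  \<open>z\<close> itself does not count; a marked node is still visited, and with \<open>ct\<close>
  only what lies below it is left out.\<close>

definition reach :: "bool \<Rightarrow> str set \<Rightarrow> str set \<Rightarrow> str \<Rightarrow> str set" where
  "reach ct R Mk z =
     {y \<in> R. strict_suffix z y \<and> (ct \<longrightarrow> (\<forall>m\<in>Mk. strict_suffix z m \<longrightarrow> \<not> strict_suffix m y))}"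

text \<open>Separates the search from the memory: \<open>n\<close> gives addresses,
  \<open>st\<close> stands for \<open>StateOf\<close> with its marks, and \<open>ch\<close> may list
  the children in any order. \<open>Mk\<close> has to contain all states, since only nodes without a
  state are known to branch. It is instantiated with \<open>marked D p\<close>, with this set up to
  the mark at the node of \<open>p\<close>, and with \<open>Pref D\<close>.\<close>

locale marked_dawg =
  fixes D :: "str set" and Mk :: "str set" and n :: "str \<Rightarrow> nat"
    and st :: "nat \<Rightarrow> nat" and ch :: "nat \<Rightarrow> nat list"
  assumes finite: "finite D"
    and Mk: "Pref D \<subseteq> Mk" "Mk \<subseteq> reps D"
    and st: "\<And>z. z \<in> reps D \<Longrightarrow> st (n z) \<noteq> 0 \<longleftrightarrow> z \<in> Mk"
    and ch: "\<And>z. z \<in> reps D \<Longrightarrow> \<exists>ys. distinct ys \<and> set ys = kids D z \<and> ch (n z) = map n ys"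
begin

lemma finite_reps: "finite (reps D)"
  by (rule finite_subset[of _ "Substr D"]) (use finite reps_Substr in auto)

text \<open>The recursion of the search, stated for the declarative set
  \<open>reach\<close>.\<close>

lemma reach_kids:
  assumes "z \<in> reps D"
  shows "reach ct (reps D) Mk z =
    (\<Union>y\<in>kids D z. insert y (if ct \<and> y \<in> Mk then {} else reach ct (reps D) Mk y))"
    (is "?L = ?R")
proof (intro equalityI subsetI)
  fix y assume y: "y \<in> ?L"
  then have yr: "y \<in> reps D" "strict_suffix z y" by (auto simp: reach_def)
  obtain w where w: "w \<in> kids D z" "suffix w y" using kid_below[OF finite assms yr] by blast
  note wr = kids_reps[OF finite w(1)]
  have "y = w \<or> (\<not> (ct \<and> w \<in> Mk) \<and> y \<in> reach ct (reps D) Mk w)"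
    using y w wr unfolding reach_def
    by (auto simp: strict_suffix_def)
  then show "y \<in> ?R" using w(1) by auto
next
  fix y assume "y \<in> ?R"
  then obtain w where w: "w \<in> kids D z" and y: "y = w \<or> (\<not> (ct \<and> w \<in> Mk) \<and> y \<in> reach ct (reps D) Mk w)"
    by (auto split: if_splits)
  note wr = kids_reps[OF finite w]
  then have yr: "y \<in> reps D" "suffix w y" "strict_suffix z y" using y
    by (auto simp: reach_def strict_suffix_def intro: suffix_order.trans dest: suffix_order.antisym)
  \<comment> \<open>A mark strictly between \<open>z\<close> and \<open>y\<close> lies in the
    subtree of the same child \<open>w\<close>, as no string lies below two children. So it is
    \<open>w\<close> itself or it already cuts \<open>y\<close> off from \<open>w\<close>.\<close>
  have "\<not> strict_suffix m y" if c: ct and m: "m \<in> Mk" "strict_suffix z m" for m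
  proof
    assume my: "strict_suffix m y"
    have mr: "m \<in> reps D" using m Mk by auto
    obtain w' where w': "w' \<in> kids D z" "suffix w' m" using kid_below[OF finite assms mr m(2)] by blast
    have "suffix w' y" using w'(2) my by (auto simp: strict_suffix_def intro: suffix_order.trans)
    then have "w' = w" using kids_disjoint[OF finite w'(1) w _ yr(2)] by blast
    then have wm: "suffix w m" using w' by simp
    then have "y \<noteq> w" using my by (auto simp: strict_suffix_def dest: suffix_order.antisym)
    then have "w \<notin> Mk" "y \<in> reach ct (reps D) Mk w" using y c by auto
    then show False using c m wm my unfolding reach_def strict_suffix_def by auto
  qed
  then show "y \<in> ?L" using yr by (auto simp: reach_def)
qed

lemma dfs_list:
  assumes "\<And>y. y \<in> set ys \<Longrightarrow>
      \<exists>zs. dfs ct st ch [n y] (map n zs) \<and> distinct zs \<and> set zs = V y"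
    "distinct ys" "\<And>y y'. y \<in> set ys \<Longrightarrow> y' \<in> set ys \<Longrightarrow> y \<noteq> y' \<Longrightarrow> V y \<inter> V y' = {}"
  shows "\<exists>zs. dfs ct st ch (map n ys) (map n zs) \<and> distinct zs \<and> set zs = (\<Union>y\<in>set ys. V y)"
  using assms
proof (induction ys)
  case Nil
  then show ?case by (auto intro: dfs.Nil)
next
  case (Cons y ys)
  from Cons.IH Cons.prems obtain zs where zs: "dfs ct st ch (map n ys) (map n zs)" "distinct zs"
    "set zs = (\<Union>y\<in>set ys. V y)" by auto
  from Cons.prems(1)[of y] obtain us where us: "dfs ct st ch [n y] (map n us)" "distinct us"
    "set us = V y" by auto
  have "distinct (us @ zs)" using zs us Cons.prems(2,3) by fastforce
  moreover have "dfs ct st ch (map n (y # ys)) (map n (us @ zs))"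
    using dfs_append[OF us(1) zs(1)] by simp
  ultimately show ?case using zs us by (intro exI[of _ "us @ zs"]) auto
qed

text \<open>Induction on the number of representatives strictly below \<open>z\<close>, which
  decreases from a node to its children. The children appear reversed because the program pushes
  them in the order of the array.\<close>

lemma dfs_reach:
  assumes "z \<in> reps D"
  shows "\<exists>zs. dfs ct st ch (rev (ch (n z))) (map n zs) \<and> distinct zs \<and>
    set zs = reach ct (reps D) Mk z"
  using assms
proof (induction "card {y \<in> reps D. strict_suffix z y}" arbitrary: z rule: less_induct)
  case less
  define V where "V y = insert y (if ct \<and> y \<in> Mk then {} else reach ct (reps D) Mk y)" for y
  obtain ys where ys: "distinct ys" "set ys = kids D z" "ch (n z) = map n ys" using ch less.prems by blast
  have "\<exists>zs. dfs ct st ch (map n (rev ys)) (map n zs) \<and> distinct zs \<and> set zs = (\<Union>y\<in>set (rev ys). V y)"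
  proof (rule dfs_list)
    fix y assume "y \<in> set (rev ys)"
    then have y: "y \<in> kids D z" using ys by simp
    note yr = kids_reps[OF finite y]
    have "y \<notin> {x \<in> reps D. strict_suffix y x}" by simp
    then have "{x \<in> reps D. strict_suffix y x} \<subset> {x \<in> reps D. strict_suffix z x}"
      using yr by (auto simp: strict_suffix_def intro: suffix_order.trans dest: suffix_order.antisym)
    then have "card {x \<in> reps D. strict_suffix y x} < card {x \<in> reps D. strict_suffix z x}"
      by (rule psubset_card_mono[rotated]) (simp add: finite_reps)
    from less.hyps[OF this] yr obtain zs where zs: "dfs ct st ch (rev (ch (n y))) (map n zs)"
      "distinct zs" "set zs = reach ct (reps D) Mk y" by blast
    show "\<exists>zs. dfs ct st ch [n y] (map n zs) \<and> distinct zs \<and> set zs = V y"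
    proof (cases "ct \<and> y \<in> Mk")
      case True
      then show ?thesis using st yr by (intro exI[of _ "[y]"]) (auto simp: V_def intro: dfs.intros)
    next
      case False
      then have "dfs ct st ch [n y] (map n (y # zs))"
        using st[of y] yr zs(1) by (auto intro!: dfs.Inner)
      moreover have "y \<notin> set zs" by (auto simp: zs reach_def)
      ultimately show ?thesis using False zs by (intro exI[of _ "y # zs"]) (auto simp: V_def)
    qed
  next
    fix y y' assume y: "y \<in> set (rev ys)" "y' \<in> set (rev ys)" "y \<noteq> y'"
    have V: "V y \<subseteq> {x. suffix y x}" for y by (auto simp: V_def reach_def strict_suffix_def)
    have "\<not> (suffix y x \<and> suffix y' x)" for x
      using y kids_disjoint[OF finite, of y z y' x] ys(2) by auto
    with V[of y] V[of y'] show "V y \<inter> V y' = {}" by auto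
  qed (use ys in simp)
  then show ?case using ys(2,3) reach_kids[OF less.prems, of ct] by (simp add: V_def rev_map)
qed

text \<open>\<open>dfs_length\<close> counts list entries. As no node is visited twice, the marked
  entries can be counted as a set, and \<open>kids_card\<close> provides the two children of every
  unmarked node.\<close>

lemma dfs_card:
  assumes "dfs ct st ch ws (map n zs)" "distinct zs" "set zs \<subseteq> reps D"
  shows "length zs \<le> 2 * card (set zs \<inter> Mk)"
proof -
  have "2 \<le> length (ch v)" if v: "v \<in> set (map n zs)" "st v = 0" for v
  proof -
    from v obtain z where z: "z \<in> reps D" "v = n z" "z \<notin> Pref D" using st Mk assms(3) by fastforce
    then obtain ys where "distinct ys" "set ys = kids D z" "ch (n z) = map n ys" using ch by blast
    then show ?thesis using kids_card[OF finite z(1,3)] z(2) by (metis distinct_card length_map)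
  qed
  from dfs_length[OF assms(1) this]
  have "length zs \<le> 2 * length (filter (\<lambda>v. st v \<noteq> 0) (map n zs))" by simp
  also have "length (filter (\<lambda>v. st v \<noteq> 0) (map n zs)) = length (filter (\<lambda>z. z \<in> Mk) zs)"
    using assms(3) st by (auto simp: filter_map o_def intro!: arg_cong[of _ _ length] filter_cong)
  also have "\<dots> = card (set zs \<inter> Mk)"
    using assms(2) by (metis distinct_card distinct_filter set_filter Collect_conj_eq Int_def Collect_mem_eq)
  finally show ?thesis .
qed

lemma dfs_below:
  assumes "z \<in> reps D"
  shows "\<exists>zs. dfs False st ch [n z] (map n zs) \<and> set zs = {y \<in> reps D. suffix z y} \<and>
     length zs \<le> 2 * card ({y. suffix z y} \<inter> Mk)"
proof -
  obtain zs where zs: "dfs False st ch (rev (ch (n z))) (map n zs)" "distinct zs"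
    "set zs = reach False (reps D) Mk z" using dfs_reach[OF assms] by blast
  have d: "dfs False st ch [n z] (map n (z # zs))" using zs(1) by (auto intro!: dfs.Inner)
  have s: "set (z # zs) = {y \<in> reps D. suffix z y}" "distinct (z # zs)"
    using zs assms by (auto simp: reach_def strict_suffix_def)
  have "set (z # zs) \<inter> Mk = {y. suffix z y} \<inter> Mk" using s Mk by auto
  then show ?thesis using d s dfs_card[OF d s(2)] by (intro exI[of _ "z # zs"]) auto
qed

text \<open>The search starts with the children, so that a mark at the start node does not stop it
  at once.\<close>

lemma dfs_near:
  assumes "z \<in> reps D"
  shows "\<exists>zs. dfs True st ch (rev (ch (n z))) (map n zs) \<and> set zs = reach True (reps D) Mk z \<and>
     length zs \<le> 2 * card (reach True (reps D) Mk z \<inter> Mk)"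
proof -
  obtain zs where zs: "dfs True st ch (rev (ch (n z))) (map n zs)" "distinct zs"
    "set zs = reach True (reps D) Mk z" using dfs_reach[OF assms] by blast
  then show ?thesis using dfs_card[OF zs(1,2)] by (auto simp: reach_def)
qed

end

section \<open>Failure links after an insertion\<close>

text \<open>The new states that already have a node. No other new state can be the failure link of
  an old state, which is a substring of that state.\<close>

definition fresh :: "str set \<Rightarrow> str \<Rightarrow> str set" where
  "fresh D p = {x. prefix x p \<and> x \<notin> Pref D \<and> x \<in> Substr D}"

definition marked :: "str set \<Rightarrow> str \<Rightarrow> str set" where
  "marked D p = Pref D \<union> ext D ` fresh D p"

text \<open>Different prefixes of \<open>p\<close> are nested and therefore never equivalent.
  Consequently no node receives two marks.\<close>

lemma ext_inj_prefixes:
  assumes "finite D" "prefix x p" "prefix y p" "x \<in> Substr D" "y \<in> Substr D" "ext D x = ext D y"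
  shows "x = y"
proof (rule ccontr)
  assume "x \<noteq> y"
  then consider "strict_prefix x y" | "strict_prefix y x"
    using assms(2,3) prefix_same_cases by (metis strict_prefixI)
  moreover have "endPos D x = endPos D y" using assms ext(2) by metis
  ultimately show False using endPos_strict_prefix assms(4,5) by metis
qed

lemma ext_fresh_inj: "finite D \<Longrightarrow> inj_on (ext D) (fresh D p)"
  by (rule inj_onI) (auto simp: fresh_def intro: ext_inj_prefixes)

lemma finite_fresh: "finite (fresh D p)"
  by (rule finite_subset[of _ "set (prefixes p)"]) (auto simp: fresh_def)

text \<open>The empty prefix is always an old state, which leaves at most \<open>length p\<close>
  prefixes.\<close>

lemma card_fresh: "card (fresh D p) \<le> length p"
proof -
  have "fresh D p \<subseteq> set (prefixes p) - {[]}" by (auto simp: fresh_def)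
  then have "card (fresh D p) \<le> card (set (prefixes p) - {[]})" by (rule card_mono[rotated]) simp
  also have "\<dots> = length p" by simp
  finally show ?thesis .
qed

lemma strict_suffix_iff: "strict_suffix t s \<longleftrightarrow> suffix t s \<and> t \<noteq> s"
  by (auto simp: strict_suffix_def)

context
  fixes D D' :: "str set" and p :: str
  assumes fin: "finite D" and pne: "p \<noteq> []" and D': "D' = D \<union> {p}"
begin

lemma Pref_D': "u \<in> Pref D' \<longleftrightarrow> u \<in> Pref D \<or> prefix u p"
  using Pref_insert[OF pne] by (auto simp: D')

text \<open>An old state \<open>u\<close> is its own representative and thus extends
  \<open>ext D x\<close>. A new prefix \<open>u\<close> of \<open>p\<close> is squeezed into the
  class of \<open>x\<close>, and a class contains only one prefix of \<open>p\<close>.\<close>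

lemma between_fresh:
  assumes x: "x \<in> fresh D p" and u: "u \<in> Pref D'" "suffix x u" "suffix u (ext D x)"
  shows "u = x \<or> u = ext D x"
proof (cases "u \<in> Pref D")
  case True
  have "suffix (ext D x) u" using ext_suffix_rep[OF fin Pref_reps[OF True] u(2)] .
  then show ?thesis using u(3) by (simp add: suffix_order.antisym)
next
  case False
  have xs: "x \<in> Substr D" "prefix x p" using x by (auto simp: fresh_def)
  note e = ext[OF fin xs(1)]
  have us: "u \<in> Substr D" using u(3) e(1) reps_Substr Substr_sublist suffix_imp_sublist by meson
  have "endPos D u = endPos D x"
    using endPos_antimono[OF u(2), of D] endPos_antimono[OF u(3), of D] e(2) by auto
  moreover have "prefix u p" using u(1) False by (simp add: Pref_D')
  ultimately have "u = x" using ext_inj_prefixes[OF fin _ xs(2) us xs(1)] ext_eq fin us xs e by metis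
  then show ?thesis ..
qed

text \<open>The case in which the node of \<open>x\<close> carries an old state: by
  \<open>between_fresh\<close> no other state of the new automaton lies between the two. No search
  is started for such an \<open>x\<close>.\<close>

lemma flink_fresh_ext:
  assumes x: "x \<in> fresh D p" and e: "ext D x \<in> Pref D"
  shows "flink D' (ext D x) = x"
proof -
  have xs: "x \<in> Substr D" "prefix x p" "x \<notin> Pref D" using x by (auto simp: fresh_def)
  note ex = ext[OF fin xs(1)]
  have ne: "x \<noteq> ext D x" using e xs by auto
  then have ene: "ext D x \<noteq> []" using ex(3) by auto
  show ?thesis unfolding flink_longest[OF ene]
  proof (rule longest_eqI)
    show "x \<in> Pref D'" using xs by (simp add: Pref_D')
    show s: "suffix x (tl (ext D x))" using ne ex(3) by (simp add: suffix_tl_iff[OF ene] strict_suffix_iff)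
    fix u assume u: "u \<in> Pref D'" "suffix u (tl (ext D x))"
    then have us: "suffix u (ext D x)" "u \<noteq> ext D x" by (auto simp: suffix_tl_iff[OF ene] strict_suffix_iff)
    show "length u \<le> length x"
    proof (rule ccontr)
      assume "\<not> length u \<le> length x"
      moreover from this have "suffix x u" using us(1) ex(3) by (meson nle_le suffix_length_suffix)
      ultimately show False using between_fresh[OF x u(1) _ us(1)] us(2) by auto
    qed
  qed
qed

text \<open>A competitor \<open>u\<close> longer than \<open>x\<close> would put a mark strictly
  between \<open>ext D x\<close> and \<open>s\<close>: the node of \<open>u\<close> itself if
  \<open>u\<close> is an old state, and the node \<open>ext D u\<close> if \<open>u\<close> is
  fresh. States that sit at the node of a fresh prefix are excluded because
  \<open>flink_fresh_ext\<close> gives them a different link.\<close>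

lemma flink_fresh_near:
  assumes x: "x \<in> fresh D p" and e: "ext D x \<notin> Pref D"
    and s: "s \<in> Pref D" "s \<notin> ext D ` fresh D p" "s \<in> reach True (reps D) (marked D p) (ext D x)"
  shows "flink D' s = x"
proof -
  have xs: "x \<in> Substr D" "prefix x p" "x \<notin> Pref D" using x by (auto simp: fresh_def)
  note ex = ext[OF fin xs(1)]
  have es: "strict_suffix (ext D x) s" using s(3) by (simp add: reach_def)
  then have sne: "s \<noteq> []" by (auto simp: strict_suffix_iff)
  have xss: "suffix x s" "x \<noteq> s" using es ex(3) xs(3) s(1) by (auto simp: strict_suffix_iff intro: suffix_order.trans)
  have no: "\<not> strict_suffix m s" if "m \<in> marked D p" "strict_suffix (ext D x) m" for m
    using s(3) that by (simp add: reach_def)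
  show ?thesis unfolding flink_longest[OF sne]
  proof (rule longest_eqI)
    show "x \<in> Pref D'" using xs by (simp add: Pref_D')
    show "suffix x (tl s)" using xss by (simp add: suffix_tl_iff[OF sne] strict_suffix_iff)
    fix u assume u: "u \<in> Pref D'" "suffix u (tl s)"
    then have us: "suffix u s" "u \<noteq> s" by (auto simp: suffix_tl_iff[OF sne] strict_suffix_iff)
    show "length u \<le> length x"
    proof (rule ccontr)
      assume n: "\<not> length u \<le> length x"
      then have xu: "suffix x u" "x \<noteq> u" using us(1) xss(1) by (auto intro: suffix_length_suffix)
      have uS: "u \<in> Substr D" using us(1) s(1) Pref_Substr Substr_sublist suffix_imp_sublist by meson
      show False
      proof (cases "u \<in> Pref D")
        case True
        then have "suffix (ext D x) u" using ext_suffix_rep[OF fin Pref_reps xu(1)] by blast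
        then have "strict_suffix (ext D x) u" using True e by (auto simp: strict_suffix_iff)
        then show False using no[of u] us True by (auto simp: marked_def strict_suffix_iff)
      next
        case False
        then have uf: "u \<in> fresh D p" using u(1) uS by (auto simp: fresh_def Pref_D')
        have "suffix (ext D u) s" using ext_suffix_rep[OF fin Pref_reps[OF s(1)] us(1)] .
        moreover have "ext D u \<noteq> s" using uf s(2) by auto
        moreover have "suffix (ext D x) (ext D u)"
          using ext_suffix_rep[OF fin ext(1)[OF fin uS]] ext(3)[OF fin uS] xu(1) suffix_order.trans by blast
        moreover have "ext D x \<noteq> ext D u" using ext_fresh_inj[OF fin, of p] x uf xu(2) by (auto simp: inj_on_def)
        ultimately show False using no[of "ext D u"] uf by (auto simp: marked_def strict_suffix_iff)
      qed
    qed
  qed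
qed

text \<open>The converse of the two preceding lemmas, so that the program misses no state. The new
  link \<open>x\<close> is not an old state, since it would then have been the link before; as a
  suffix of \<open>s\<close> it occurs in \<open>D\<close>, so it is fresh.\<close>

lemma flink_insert_changed:
  assumes s: "s \<in> Pref D" "s \<noteq> []" and ch: "flink D' s \<noteq> flink D s"
  shows "\<exists>x\<in>fresh D p. s = ext D x \<or> (s \<notin> ext D ` fresh D p \<and> ext D x \<notin> Pref D \<and>
    s \<in> reach True (reps D) (marked D p) (ext D x))"
proof -
  define x where "x = flink D' s"
  have x': "x = longest (Pref D') (tl s)" by (simp add: x_def flink_longest s)
  have x: "x \<in> Pref D'" "suffix x (tl s)" and mx: "\<And>t. t \<in> Pref D' \<Longrightarrow> suffix t (tl s) \<Longrightarrow> suffix t x"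
    unfolding x' by (auto intro: longest)
  have xs: "suffix x s" "x \<noteq> s" using x(2) by (auto simp: suffix_tl_iff[OF s(2)] strict_suffix_iff)
  have mx': "suffix t x" if "t \<in> Pref D'" "suffix t s" "t \<noteq> s" for t
    using mx that by (simp add: suffix_tl_iff[OF s(2)] strict_suffix_iff)
  have "x \<notin> Pref D"
  proof
    assume "x \<in> Pref D"
    then have "flink D s = x" unfolding flink_longest[OF s(2)]
      by (rule longest_eqI) (use x mx in \<open>auto simp: Pref_D' intro: suffix_length_le\<close>)
    then show False using ch x_def by simp
  qed
  moreover have xS: "x \<in> Substr D" using xs(1) s(1) Pref_Substr Substr_sublist suffix_imp_sublist by meson
  ultimately have xf: "x \<in> fresh D p" using x(1) by (auto simp: fresh_def Pref_D')
  let ?e = "ext D x"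
  note ex = ext[OF fin xS]
  have es: "suffix ?e s" using ext_suffix_rep[OF fin Pref_reps[OF s(1)] xs(1)] .
  show ?thesis
  proof (cases "s = ?e")
    case True
    then show ?thesis using xf by auto
  next
    case False
    \<comment> \<open>As \<open>x\<close> is the longest candidate, a fresh suffix \<open>y\<close>
      of \<open>s\<close> is a suffix of \<open>x\<close>; if moreover \<open>x\<close> is a suffix
      of \<open>ext D y\<close>, then \<open>between_fresh\<close> leaves only the two ends.\<close>
    have fr: "y = x \<or> x = ext D y" if "y \<in> fresh D p" "suffix y s" "suffix x (ext D y)" for y
    proof -
      have "y \<in> Pref D'" "y \<noteq> s" using that s(1) by (auto simp: fresh_def Pref_D')
      then show ?thesis using between_fresh[OF that(1) x(1) mx' that(3)] that(2) by auto
    qed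
    have 1: "?e \<notin> Pref D"
    proof
      assume e: "?e \<in> Pref D"
      then have "suffix ?e x" using mx'[of ?e] es False by (auto simp: Pref_D')
      then show False using ex(3) e \<open>x \<notin> Pref D\<close> by (metis suffix_order.antisym)
    qed
    have 2: "s \<notin> ext D ` fresh D p"
    proof
      assume "s \<in> ext D ` fresh D p"
      then obtain y where y: "y \<in> fresh D p" "s = ext D y" by auto
      then have "suffix y s" using ext(3)[OF fin] by (auto simp: fresh_def)
      then show False using fr[OF y(1)] y xs False by auto
    qed
    have "\<not> strict_suffix m s" if m: "m \<in> marked D p" "strict_suffix ?e m" for m
    proof
      assume ms: "strict_suffix m s"
      have xm: "suffix x m" "x \<noteq> m" using m(2) ex(3) by (auto simp: strict_suffix_iff intro: suffix_order.trans dest: suffix_order.antisym)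
      show False
      proof (cases "m \<in> Pref D")
        case True
        then have "suffix m x" using mx'[of m] ms by (auto simp: Pref_D' strict_suffix_iff)
        then show False using xm by (simp add: suffix_order.antisym)
      next
        case False
        then obtain y where y: "y \<in> fresh D p" "m = ext D y" using m(1) by (auto simp: marked_def)
        then have "suffix y s" using ext(3)[OF fin, of y] ms
          by (auto simp: fresh_def strict_suffix_iff intro: suffix_order.trans)
        then show False using fr[OF y(1)] y xm m(2) by auto
      qed
    qed
    then have "s \<in> reach True (reps D) (marked D p) ?e"
      using Pref_reps[OF s(1)] es False by (auto simp: reach_def strict_suffix_iff)
    then show ?thesis using xf 1 2 by auto
  qed
qed

lemma marked_reps: "Pref D \<subseteq> marked D p" "marked D p \<subseteq> reps D"
  using Pref_reps ext(1)[OF fin] by (auto simp: marked_def fresh_def)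

text \<open>The starting nodes are marked themselves. If two searches met in \<open>s\<close>, one
  starting node would lie strictly between the other one and \<open>s\<close> and cut the search. So
  the marks met are pairwise different, and each is an old state whose link changes, counted by
  \<open>u_f\<close>, or the node of a fresh prefix, of which there are at most
  \<open>length p\<close>.\<close>

lemma near_sum:
  "(\<Sum>x\<in>{x \<in> fresh D p. ext D x \<notin> Pref D}. card (reach True (reps D) (marked D p) (ext D x) \<inter> marked D p))
    \<le> u_f D D' + length p"
proof -
  let ?X = "{x \<in> fresh D p. ext D x \<notin> Pref D}"
  let ?N = "\<lambda>x. reach True (reps D) (marked D p) (ext D x) \<inter> marked D p"
  let ?C = "{s \<in> Pref D \<inter> Pref D'. s \<noteq> [] \<and> flink D s \<noteq> flink D' s}"
  have fm: "finite (marked D p)" using finite_fresh fin by (simp add: marked_def)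
  have "?N x \<inter> ?N y = {}" if xy: "x \<in> ?X" "y \<in> ?X" "x \<noteq> y" for x y
  proof (rule ccontr)
    assume "?N x \<inter> ?N y \<noteq> {}"
    then obtain s where s: "s \<in> ?N x" "s \<in> ?N y" by blast
    have ne: "ext D x \<noteq> ext D y" using ext_fresh_inj[OF fin, of p] xy by (auto simp: inj_on_def)
    have m: "ext D x \<in> marked D p" "ext D y \<in> marked D p" using xy by (auto simp: marked_def)
    have "strict_suffix (ext D x) s" "strict_suffix (ext D y) s" using s by (auto simp: reach_def)
    moreover from this consider "strict_suffix (ext D x) (ext D y)" | "strict_suffix (ext D y) (ext D x)"
      using ne suffix_same_cases by (auto simp: strict_suffix_iff)
    ultimately show False using s m by cases (auto simp: reach_def)
  qed
  then have "(\<Sum>x\<in>?X. card (?N x)) = card (\<Union>x\<in>?X. ?N x)"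
    using fm finite_fresh by (subst card_UN_disjoint) auto
  also have "\<dots> \<le> card (?C \<union> ext D ` fresh D p)"
  proof (rule card_mono)
    show "finite (?C \<union> ext D ` fresh D p)" using fin finite_fresh by simp
    show "(\<Union>x\<in>?X. ?N x) \<subseteq> ?C \<union> ext D ` fresh D p"
    proof
      fix s assume "s \<in> (\<Union>x\<in>?X. ?N x)"
      then obtain x where x: "x \<in> fresh D p" "ext D x \<notin> Pref D" "s \<in> ?N x" by auto
      show "s \<in> ?C \<union> ext D ` fresh D p"
      proof (cases "s \<in> ext D ` fresh D p")
        case False
        then have s: "s \<in> Pref D" using x(3) by (auto simp: marked_def)
        have ne: "s \<noteq> []" using x(3) by (auto simp: reach_def strict_suffix_iff)
        \<comment> \<open>The new link is no old state whereas the previous link was one; so the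
          link of \<open>s\<close> really changes.\<close>
        have "flink D' s = x" using flink_fresh_near[OF x(1,2) s False] x(3) by auto
        moreover have "flink D s \<in> Pref D" by (simp add: flink_longest ne longest)
        moreover have "x \<notin> Pref D" using x(1) by (simp add: fresh_def)
        ultimately have "s \<in> ?C" using s ne by (auto simp: Pref_D')
        then show ?thesis by blast
      qed simp
    qed
  qed
  also have "\<dots> \<le> card ?C + card (ext D ` fresh D p)" by (rule card_Un_le)
  also have "\<dots> \<le> u_f D D' + length p"
    unfolding u_f_def using card_image_le[OF finite_fresh, of "ext D" D p] card_fresh[of D p] by linarith
  finally show ?thesis .
qed

end

text \<open>The recurrence of Aho and Corasick. That \<open>f\<close> is the longest candidate with
  a transition by \<open>c\<close> is expressed by the suffix order, as this is what following
  failure links preserves.\<close>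

lemma flink_snoc:
  assumes "x \<noteq> []" "f \<in> Pref D" "suffix f (tl x)" "f @ [c] \<in> Pref D"
    "\<And>t. t \<in> Pref D \<Longrightarrow> suffix t (tl x) \<Longrightarrow> t @ [c] \<in> Pref D \<Longrightarrow> suffix t f"
  shows "flink D (x @ [c]) = f @ [c]"
proof -
  have "tl (x @ [c]) = tl x @ [c]" using assms(1) by simp
  moreover have "longest (Pref D) (tl x @ [c]) = f @ [c]"
  proof (rule longest_eqI)
    fix u assume u: "u \<in> Pref D" "suffix u (tl x @ [c])"
    show "length u \<le> length (f @ [c])"
    proof (cases u rule: rev_cases)
      case (snoc t d)
      then have t: "d = c" "suffix t (tl x)" using u(2) by auto
      then have "suffix t f" using assms(5)[of t] u(1) snoc Pref_prefix[of u D t] by auto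
      then show ?thesis using snoc by (auto dest: suffix_length_le)
    qed simp
  qed (use assms in auto)
  ultimately show ?thesis by (simp add: flink_longest)
qed

lemma flink_snoc_Nil:
  assumes "x \<noteq> []" "\<And>t. t \<in> Pref D \<Longrightarrow> suffix t (tl x) \<Longrightarrow> t @ [c] \<notin> Pref D"
  shows "flink D (x @ [c]) = []"
proof -
  have "tl (x @ [c]) = tl x @ [c]" using assms(1) by simp
  moreover have "longest (Pref D) (tl x @ [c]) = []"
  proof (rule longest_eqI)
    fix u assume u: "u \<in> Pref D" "suffix u (tl x @ [c])"
    show "length u \<le> length []"
    proof (cases u rule: rev_cases)
      case (snoc t d)
      then show ?thesis using assms(2)[of t] u Pref_prefix[of u D t] by auto
    qed simp
  qed auto
  ultimately show ?thesis by (simp add: flink_longest)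
qed

section \<open>Failure links after a deletion\<close>

text \<open>With the states as the only marks, the search stops at the first state on every branch
  below \<open>x\<close>. These are the states for which no state lies strictly between
  \<open>x\<close> and them, which inverts the failure function.\<close>

lemma near_states:
  assumes "x \<in> Pref D"
  shows "reach True (reps D) (Pref D) x \<inter> Pref D = {s \<in> Pref D. s \<noteq> [] \<and> flink D s = x}"
proof (intro equalityI subsetI)
  fix s assume "s \<in> reach True (reps D) (Pref D) x \<inter> Pref D"
  then have s: "s \<in> reach True (reps D) (Pref D) x" "s \<in> Pref D" by auto
  then have ss: "strict_suffix x s" by (simp add: reach_def)
  then have ne: "s \<noteq> []" by (auto simp: strict_suffix_iff)
  have "longest (Pref D) (tl s) = x"
  proof (rule longest_eqI)
    show "suffix x (tl s)" using ss suffix_tl_iff[OF ne] by simp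
    fix u assume u: "u \<in> Pref D" "suffix u (tl s)"
    then have us: "strict_suffix u s" using suffix_tl_iff[OF ne] by simp
    then have "\<not> strict_suffix x u" using s(1) u(1) by (auto simp: reach_def)
    then show "length u \<le> length x"
      using ss us by (metis nle_le strict_suffix_iff suffix_length_suffix)
  qed (rule assms)
  then show "s \<in> {s \<in> Pref D. s \<noteq> [] \<and> flink D s = x}" using ne s by (simp add: flink_longest)
next
  fix s assume "s \<in> {s \<in> Pref D. s \<noteq> [] \<and> flink D s = x}"
  then have s: "s \<in> Pref D" "s \<noteq> []" "x = flink D s" by auto
  note l = longest[of "Pref D", OF Nil_in_Pref, where s = "tl s"]
  have "strict_suffix x s" using l(2) s by (simp add: flink_longest suffix_tl_iff)
  moreover have "\<not> strict_suffix m s" if "m \<in> Pref D" "strict_suffix x m" for m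
  proof
    assume "strict_suffix m s"
    then have "suffix m x" using l(3)[of m] that s by (simp add: flink_longest suffix_tl_iff)
    then show False using that(2) by (auto simp: strict_suffix_iff dest: suffix_order.antisym)
  qed
  ultimately show "s \<in> reach True (reps D) (Pref D) x \<inter> Pref D"
    using s Pref_reps by (auto simp: reach_def)
qed

text \<open>Removing states in the order of increasing length, the failure links to the removed state are
  redirected to the target of its own failure link, which has survived.\<close>

definition remaining :: "str set \<Rightarrow> str \<Rightarrow> nat \<Rightarrow> nat \<Rightarrow> str set" where
  "remaining D p k j = Pref D - {take i p | i. k < i \<and> i \<le> j}"

lemma Nil_in_remaining [simp]: "p \<noteq> [] \<Longrightarrow> [] \<in> remaining D p k j"
  by (auto simp: remaining_def)

text \<open>The condition speaks of the original link \<open>flink D s\<close>, which a search in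
  the unchanged DAWG finds. A link that was redirected earlier cannot point to
  \<open>take (Suc j) p\<close> now: its original target would have \<open>take (Suc j) p\<close> as
  a suffix, yet it was removed earlier and is therefore shorter.\<close>

lemma remaining_step:
  assumes p: "p \<in> D" "p \<noteq> []" and j: "k \<le> j" "j < length p" and s: "s \<noteq> []"
  shows "longest (remaining D p k (Suc j)) (tl s) =
    (if flink D s = take (Suc j) p then longest (remaining D p k j) (tl (take (Suc j) p))
     else longest (remaining D p k j) (tl s))"
proof -
  let ?x = "take (Suc j) p"
  let ?A = "remaining D p k j" and ?B = "remaining D p k (Suc j)"
  have xP: "?x \<in> Pref D" using p take_is_prefix by (auto simp: Pref_def)
  have "take i p \<noteq> ?x" if "i \<le> j" for i
  proof -
    have "length (take i p) \<noteq> length ?x" using that j by simp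
    then show ?thesis by metis
  qed
  then have xA: "?x \<in> ?A" using xP by (auto simp: remaining_def) (metis)
  have B: "?B = ?A - {?x}" using j(1) by (auto simp: remaining_def le_Suc_eq)
  have NA: "[] \<in> ?A" "[] \<in> ?B" using p by auto
  have xne: "?x \<noteq> []" using p(2) by simp
  show ?thesis
  proof (cases "flink D s = ?x")
    case True
    then have l: "longest (Pref D) (tl s) = ?x" using s by (simp add: flink_longest)
    have "longest ?B (tl s) = longest ?B ?x"
    proof (rule longest_trans[symmetric, OF NA(2)])
      show "suffix ?x (tl s)" using longest(2)[of "Pref D" "tl s"] l by simp
      have "longest ?B (tl s) \<in> Pref D" using longest(1)[OF NA(2)] by (auto simp: remaining_def)
      then show "suffix (longest ?B (tl s)) ?x"
        using longest(3)[of "Pref D" "longest ?B (tl s)" "tl s"] longest(2)[OF NA(2)] l by simp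
    qed
    also have "\<dots> = longest ?B (tl ?x)" using longest_tl[OF NA(2), of ?x] B by simp
    also have "\<dots> = longest ?A (tl ?x)"
    proof (rule longest_eqI)
      note l = longest[OF NA(1), where s = "tl ?x"]
      have "longest ?A (tl ?x) \<noteq> ?x" using l(2) strict_suffix_tl[OF xne] by (auto simp: strict_suffix_iff dest: suffix_order.antisym)
      then show "longest ?A (tl ?x) \<in> ?B" using l(1) B by simp
      show "suffix (longest ?A (tl ?x)) (tl ?x)" by (rule l)
      show "length u \<le> length (longest ?A (tl ?x))" if "u \<in> ?B" "suffix u (tl ?x)" for u
        using l(3)[of u] that B by (auto intro: suffix_length_le)
    qed
    finally show ?thesis using True by simp
  next
    case False
    have "longest ?A (tl s) \<noteq> ?x"
    proof
      assume l: "longest ?A (tl s) = ?x"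
      let ?f = "longest (Pref D) (tl s)"
      have f: "?f \<in> Pref D" "suffix ?f (tl s)" "suffix ?x ?f"
        using longest[of "Pref D", where s = "tl s"] longest(2)[OF NA(1), of "tl s"] l xP by auto
      have "?f \<notin> ?A"
      proof
        assume "?f \<in> ?A"
        then have "suffix ?f ?x" using longest(3)[OF NA(1) _ f(2)] l by simp
        then show False using f(3) False s by (simp add: flink_longest suffix_order.antisym)
      qed
      then obtain i where "i \<le> j" "?f = take i p" using f(1) by (auto simp: remaining_def)
      then show False using f(3) j(2) by (auto dest!: suffix_length_le)
    qed
    note l = longest[OF NA(1), where s = "tl s"]
    have "longest ?B (tl s) = longest ?A (tl s)"
    proof (rule longest_eqI)
      show "longest ?A (tl s) \<in> ?B" using l(1) B \<open>longest ?A (tl s) \<noteq> ?x\<close> by simp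
      show "length u \<le> length (longest ?A (tl s))" if "u \<in> ?B" "suffix u (tl s)" for u
        using l(3)[of u] that B by (auto intro: suffix_length_le)
    qed (rule l)
    then show ?thesis using False by simp
  qed
qed

lemma Pref_delete_prefix:
  assumes "x \<in> Pref D" "x \<notin> Pref (D - {p})" shows "prefix x p \<and> x \<noteq> []"
  using assms by (auto simp: Pref_def)

lemma remaining_all:
  assumes "p \<in> D" "\<And>i. i \<le> length p \<Longrightarrow> take i p \<in> Pref (D - {p}) \<longleftrightarrow> i \<le> k"
  shows "remaining D p k (length p) = Pref (D - {p})"
proof (intro equalityI subsetI)
  fix x assume x: "x \<in> remaining D p k (length p)"
  show "x \<in> Pref (D - {p})"
  proof (rule ccontr)
    assume n: "x \<notin> Pref (D - {p})"
    then have "prefix x p" using x Pref_delete_prefix by (auto simp: remaining_def)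
    then have "x = take (length x) p" "length x \<le> length p" by (auto simp: prefix_def)
    then show False using assms(2)[of "length x"] n x by (auto simp: remaining_def)
  qed
next
  fix x assume x: "x \<in> Pref (D - {p})"
  moreover have "x \<in> Pref D" using x by (auto simp: Pref_def)
  ultimately show "x \<in> remaining D p k (length p)" using assms(2) by (auto simp: remaining_def)
qed

text \<open>A state linked to a removed state is either removed itself, hence one of at most
  \<open>length p\<close> nonempty prefixes of \<open>p\<close>, or it survives and its link has to
  change, hence is counted by \<open>u_f\<close>.\<close>

lemma redirected_sum:
  assumes "finite D" "\<And>j. k < j \<Longrightarrow> j \<le> length p \<Longrightarrow> take j p \<notin> Pref (D - {p})"
  shows "(\<Sum>j\<in>{k<..length p}. card {s \<in> Pref D. s \<noteq> [] \<and> flink D s = take j p})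
    \<le> u_f D (D - {p}) + length p"
proof -
  let ?N = "\<lambda>j. {s \<in> Pref D. s \<noteq> [] \<and> flink D s = take j p}"
  let ?D' = "D - {p}"
  let ?C = "{s \<in> Pref D \<inter> Pref ?D'. s \<noteq> [] \<and> flink D s \<noteq> flink ?D' s}"
  let ?R = "set (prefixes p) - {[]}"
  have "?N i \<inter> ?N j = {}" if "i \<in> {k<..length p}" "j \<in> {k<..length p}" "i \<noteq> j" for i j
  proof -
    have "length (take i p) \<noteq> length (take j p)" using that by simp
    then have "take i p \<noteq> take j p" by metis
    then show ?thesis by auto
  qed
  then have "(\<Sum>j\<in>{k<..length p}. card (?N j)) = card (\<Union>j\<in>{k<..length p}. ?N j)"
    using assms by (subst card_UN_disjoint) auto
  also have "\<dots> \<le> card (?C \<union> ?R)"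
  proof (rule card_mono)
    show "finite (?C \<union> ?R)" using assms by simp
    have "flink ?D' s \<in> Pref ?D'" if "s \<noteq> []" for s using that by (simp add: flink_longest longest)
    then show "(\<Union>j\<in>{k<..length p}. ?N j) \<subseteq> ?C \<union> ?R"
      using assms(2) Pref_delete_prefix by fastforce
  qed
  also have "\<dots> \<le> card ?C + card ?R" by (rule card_Un_le)
  also have "card ?R = length p" by simp
  finally show ?thesis unfolding u_f_def .
qed

section \<open>Outputs\<close>

text \<open>The pattern at the head of the output list; \<open>[]\<close>, which is never a pattern,
  stands for the empty list.\<close>

abbreviation top_out :: "str set \<Rightarrow> str \<Rightarrow> str" where
  "top_out D s \<equiv> longest (insert [] D) s"

text \<open>If the longest output of \<open>s\<close> without \<open>p\<close> is a suffix of
  \<open>p\<close>, it coincides with that of \<open>p\<close>; otherwise it is longer than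
  \<open>p\<close>. So comparing the head of \<open>s\<close> with the head of \<open>p\<close>
  decides whether \<open>p\<close> becomes the new head, and this comparison is what the program
  makes.\<close>

lemma top_out_insert:
  assumes "p \<notin> D" "p \<noteq> []"
  shows "top_out (insert p D) s =
    (if suffix p s \<and> top_out D s = top_out D p then p else top_out D s)"
proof -
  have N: "[] \<in> insert [] D" by simp
  note l = longest[OF N, where s = s]
  show ?thesis
  proof (cases "suffix p s \<and> top_out D s = top_out D p")
    case True
    have "top_out (insert p D) s = p"
    proof (rule longest_eqI)
      fix u assume u: "u \<in> insert [] (insert p D)" "suffix u s"
      show "length u \<le> length p"
      proof (cases "u = p")
        case False
        then have "suffix u (top_out D p)" using l(3)[of u] u True by auto
        then show ?thesis using longest(2)[OF N, of p] by (meson suffix_length_le le_trans)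
      qed simp
    qed (use True in auto)
    then show ?thesis using True by simp
  next
    case False
    have "top_out (insert p D) s = top_out D s"
    proof (rule longest_eqI)
      show "length u \<le> length (top_out D s)" if u: "u \<in> insert [] (insert p D)" "suffix u s" for u
      proof (cases "u \<in> insert [] D")
        case True
        then show ?thesis using l(3)[of u] u by (auto intro: suffix_length_le)
      next
        case F: False
        then have "u = p" using u by auto
        then have "suffix p s" using u by simp
        then have "\<not> suffix (top_out D s) p" using False longest_trans[OF N _ \<open>suffix p s\<close>] by auto
        then show ?thesis using l(2) \<open>u = p\<close> \<open>suffix p s\<close> by (meson nle_le suffix_length_suffix)
      qed
    qed (use l in auto)
    then show ?thesis using False by (simp only: if_False)
  qed
qed

text \<open>The remaining outputs are proper suffixes of the longest one. This is why the lists can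
  share their tails.\<close>

lemma outputs_top_out:
  assumes "[] \<notin> D"
  shows "outputs D s = (if top_out D s = [] then {} else insert (top_out D s) (outputs D (tl (top_out D s))))"
proof -
  have N: "[] \<in> insert [] D" by simp
  note l = longest[OF N, where s = s]
  show ?thesis
  proof (cases "top_out D s = []")
    case True
    then have "q = []" if "q \<in> D" "suffix q s" for q using l(3)[of q] that by simp
    then show ?thesis using True assms by (auto simp: outputs_def)
  next
    case False
    have "q = top_out D s \<or> suffix q (tl (top_out D s))" if "q \<in> D" "suffix q s" for q
      using l(3)[of q] that by (auto simp: suffix_tl_iff[OF False] strict_suffix_iff)
    moreover have "suffix (tl (top_out D s)) s" using l(2) suffix_order.trans suffix_tl by blast
    ultimately show ?thesis using False l(1,2) suffix_order.trans by (auto simp: outputs_def)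
  qed
qed

definition out_addr :: "(str \<times> bool list \<Rightarrow> nat) \<Rightarrow> str \<Rightarrow> nat" where
  "out_addr \<nu> q = (if q = [] then 0 else \<nu> (q, []))"

text \<open>Replaces the existence of lists by conditions on single pointers: one head for each
  state and one successor for each pattern. As lists are sorted by decreasing length, a head is the
  longest output; conversely, the list of \<open>s\<close> is built from that of the shorter string
  \<open>tl (top_out D s)\<close>.\<close>

lemma output_lists_iff:
  assumes "finite D" "[] \<notin> D"
  shows "(\<forall>s \<in> Pref D. \<exists>qs. set qs = outputs D s \<and> sorted_wrt (\<lambda>q r. length q > length r) qs \<and>
        linked_list nx (hds (\<nu> (s, []))) (map (\<lambda>q. \<nu> (q, [])) qs)) \<longleftrightarrow>
    (\<forall>s\<in>Pref D. hds (\<nu> (s, [])) = out_addr \<nu> (top_out D s)) \<and>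
    (\<forall>q\<in>D. nx (\<nu> (q, [])) = out_addr \<nu> (top_out D (tl q)))" (is "?L \<longleftrightarrow> ?R")
proof
  have N: "[] \<in> insert [] D" by simp
  have first: "a = out_addr \<nu> (top_out D s)"
    if qs: "set qs = outputs D s" "sorted_wrt (\<lambda>q r. length q > length r) qs"
      "linked_list nx a (map (\<lambda>q. \<nu> (q, [])) qs)" for a s qs
  proof (cases qs)
    case Nil
    then show ?thesis using qs outputs_top_out[OF assms(2), of s] by (auto simp: out_addr_def split: if_splits)
  next
    case (Cons q rs)
    have "top_out D s = q"
    proof (rule longest_eqI)
      have q: "q \<in> outputs D s" using qs(1) Cons by auto
      then show "q \<in> insert [] D" "suffix q s" by (auto simp: outputs_def)
      fix u assume "u \<in> insert [] D" "suffix u s"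
      then have "u = [] \<or> u \<in> set qs" using qs(1) by (auto simp: outputs_def)
      then show "length u \<le> length q" using qs(2) Cons by auto
    qed
    moreover have "q \<noteq> []" using qs(1) Cons assms by (auto simp: outputs_def)
    ultimately show ?thesis using qs(3) Cons by (simp add: out_addr_def)
  qed
  {
    assume L: ?L
    have "nx (\<nu> (q, [])) = out_addr \<nu> (top_out D (tl q))" if q: "q \<in> D" for q
    proof -
      have "q \<in> Pref D" using q by (auto simp: Pref_def)
      with L obtain qs where qs: "set qs = outputs D q" "sorted_wrt (\<lambda>q r. length q > length r) qs"
        "linked_list nx (hds (\<nu> (q, []))) (map (\<lambda>q. \<nu> (q, [])) qs)" by blast
      have tq: "top_out D q = q" using q by (simp add: longest_self)
      have ne: "q \<noteq> []" using q assms by auto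
      have o: "outputs D q = insert q (outputs D (tl q))" using outputs_top_out[OF assms(2), of q] tq ne by simp
      have qn: "q \<notin> outputs D (tl q)" using ne by (cases q) (auto simp: outputs_def dest!: suffix_length_le)
      obtain r rs where rs: "qs = r # rs" using qs(1) o by (cases qs) auto
      have "r = q"
      proof (rule ccontr)
        assume "r \<noteq> q"
        then have "q \<in> set rs" "r \<in> outputs D (tl q)" using rs qs(1) o by auto
        then show False using qs(2) rs by (auto simp: outputs_def dest!: suffix_length_le)
      qed
      moreover have "q \<notin> set rs" using qs(2) rs \<open>r = q\<close> by auto
      ultimately have "set rs = outputs D (tl q)" using rs qs(1) o qn by auto
      moreover have "hds (\<nu> (q, [])) = \<nu> (q, [])" "linked_list nx (nx (hds (\<nu> (q, [])))) (map (\<lambda>q. \<nu> (q, [])) rs)"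
        using qs(3) rs \<open>r = q\<close> by auto
      ultimately show ?thesis using first[of rs "tl q" "nx (\<nu> (q, []))"] qs(2) rs by simp
    qed
    then show ?R using L first by blast
  }
  {
    assume R: ?R
    have "\<exists>qs. set qs = outputs D s \<and> sorted_wrt (\<lambda>q r. length q > length r) qs \<and>
        linked_list nx (out_addr \<nu> (top_out D s)) (map (\<lambda>q. \<nu> (q, [])) qs)" for s
    proof (induction "length s" arbitrary: s rule: less_induct)
      case less
      let ?t = "top_out D s"
      show ?case
      proof (cases "?t = []")
        case True
        then show ?thesis using outputs_top_out[OF assms(2), of s] by (intro exI[of _ "[]"]) (auto simp: out_addr_def)
      next
        case False
        have "length (tl ?t) < length s"
          using longest(2)[OF N, of s] False by (metis length_tl suffix_length_le diff_less length_greater_0_conv less_le_trans zero_less_one)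
        from less[OF this] obtain qs where qs: "set qs = outputs D (tl ?t)"
          "sorted_wrt (\<lambda>q r. length q > length r) qs"
          "linked_list nx (out_addr \<nu> (top_out D (tl ?t))) (map (\<lambda>q. \<nu> (q, [])) qs)" by blast
        have tD: "?t \<in> D" using longest(1)[OF N, of s] False by auto
        have "\<forall>q\<in>set qs. length q < length ?t"
        proof
          fix q assume "q \<in> set qs"
          then have "length q \<le> length (tl ?t)" using qs(1) by (auto simp: outputs_def dest: suffix_length_le)
          then show "length q < length ?t" using False by (cases ?t) auto
        qed
        then show ?thesis
          using qs R tD outputs_top_out[OF assms(2), of s] False
          by (intro exI[of _ "?t # qs"]) (auto simp: out_addr_def)
      qed
    qed
    then show ?L using R by auto
  }
qed

lemma u_o_insert:
  assumes "p \<notin> D" "p \<noteq> []"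
  shows "u_o D (D \<union> {p}) = card {s \<in> Pref D. suffix p s}"
proof -
  have "outputs D s \<noteq> outputs (D \<union> {p}) s \<longleftrightarrow> suffix p s" for s
    using assms(1) by (auto simp: outputs_def)
  moreover have "Pref D \<inter> Pref (D \<union> {p}) = Pref D" using Pref_insert[OF assms(2)] by auto
  ultimately show ?thesis by (simp add: u_o_def)
qed

text \<open>Among the states that have \<open>p\<close> as a suffix only \<open>p\<close> itself can
  disappear, and then \<open>u_o\<close> does not count it.\<close>

lemma u_o_delete:
  assumes "p \<in> D" "finite D"
  shows "card {s \<in> Pref D. suffix p s} \<le> Suc (u_o D (D - {p}))"
proof -
  let ?D' = "D - {p}"
  have o: "outputs D s \<noteq> outputs ?D' s \<longleftrightarrow> suffix p s" for s
    using assms(1) by (auto simp: outputs_def)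
  have "{s \<in> Pref D. suffix p s} \<subseteq> insert p {s \<in> Pref D \<inter> Pref ?D'. outputs D s \<noteq> outputs ?D' s}"
  proof
    fix s assume s: "s \<in> {s \<in> Pref D. suffix p s}"
    show "s \<in> insert p {s \<in> Pref D \<inter> Pref ?D'. outputs D s \<noteq> outputs ?D' s}"
    proof (cases "s \<in> Pref ?D'")
      case False
      then have "prefix s p" using s Pref_delete_prefix by auto
      then have "length s = length p" using s by (auto dest!: prefix_length_le suffix_length_le)
      then have "s = p" using s by (auto simp: suffix_def)
      then show ?thesis by simp
    qed (use s o in auto)
  qed
  then have "card {s \<in> Pref D. suffix p s} \<le> card (insert p {s \<in> Pref D \<inter> Pref ?D'. outputs D s \<noteq> outputs ?D' s})"
    by (rule card_mono[rotated]) (use assms in simp)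
  also have "\<dots> \<le> Suc (u_o D ?D')" unfolding u_o_def by (simp add: card_insert_if assms)
  finally show ?thesis .
qed

section \<open>Running programs\<close>

text \<open>The postcondition receives the number of steps, so that the rewrite rules execute a
  program symbolically together with its cost. As \<open>exec\<close> is deterministic, the
  existence of one halting run describes the behaviour completely.\<close>

definition run :: "com \<Rightarrow> memory \<Rightarrow> (nat \<Rightarrow> memory \<Rightarrow> bool) \<Rightarrow> bool" where
  "run c M Q \<longleftrightarrow> (\<exists>t M'. exec c M t M' \<and> Q t M')"

inductive_cases SkipE: "exec Skip M t M'"
inductive_cases AssignE: "exec (Assign r e) M t M'"
inductive_cases StoreE: "exec (Store a e f) M t M'"
inductive_cases SeqE: "exec (Seq c d) M t M'"
inductive_cases CondE: "exec (Cond b c d) M t M'"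
inductive_cases WhileE: "exec (While b c) M t M'"

lemma run_Skip [simp]: "run Skip M Q \<longleftrightarrow> Q 1 M"
  unfolding run_def by (metis exec.Skip SkipE)

lemma run_Assign [simp]: "run (Assign r e) M Q \<longleftrightarrow> Q 1 (M\<lparr>regs := (regs M)(r := aval e M)\<rparr>)"
proof -
  have "exec (Assign r e) M t M' \<longleftrightarrow> t = 1 \<and> M' = M\<lparr>regs := (regs M)(r := aval e M)\<rparr>" for t M'
    by (metis exec.Assign AssignE)
  then show ?thesis by (simp add: run_def)
qed

lemma run_Store [simp]: "run (Store a e f) M Q \<longleftrightarrow>
    Q 1 (M\<lparr>cells := (cells M)(a := (cells M a)(aval e M := aval f M))\<rparr>)"
proof -
  have "exec (Store a e f) M t M' \<longleftrightarrow>
      t = 1 \<and> M' = M\<lparr>cells := (cells M)(a := (cells M a)(aval e M := aval f M))\<rparr>" for t M'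
    by (metis exec.Store StoreE)
  then show ?thesis by (simp add: run_def)
qed

lemma run_Seq [simp]: "run (Seq c d) M Q \<longleftrightarrow> run c M (\<lambda>t M'. run d M' (\<lambda>u. Q (t + u)))"
  unfolding run_def by (blast intro: exec.Seq elim: SeqE)

lemma run_Cond [simp]: "run (Cond b c d) M Q \<longleftrightarrow> run (if bval b M then c else d) M (\<lambda>t. Q (t + 1))"
proof -
  have "exec (Cond b c d) M t M' \<longleftrightarrow> (\<exists>u. t = u + 1 \<and> exec (if bval b M then c else d) M u M')" for t M'
    by (cases "bval b M") (auto intro: exec.CondTrue[simplified] exec.CondFalse[simplified] elim: CondE)
  then show ?thesis unfolding run_def by auto
qed

lemma run_unfold_while: "run (While b c) M Q \<longleftrightarrow>
    (if bval b M then run c M (\<lambda>t M'. run (While b c) M' (\<lambda>u. Q (t + u + 1))) else Q 1 M)"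
proof (cases "bval b M")
  case True
  then show ?thesis unfolding run_def
    by (auto intro: exec.WhileTrue[simplified] elim: WhileE) (metis (full_types) WhileE add.commute plus_1_eq_Suc)
next
  case False
  have "exec (While b c) M t M' \<longleftrightarrow> t = 1 \<and> M' = M" for t M'
    using False by (metis exec.WhileFalse WhileE)
  then show ?thesis using False by (simp add: run_def)
qed

lemma run_mono: "run c M Q \<Longrightarrow> (\<And>t M'. Q t M' \<Longrightarrow> Q' t M') \<Longrightarrow> run c M Q'"
  unfolding run_def by blast

text \<open>\<open>n\<close> is the termination measure and \<open>t\<close> the time spent so far.
  The invariant may relate the two and the memory, which is how amortized bounds are
  expressed.\<close>

lemma run_while:
  fixes n :: nat
  assumes "I n 0 M"
    and step: "\<And>n t M. I n t M \<Longrightarrow> bval b M \<Longrightarrow> run c M (\<lambda>u M'. \<exists>n'<n. I n' (t + u + 1) M')"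
    and exit: "\<And>n t M. I n t M \<Longrightarrow> \<not> bval b M \<Longrightarrow> Q (t + 1) M"
  shows "run (While b c) M Q"
proof -
  have "I n s M \<Longrightarrow> run (While b c) M (\<lambda>t. Q (s + t))" for n :: nat and s M
  proof (induction n arbitrary: s M rule: less_induct)
    case (less n)
    show ?case
    proof (cases "bval b M")
      case True
      from step[OF less.prems True] obtain t M' n' where
        t: "exec c M t M'" "n' < n" "I n' (s + t + 1) M'" by (auto simp: run_def)
      from less.IH[OF t(2,3)] obtain u M'' where
        "exec (While b c) M' u M''" "Q (s + t + 1 + u) M''" by (auto simp: run_def)
      then show ?thesis
        using exec.WhileTrue[OF True t(1), of u M''] unfolding run_def
        by (intro exI[of _ "t + u + 1"] exI[of _ M'']) (simp add: add.assoc)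
    next
      case False
      then show ?thesis using exit[OF less.prems False] unfolding run_def
        by (intro exI[of _ 1] exI[of _ M]) (simp add: exec.WhileFalse[simplified])
    qed
  qed
  from this[OF assms(1)] show ?thesis by simp
qed

primrec block :: "com list \<Rightarrow> com" where
  "block [] = Skip"
| "block (c # cs) = Seq c (block cs)"

definition keeps :: "reg set \<Rightarrow> arr set \<Rightarrow> memory \<Rightarrow> memory \<Rightarrow> bool" where
  "keeps R A M M' \<longleftrightarrow> (\<forall>r. r \<notin> R \<longrightarrow> regs M' r = regs M r) \<and> (\<forall>a. a \<notin> A \<longrightarrow> cells M' a = cells M a)"

lemma keeps_refl [simp]: "keeps R A M M" by (simp add: keeps_def)

abbreviation "rCur \<equiv> Reg 0"
abbreviation "rChr \<equiv> Reg 19"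
abbreviation "rCnt \<equiv> Reg 2"
abbreviation "rTop \<equiv> Reg 3"
abbreviation "rNod \<equiv> Reg 4"
abbreviation "rSta \<equiv> Reg 5"
abbreviation "rPtr \<equiv> Reg 6"
abbreviation "rNum \<equiv> Reg 7"
abbreviation "rFrom \<equiv> Reg 8"
abbreviation "rTo \<equiv> Reg 9"
abbreviation "rIdx \<equiv> Reg 10"
abbreviation "rOld \<equiv> Reg 11"
abbreviation "rRoots \<equiv> Reg 12"
abbreviation "rLast \<equiv> Reg 13"
abbreviation "rSave \<equiv> Reg 14"
abbreviation "rFail \<equiv> Reg 15"
abbreviation "rCut \<equiv> Reg 16"
abbreviation "rBit \<equiv> Reg 17"
abbreviation "rKeep \<equiv> Reg 18"
abbreviation "aStack \<equiv> Arr 0"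
abbreviation "aState \<equiv> Arr 3"
abbreviation "aRoots \<equiv> Arr 2"

section \<open>Binary codes\<close>

lemma length_code [simp]: "length (code L c) = L"
  by (simp add: code_def)

lemma code_0 [simp]: "code 0 c = []" by (simp add: code_def)

lemma code_neq_Nil [simp]: "0 < L \<Longrightarrow> code L c \<noteq> []"
  by (simp add: code_def)

lemma code_Suc: "code (Suc L) c = odd c # code L (c div 2)"
  by (simp add: code_def upt_conv_Cons del: upt_Suc)
    (simp add: map_Suc_upt[symmetric] bit_Suc comp_def bit_0 del: upt_Suc)

lemma code_inj: "c < 2 ^ L \<Longrightarrow> d < 2 ^ L \<Longrightarrow> code L c = code L d \<Longrightarrow> c = d"
proof (induction L arbitrary: c d)
  case (Suc L)
  then have "c div 2 = d div 2" "odd c = odd d" by (auto simp: code_Suc less_mult_imp_div_less)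
  then show ?case by (metis even_two_times_div_two odd_two_times_div_two_succ)
qed simp

definition bits :: "nat \<Rightarrow> str \<Rightarrow> bool list" where
  "bits L q = concat (map (code L) q)"

lemma bits_simps [simp]:
  "bits L [] = []" "bits L (c # q) = code L c @ bits L q" "bits L (u @ v) = bits L u @ bits L v"
  by (simp_all add: bits_def)

lemma length_bits [simp]: "length (bits L q) = L * length q"
  by (induction q) auto

text \<open>All codes have length \<open>L\<close>, so a prefix of \<open>bits L q\<close> splits
  into complete codes and a remainder shorter than \<open>L\<close>; below \<open>2 ^ L\<close> a
  code determines its character.\<close>

lemma prefix_bits:
  assumes "set v \<subseteq> {..<2 ^ L}" "set q \<subseteq> {..<2 ^ L}" "length w < L" "prefix (bits L v @ w) (bits L q)"
  shows "prefix v q \<and> (w = [] \<or> (\<exists>c. prefix (v @ [c]) q \<and> strict_prefix w (code L c)))"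
  using assms
proof (induction v arbitrary: q)
  case Nil
  show ?case
  proof (cases q)
    case (Cons c q')
    then have "prefix w (code L c @ bits L q')" using Nil by simp
    then have "prefix w (code L c)" using Nil.prems(3) by (simp add: prefix_append)
        (metis Nil.prems(3) length_append length_code less_not_refl not_add_less1)
    then have "strict_prefix w (code L c)" using Nil.prems(3) by (auto simp: strict_prefix_def)
    then show ?thesis using Cons by auto
  qed (use Nil in simp)
next
  case (Cons d v)
  then have "0 < L" by auto
  then obtain c q' where q: "q = c # q'" using Cons.prems(4) by (cases q) auto
  then have "prefix (code L d @ (bits L v @ w)) (code L c @ bits L q')" using Cons.prems by simp
  then have "code L d = code L c" "prefix (bits L v @ w) (bits L q')"
    by (auto simp: prefix_def append_eq_append_conv)
  moreover from this have "d = c" using code_inj Cons.prems q by auto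
  ultimately show ?case using Cons.IH[of q'] Cons.prems q by auto
qed

lemma bits_inj:
  assumes "0 < L" "set u \<subseteq> {..<2 ^ L}" "set v \<subseteq> {..<2 ^ L}" "length w < L" "length x < L"
    "bits L u @ w = bits L v @ x"
  shows "u = v \<and> w = x"
  using assms(2,3,6)
proof (induction u arbitrary: v)
  case Nil
  show ?case
  proof (cases v)
    case (Cons c v')
    then have "length w = length (code L c @ bits L v' @ x)" using Nil by simp
    then show ?thesis using assms(4) by simp
  qed (use Nil in simp)
next
  case (Cons c u)
  show ?case
  proof (cases v)
    case Nil
    then have "length x = length (code L c @ bits L u @ w)" using Cons.prems(3) by simp
    then show ?thesis using assms(5) by simp
  next
    case v: (Cons d v')
    then have "code L c = code L d" "bits L u @ w = bits L v' @ x" using Cons.prems(3)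
      by (auto simp: append_eq_append_conv)
    moreover from this have "c = d" using code_inj Cons.prems v by auto
    ultimately show ?thesis using Cons.IH[of v'] Cons.prems v by auto
  qed
qed

section \<open>Digital search trees\<close>

text \<open>Nothing is known about the contents of the arrays at address 0, so the null pointer has
  to stop the walk explicitly.\<close>

primrec walk :: "(bool \<Rightarrow> nat \<Rightarrow> nat) \<Rightarrow> nat \<Rightarrow> bool list \<Rightarrow> nat" where
  "walk ch v [] = v"
| "walk ch v (b # bs) = (if v = 0 then 0 else walk ch (ch b v) bs)"

lemma walk_0 [simp]: "walk ch 0 bs = 0"
  by (cases bs) auto

text \<open>Induction over the digits \<open>r\<close> still to be read, with \<open>w\<close> those
  already read. All characters on edges leaving \<open>v\<close> are bounded by
  \<open>2 ^ L\<close>, so that the last digit leads along an edge with the character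
  \<open>c\<close> and not with another one of the same code.\<close>

lemma walk_branching:
  assumes B: "branching L V E \<nu> ch" and L: "0 < L" and v: "v \<in> V"
    and E: "\<And>d u. (v, d, u) \<in> E \<Longrightarrow> d < 2 ^ L" and c: "c < 2 ^ L"
  shows "(\<And>u. (v, c, u) \<in> E \<Longrightarrow> walk ch (\<nu> (v, [])) (code L c) = \<nu> (u, []))"
    "(\<nexists>u. (v, c, u) \<in> E) \<Longrightarrow> walk ch (\<nu> (v, [])) (code L c) = 0"
proof -
  note B = B[unfolded branching_def]
  have nz: "\<nu> k \<noteq> 0" if "k \<in> branch_keys L V E" for k using B that by (metis imageI)
  have *: "(\<forall>u. (v, c, u) \<in> E \<longrightarrow> walk ch (\<nu> (v, w)) r = \<nu> (u, [])) \<and>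
      ((\<nexists>u. (v, c, u) \<in> E) \<longrightarrow> walk ch (\<nu> (v, w)) r = 0)"
    if "w @ r = code L c" "r \<noteq> []" "(v, w) \<in> branch_keys L V E" for w r
    using that
  proof (induction r arbitrary: w)
    case (Cons b r)
    show ?case
    proof (cases "\<exists>d u. (v, d, u) \<in> E \<and> prefix (w @ [b]) (code L d)")
      case True
      then obtain d u where d: "(v, d, u) \<in> E" "prefix (w @ [b]) (code L d)" by blast
      show ?thesis
      proof (cases "r = []")
        case True
        then have cd: "code L c = w @ [b]" using Cons.prems by simp
        then have "code L d = code L c" using d(2)
          by (metis length_code not_equal_is_parallel parallel_def prefix_order.refl prefix_length_prefix le_refl prefix_order.antisym)
        then have "d = c" using code_inj E[OF d(1)] c by blast
        then show ?thesis using True B d(1) cd nz[OF Cons.prems(3)] by auto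
      next
        case False
        then have "length (w @ [b]) < L" using Cons.prems(1) length_code[of L c]
          by (metis length_append length_Cons length_greater_0_conv list.size(3) add_less_mono1 add.commute less_add_same_cancel1 add_Suc_right add_0_right append.assoc append_Cons append_Nil)
        then have "w @ [b] \<noteq> code L d" by (metis length_code less_irrefl)
        then have "strict_prefix (w @ [b]) (code L d)" using d(2) by (simp add: strict_prefix_def)
        then have k: "(v, w @ [b]) \<in> branch_keys L V E" using d(1) v by (auto simp: branch_keys_def)
        then have "ch b (\<nu> (v, w)) = \<nu> (v, w @ [b])" using B by blast
        then show ?thesis using Cons.IH[of "w @ [b]"] Cons.prems(1) False k nz[OF Cons.prems(3)] by auto
      qed
    next
      case False
      then have "ch b (\<nu> (v, w)) = 0" using B Cons.prems(3) by blast
      moreover have "(v, c, u) \<notin> E" for u using False Cons.prems(1)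
        by (metis append.assoc append_Cons append_Nil prefixI)
      ultimately show ?thesis by simp
    qed
  qed simp
  have k: "(v, []) \<in> branch_keys L V E" using v by (simp add: branch_keys_def)
  have ne: "code L c \<noteq> []" using L by (metis length_code less_irrefl list.size(3))
  show "\<And>u. (v, c, u) \<in> E \<Longrightarrow> walk ch (\<nu> (v, [])) (code L c) = \<nu> (u, [])"
    "(\<nexists>u. (v, c, u) \<in> E) \<Longrightarrow> walk ch (\<nu> (v, [])) (code L c) = 0"
    using *[of "[]"] ne k by auto
qed

text \<open>The search trees of all states of an automaton form a single binary trie, in which the vertex
  \<open>(v, w)\<close> is addressed by the concatenated codes of the characters of \<open>v\<close>, followed by \<open>w\<close>.\<close>

definition trie :: "bool list set \<Rightarrow> (bool list \<Rightarrow> nat) \<Rightarrow> (bool \<Rightarrow> nat \<Rightarrow> nat) \<Rightarrow> nat \<Rightarrow> bool" where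
  "trie T a ch F \<longleftrightarrow> [] \<in> T \<and> (\<forall>\<beta> b. \<beta> @ [b] \<in> T \<longrightarrow> \<beta> \<in> T) \<and> inj_on a T \<and>
     (\<forall>\<beta>\<in>T. 0 < a \<beta> \<and> a \<beta> < F \<and> (\<forall>b. ch b (a \<beta>) = (if \<beta> @ [b] \<in> T then a (\<beta> @ [b]) else 0)))"

definition code_words :: "nat \<Rightarrow> str set \<Rightarrow> bool list set" where
  "code_words L D = insert [] {\<beta>. \<exists>q\<in>D. prefix \<beta> (bits L q)}"

lemma walk_trie:
  "trie T a ch F \<Longrightarrow> \<beta> \<in> T \<Longrightarrow> walk ch (a \<beta>) \<gamma> = (if \<beta> @ \<gamma> \<in> T then a (\<beta> @ \<gamma>) else 0)"
proof (induction \<gamma> arbitrary: \<beta>)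
  case (Cons b \<gamma>)
  have closed: "\<beta> @ \<gamma> \<in> T \<Longrightarrow> \<beta> \<in> T" for \<beta> \<gamma>
    using Cons.prems(1) by (induction \<gamma> rule: rev_induct) (auto simp: trie_def simp flip: append_assoc)
  show ?case
  proof (cases "\<beta> @ [b] \<in> T")
    case True
    then show ?thesis using Cons.IH[OF Cons.prems(1) True] Cons.prems by (auto simp: trie_def)
  next
    case False
    then have "\<beta> @ b # \<gamma> \<notin> T" using closed[of "\<beta> @ [b]" \<gamma>] by auto
    then show ?thesis using False Cons.prems by (auto simp: trie_def)
  qed
qed simp

text \<open>The cells at the free address \<open>F\<close> hold arbitrary values; therefore
  \<open>ch'\<close> also sets both children of the new vertex to 0.\<close>

lemma trie_extend:
  assumes "trie T a ch F" "\<beta> \<in> T" "\<beta> @ [b] \<notin> T"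
    "\<And>b' v. ch' b' v = (if b' = b \<and> v = a \<beta> then F else if v = F then 0 else ch b' v)"
  shows "trie (insert (\<beta> @ [b]) T) (a(\<beta> @ [b] := F)) ch' (Suc F)"
proof -
  let ?\<gamma> = "\<beta> @ [b]" and ?a = "a(\<beta> @ [b] := F)"
  have T: "[] \<in> T" "\<And>\<beta> b. \<beta> @ [b] \<in> T \<Longrightarrow> \<beta> \<in> T" "inj_on a T"
    "\<And>\<beta>. \<beta> \<in> T \<Longrightarrow> 0 < a \<beta> \<and> a \<beta> < F"
    "\<And>\<beta> b. \<beta> \<in> T \<Longrightarrow> ch b (a \<beta>) = (if \<beta> @ [b] \<in> T then a (\<beta> @ [b]) else 0)"
    using assms(1) unfolding trie_def by blast+
  have inj: "inj_on ?a (insert ?\<gamma> T)"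
    using T(3,4) assms(3) by (auto simp: inj_on_def)
  have "ch' b' (?a \<delta>) = (if \<delta> @ [b'] \<in> insert ?\<gamma> T then ?a (\<delta> @ [b']) else 0)"
    if d: "\<delta> \<in> insert ?\<gamma> T" for \<delta> b'
  proof (cases "\<delta> = ?\<gamma>")
    case True
    have "F \<noteq> a \<beta>" using T(4)[OF assms(2)] by simp
    moreover have "?\<gamma> @ [b'] \<notin> T" using T(2)[of ?\<gamma>] assms(3) by auto
    ultimately show ?thesis using True by (simp add: assms(4))
  next
    case False
    then have dT: "\<delta> \<in> T" using d by simp
    have "a \<delta> \<noteq> F" using T(4)[OF dT] by simp
    moreover have "a \<delta> = a \<beta> \<longleftrightarrow> \<delta> = \<beta>" using T(3) dT assms(2) by (auto simp: inj_on_def)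
    ultimately show ?thesis using False T(5)[OF dT] assms(3) by (auto simp: assms(4))
  qed
  moreover have "0 < ?a \<delta> \<and> ?a \<delta> < Suc F" if "\<delta> \<in> insert ?\<gamma> T" for \<delta>
    using T(4) that assms(2) by (fastforce simp: less_Suc_eq)
  ultimately show ?thesis using inj T(1,2) assms(2) unfolding trie_def by auto
qed

text \<open>The keys of the search trees are the vertices of the trie: by \<open>prefix_bits\<close>
  a word splits into a state \<open>v\<close> and the digits \<open>w\<close> inside the tree of
  \<open>v\<close>.\<close>

lemma branch_keys_ac:
  assumes "0 < L" "\<And>q. q \<in> D \<Longrightarrow> set q \<subseteq> {..<2 ^ L}"
  shows "(v, w) \<in> branch_keys L (Pref D) (goto_edges D) \<longleftrightarrow>
    set v \<subseteq> {..<2 ^ L} \<and> length w < L \<and> bits L v @ w \<in> code_words L D"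
proof
  assume k: "(v, w) \<in> branch_keys L (Pref D) (goto_edges D)"
  have pre: "set x \<subseteq> {..<2 ^ L} \<and> bits L x \<in> code_words L D" if "x \<in> Pref D" for x
    using that assms(2) set_mono_prefix by (fastforce simp: Pref_def code_words_def prefix_def)
  show "set v \<subseteq> {..<2 ^ L} \<and> length w < L \<and> bits L v @ w \<in> code_words L D"
  proof (cases "w = []")
    case True
    then show ?thesis using k pre assms(1) by (auto simp: branch_keys_def)
  next
    case False
    then obtain c where c: "v \<in> Pref D" "v @ [c] \<in> Pref D" "strict_prefix w (code L c)"
      using k by (auto simp: branch_keys_def goto_edges_def)
    have l: "length w < L" using prefix_length_less[OF c(3)] by simp
    obtain q where "q \<in> D" "prefix (v @ [c]) q" using c(2) by (auto simp: Pref_def)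
    moreover from this have "prefix (bits L v @ w) (bits L q)"
      using c(3) by (auto simp: prefix_def strict_prefix_def)
    ultimately have "bits L v @ w \<in> code_words L D" by (auto simp: code_words_def)
    then show ?thesis using l pre[OF c(1)] by simp
  qed
next
  assume r: "set v \<subseteq> {..<2 ^ L} \<and> length w < L \<and> bits L v @ w \<in> code_words L D"
  show "(v, w) \<in> branch_keys L (Pref D) (goto_edges D)"
  proof (cases "v = [] \<and> w = []")
    case False
    have "bits L v @ w \<noteq> []"
    proof
      assume "bits L v @ w = []"
      then have "w = []" "L * length v = 0" using length_bits[of L v] by auto
      then show False using False assms(1) by auto
    qed
    then obtain q where q: "q \<in> D" "prefix (bits L v @ w) (bits L q)" using r by (auto simp: code_words_def)
    with prefix_bits[of v L q w] r assms(2) have *: "prefix v q \<and> (w = [] \<or> (\<exists>c. prefix (v @ [c]) q \<and> strict_prefix w (code L c)))"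
      by auto
    then have vP: "v \<in> Pref D" using q by (auto simp: Pref_def)
    have "\<exists>c. v @ [c] \<in> Pref D \<and> strict_prefix w (code L c)" if "w \<noteq> []"
      using that * q by (auto simp: Pref_def)
    then show ?thesis using vP by (auto simp: branch_keys_def goto_edges_def)
  qed (auto simp: branch_keys_def)
qed

lemma bits_code_words:
  assumes "0 < L" "\<And>q. q \<in> D \<Longrightarrow> set q \<subseteq> {..<2 ^ L}" "set x \<subseteq> {..<2 ^ L}"
  shows "bits L x \<in> code_words L D \<longleftrightarrow> x \<in> Pref D"
  using branch_keys_ac[OF assms(1,2), of D x "[]"] assms(1,3) by (auto simp: branch_keys_def)

text \<open>Encoding a key as a word is injective by \<open>bits_inj\<close> and onto the words of
  the trie, so addresses are transferred along its inverse. A child pointer either stays inside the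
  tree of \<open>v\<close> or, at the last digit of a code, leads to the address of the next
  state.\<close>

lemma trie_of_branching:
  assumes L: "0 < L" and D: "\<And>q. q \<in> D \<Longrightarrow> set q \<subseteq> {..<2 ^ L}"
    and B: "branching L (Pref D) (goto_edges D) \<nu> ch"
    and F: "\<forall>k\<in>branch_keys L (Pref D) (goto_edges D). \<nu> k < F"
  obtains a where "trie (code_words L D) a ch F"
    "\<And>v w. (v, w) \<in> branch_keys L (Pref D) (goto_edges D) \<Longrightarrow> a (bits L v @ w) = \<nu> (v, w)"
proof -
  let ?K = "branch_keys L (Pref D) (goto_edges D)" and ?T = "code_words L D"
  define e where "e = (\<lambda>(v, w). bits L v @ w)"
  define a where "a = (\<lambda>\<beta>. \<nu> (inv_into ?K e \<beta>))"
  have K: "(v, w) \<in> ?K \<longleftrightarrow> set v \<subseteq> {..<2 ^ L} \<and> length w < L \<and> bits L v @ w \<in> ?T" for v w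
    by (rule branch_keys_ac[OF L D])
  have inj: "inj_on e ?K"
  proof (rule inj_onI)
    fix k k' assume "k \<in> ?K" "k' \<in> ?K" "e k = e k'"
    then show "k = k'" using bits_inj[OF L, of "fst k" "fst k'" "snd k" "snd k'"] K
      by (cases k, cases k') (simp add: e_def)
  qed
  have a: "a (e k) = \<nu> k" if "k \<in> ?K" for k using that inj by (simp add: a_def inv_into_f_f)
  have surj: "\<exists>k\<in>?K. \<beta> = e k" if b: "\<beta> \<in> ?T" for \<beta>
  proof -
    have "\<exists>q. prefix \<beta> (bits L q) \<and> set q \<subseteq> {..<2 ^ L}"
    proof (cases "\<beta> = []")
      case True
      then show ?thesis by (intro exI[of _ "[]"]) simp
    next
      case False
      then show ?thesis using b D unfolding code_words_def by blast
    qed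
    then obtain q where q: "prefix \<beta> (bits L q)" "set q \<subseteq> {..<2 ^ L}" by blast
    have "\<exists>v w. \<beta> = bits L v @ w \<and> length w < L \<and> set v \<subseteq> {..<2 ^ L}" using q
    proof (induction q arbitrary: \<beta>)
      case Nil
      then show ?case using L by (intro exI[of _ "[]"]) auto
    next
      case (Cons c q)
      show ?case
      proof (cases "length \<beta> < L")
        case True
        then show ?thesis by (intro exI[of _ "[]"] exI[of _ \<beta>]) auto
      next
        case False
        then have "prefix (code L c) \<beta>"
          by (metis Cons.prems(1) bits_simps(2) length_code not_less prefixI prefix_length_prefix)
        then obtain \<gamma> where g: "\<beta> = code L c @ \<gamma>" by (auto simp: prefix_def)
        then have "prefix \<gamma> (bits L q)" using Cons.prems(1) by simp
        with Cons.IH[of \<gamma>] Cons.prems obtain v w where "\<gamma> = bits L v @ w" "length w < L" "set v \<subseteq> {..<2 ^ L}" by auto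
        then show ?thesis using g Cons.prems by (intro exI[of _ "c # v"] exI[of _ w]) auto
      qed
    qed
    then obtain v w where "\<beta> = e (v, w)" "(v, w) \<in> ?K" using b K by (auto simp: e_def)
    then show ?thesis by blast
  qed
  note B = B[unfolded branching_def]
  have "inj_on a ?T"
  proof (rule inj_onI)
    fix x y assume "x \<in> ?T" "y \<in> ?T" "a x = a y"
    moreover from this obtain k k' where "k \<in> ?K" "x = e k" "k' \<in> ?K" "y = e k'" using surj by blast
    ultimately show "x = y" using a B by (metis inj_onD)
  qed
  moreover have "0 < a \<beta> \<and> a \<beta> < F" if "\<beta> \<in> ?T" for \<beta>
    using surj[OF that] a B F by (metis image_eqI neq0_conv)
  moreover have "ch b (a \<beta>) = (if \<beta> @ [b] \<in> ?T then a (\<beta> @ [b]) else 0)" if b: "\<beta> \<in> ?T" for \<beta> b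
  proof -
    obtain v w where k: "(v, w) \<in> ?K" "\<beta> = bits L v @ w" using surj[OF b] by (auto simp: e_def)
    then have ab: "a \<beta> = \<nu> (v, w)" using a[of "(v, w)"] by (simp add: e_def)
    have v: "v \<in> Pref D" using k by (auto simp: branch_keys_def)
    have lw: "length w < L" "set v \<subseteq> {..<2 ^ L}" using k K by auto
    show ?thesis
    proof (cases "\<beta> @ [b] \<in> ?T")
      case True
      show ?thesis
      proof (cases "length (w @ [b]) < L")
        case len: True
        then have "(v, w @ [b]) \<in> ?K" using K True k lw by auto
        then show ?thesis using B ab True a[of "(v, w @ [b])"] k(2) by (auto simp: e_def)
      next
        case False
        then have len: "length (w @ [b]) = L" using lw by simp
        obtain v' w' where k': "(v', w') \<in> ?K" "\<beta> @ [b] = bits L v' @ w'" using surj[OF True] by (auto simp: e_def)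
        have "length (bits L v' @ w') = L * Suc (length v)" using len k(2) k'(2) by (metis append_assoc length_append length_bits mult_Suc_right add.commute)
        \<comment> \<open>As \<open>length w' < L\<close>, comparing remainders modulo
          \<open>L\<close> leaves \<open>w' = []\<close>: the vertex reached is the root of the tree
          of a state longer by one character.\<close>
        then have "L * length v' + length w' = L * Suc (length v)" by simp
        moreover have "length w' < L" using k' K by auto
        ultimately have "length w' = 0"
          by (metis mod_less mod_mult_self2 mod_mult_self1_is_0 add.commute mult.commute mod_mult_self2_is_0)
        then have w': "w' = []" by simp
        then have "L * length v' = L * Suc (length v)"
          using \<open>L * length v' + length w' = L * Suc (length v)\<close> by simp
        then have "length v' = Suc (length v)" using L by (simp only: mult_cancel1) simp
        then obtain u c where u: "v' = u @ [c]" "length u = length v" by (metis length_Suc_conv_rev)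
        have "bits L v @ (w @ [b]) = bits L u @ code L c" using k(2) k'(2) w' u by simp
        then have *: "bits L v = bits L u" "w @ [b] = code L c" using u(2) by (auto simp: append_eq_append_conv)
        have "set u \<subseteq> {..<2 ^ L}" using K[of v' w'] k'(1) u(1) by auto
        then have "u = v" using bits_inj[OF L, of u v "[]" "[]"] *(1) lw(2) L by simp
        have "(v, c, v @ [c]) \<in> goto_edges D"
          using k'(1) u \<open>u = v\<close> v by (auto simp: goto_edges_def branch_keys_def)
        then have "ch b (\<nu> (v, w)) = \<nu> (v @ [c], [])" using B *(2)[symmetric] by blast
        also have "\<dots> = a (\<beta> @ [b])" using a[of "(v', w')"] k' w' u \<open>u = v\<close> by (simp add: e_def)
        finally show ?thesis using True ab by simp
      qed
    next
      case False
      have "\<nexists>c u. (v, c, u) \<in> goto_edges D \<and> prefix (w @ [b]) (code L c)"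
      proof
        assume "\<exists>c u. (v, c, u) \<in> goto_edges D \<and> prefix (w @ [b]) (code L c)"
        then obtain c where c: "v @ [c] \<in> Pref D" "prefix (w @ [b]) (code L c)" by (auto simp: goto_edges_def)
        then obtain q where "q \<in> D" "prefix (v @ [c]) q" by (auto simp: Pref_def)
        then have "prefix (bits L v @ w @ [b]) (bits L q)" using c(2) by (auto simp: prefix_def)
        then show False using False k(2) \<open>q \<in> D\<close> by (auto simp: code_words_def)
      qed
      then show ?thesis using B k(1) ab False by auto
    qed
  qed
  moreover have "[] \<in> ?T" "\<And>\<beta> b. \<beta> @ [b] \<in> ?T \<Longrightarrow> \<beta> \<in> ?T"
    by (auto simp: code_words_def dest: append_prefixD)
  ultimately have "trie ?T a ch F" unfolding trie_def by blast
  then show thesis using that a by (auto simp: e_def)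
qed

text \<open>The way back after an update: the address of a key is that of the concatenated
  word.\<close>

lemma branching_of_trie:
  assumes L: "0 < L" and D: "\<And>q. q \<in> D \<Longrightarrow> set q \<subseteq> {..<2 ^ L}"
    and T: "trie (code_words L D) a ch F"
  defines "\<nu> \<equiv> \<lambda>(v, w). a (bits L v @ w)"
  shows "branching L (Pref D) (goto_edges D) \<nu> ch"
    "\<forall>k\<in>branch_keys L (Pref D) (goto_edges D). \<nu> k < F"
proof -
  let ?K = "branch_keys L (Pref D) (goto_edges D)" and ?T = "code_words L D"
  have K: "(v, w) \<in> ?K \<longleftrightarrow> set v \<subseteq> {..<2 ^ L} \<and> length w < L \<and> bits L v @ w \<in> ?T" for v w
    by (rule branch_keys_ac[OF L D])
  have T: "inj_on a ?T" "\<And>\<beta>. \<beta> \<in> ?T \<Longrightarrow> 0 < a \<beta> \<and> a \<beta> < F"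
    "\<And>\<beta> b. \<beta> \<in> ?T \<Longrightarrow> ch b (a \<beta>) = (if \<beta> @ [b] \<in> ?T then a (\<beta> @ [b]) else 0)"
    using T unfolding trie_def by blast+
  have "inj_on \<nu> ?K"
  proof (rule inj_onI)
    fix k k' assume k: "k \<in> ?K" "k' \<in> ?K" "\<nu> k = \<nu> k'"
    obtain v w v' w' where vw: "k = (v, w)" "k' = (v', w')" by fastforce
    then have "bits L v @ w = bits L v' @ w'" using k K T(1) by (auto simp: \<nu>_def inj_on_def)
    then show "k = k'" using bits_inj[OF L, of v v' w w'] k vw K by auto
  qed
  moreover have "0 \<notin> \<nu> ` ?K" using K T(2) by (fastforce simp: \<nu>_def)
  moreover have "ch b (\<nu> (v, w)) = \<nu> (v, w @ [b])" if "(v, w @ [b]) \<in> ?K" for v w b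
  proof -
    have "bits L v @ w @ [b] \<in> ?T" using that K by auto
    moreover from this have "bits L v @ w \<in> ?T" by (auto simp: code_words_def dest: append_prefixD simp flip: append_assoc)
    ultimately show ?thesis using T(3)[of "bits L v @ w" b] by (simp add: \<nu>_def)
  qed
  moreover have "ch b (\<nu> (v, w)) = \<nu> (u, [])"
    if e: "(v, c, u) \<in> goto_edges D" "code L c = w @ [b]" for v c u w b
  proof -
    have u: "u = v @ [c]" "u \<in> Pref D" using e by (auto simp: goto_edges_def)
    then obtain q where "q \<in> D" "prefix u q" by (auto simp: Pref_def)
    then have "prefix (bits L v @ w @ [b]) (bits L q)" using e u by (auto simp: prefix_def)
    then have "bits L v @ w @ [b] \<in> ?T" using \<open>q \<in> D\<close> by (auto simp: code_words_def)
    moreover from this have "bits L v @ w \<in> ?T" by (auto simp: code_words_def dest: append_prefixD simp flip: append_assoc)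
    ultimately show ?thesis using T(3)[of "bits L v @ w" b] e u by (simp add: \<nu>_def)
  qed
  moreover have "ch b (\<nu> (v, w)) = 0"
    if k: "(v, w) \<in> ?K" and n: "\<nexists>c u. (v, c, u) \<in> goto_edges D \<and> prefix (w @ [b]) (code L c)" for v w b
  proof -
    have "bits L v @ w @ [b] \<notin> ?T"
    proof
      assume t: "bits L v @ w @ [b] \<in> ?T"
      have kk: "set v \<subseteq> {..<2 ^ L}" "length w < L" "v \<in> Pref D" using k K by (auto simp: branch_keys_def)
      show False
      proof (cases "length (w @ [b]) < L")
        case True
        then have "(v, w @ [b]) \<in> ?K" using K t kk by auto
        then show False using n by (auto simp: branch_keys_def strict_prefix_def)
      next
        case False
        obtain q where q: "q \<in> D" "prefix (bits L v @ w @ [b]) (bits L q)" using t by (auto simp: code_words_def)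
        have vq: "prefix v q" using prefix_bits[of v L q w] kk q D[OF q(1)] append_prefixD[of "bits L v @ w" "[b]"] by auto
        then obtain r where r: "q = v @ r" by (auto simp: prefix_def)
        then have pr: "prefix (w @ [b]) (bits L r)" using q(2) by simp
        then obtain c r' where c: "r = c # r'" using pr by (cases r) auto
        then have "prefix (w @ [b]) (code L c)" using pr kk(2)
          by (metis bits_simps(2) length_append_singleton length_code Suc_leI prefixI prefix_length_prefix)
        moreover have "v @ [c] \<in> Pref D" using q r c by (auto simp: Pref_def prefix_def)
        ultimately show False using n kk by (auto simp: goto_edges_def)
      qed
    qed
    moreover have "bits L v @ w \<in> ?T" using k K by auto
    ultimately show ?thesis using T(3)[of "bits L v @ w" b] by (simp add: \<nu>_def)
  qed
  ultimately show "branching L (Pref D) (goto_edges D) \<nu> ch" unfolding branching_def by blast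
  show "\<forall>k\<in>?K. \<nu> k < F" using K T(2) by (fastforce simp: \<nu>_def)
qed

section \<open>Subroutines\<close>

definition walk_com :: "(bool \<Rightarrow> arr) \<Rightarrow> com" where
  "walk_com A = block [
     Assign rCnt (Var Width),
     While (Conj (Less (Num 0) (Var rCnt)) (Neg (Equal (Var rCur) (Num 0)))) (block [
       Cond (Equal (Parity (Var rChr)) (Num 0))
         (Assign rCur (Cell (A False) (Var rCur))) (Assign rCur (Cell (A True) (Var rCur))),
       Assign rChr (Half (Var rChr)),
       Assign rCnt (Decr (Var rCnt))])]"

text \<open>Six steps per digit: two for the conditional, three for the rest of the body and one for
  the loop.\<close>

lemma run_walk_com:
  "run (walk_com A) M (\<lambda>t M'. t \<le> 6 * regs M Width + 3 \<and> keeps {rCur, rChr, rCnt} {} M M' \<and>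
     regs M' rCur = walk (\<lambda>b. cells M (A b)) (regs M rCur) (code (regs M Width) (regs M rChr)))"
proof -
  define I where "I n t N \<longleftrightarrow> n = regs N rCnt \<and> t + 6 * n \<le> 6 * regs M Width \<and>
     keeps {rCur, rChr, rCnt} {} M N \<and>
     walk (\<lambda>b. cells M (A b)) (regs N rCur) (code n (regs N rChr)) =
     walk (\<lambda>b. cells M (A b)) (regs M rCur) (code (regs M Width) (regs M rChr))" for n t N
  show ?thesis unfolding walk_com_def
    apply (simp only: block.simps run_Seq run_Assign run_Skip)
    apply (rule run_while[where I = I and n = "regs M Width"])
    subgoal by (simp add: I_def keeps_def)
    subgoal for n t N
      by (cases "regs N rCnt") (auto simp: I_def keeps_def code_Suc odd_iff_mod_2_eq_one split: if_splits)
    subgoal for n t N by (auto simp: I_def)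
    done
qed

definition children :: "memory \<Rightarrow> nat \<Rightarrow> nat list" where
  "children M w = map (\<lambda>i. cells M InvLinks (cells M InvStart w + i)) [0..<cells M InvCount w]"

text \<open>Listed from the top, so that pushing an entry is \<open>Cons\<close>.\<close>

definition stack :: "memory \<Rightarrow> nat list" where
  "stack M = rev (map (cells M aStack) [0..<regs M rTop])"

definition push_children :: com where
  "push_children = block [
     Assign rPtr (Cell InvStart (Var rNod)),
     Assign rNum (Cell InvCount (Var rNod)),
     While (Less (Num 0) (Var rNum)) (block [
       Store aStack (Var rTop) (Cell InvLinks (Var rPtr)),
       Assign rTop (Incr (Var rTop)),
       Assign rPtr (Incr (Var rPtr)),
       Assign rNum (Decr (Var rNum))])]"

lemma run_push_children:
  "run push_children M (\<lambda>t M'. t \<le> 6 * length (children M (regs M rNod)) + 4 \<and>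
     keeps {rTop, rPtr, rNum} {aStack} M M' \<and>
     stack M' = rev (children M (regs M rNod)) @ stack M)"
proof -
  let ?s = "cells M InvStart (regs M rNod)" and ?c = "cells M InvCount (regs M rNod)"
  define I where "I n t N \<longleftrightarrow> n = regs N rNum \<and> n \<le> ?c \<and> regs N rPtr = ?s + (?c - n) \<and>
     t + 6 * n \<le> 6 * ?c \<and> keeps {rTop, rPtr, rNum} {aStack} M N \<and>
     stack N = rev (map (\<lambda>i. cells M InvLinks (?s + i)) [0..<?c - n]) @ stack M" for n t N
  show ?thesis unfolding push_children_def
    apply (simp only: block.simps run_Seq run_Assign run_Skip)
    apply (rule run_while[where I = I and n = ?c])
    subgoal by (simp add: I_def keeps_def stack_def)
    subgoal for n t N
    proof -
      assume I: "I n t N" and b: "bval (Less (Num 0) (Var rNum)) N"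
      then obtain k where k: "n = Suc k" by (cases n) (auto simp: I_def)
      have "n \<le> ?c" using I by (simp add: I_def)
      then have "?c - k = Suc (?c - n)" using k by simp
      then have l: "[0..<?c - k] = [0..<?c - n] @ [?c - n]" by simp
      show ?thesis
        apply (simp only: block.simps run_Seq run_Assign run_Store run_Skip)
        apply (rule exI[of _ k])
        using I k unfolding I_def l
        apply (auto simp: keeps_def stack_def)
        done
    qed
    subgoal for n t N by (auto simp: I_def children_def)
    done
qed

definition search :: "bool \<Rightarrow> com \<Rightarrow> com" where
  "search ct act = While (Less (Num 0) (Var rTop)) (block [
     Assign rTop (Decr (Var rTop)),
     Assign rNod (Cell aStack (Var rTop)),
     Assign rSta (Cell StateOf (Var rNod)),
     Cond (Equal (Var rSta) (Num 0)) push_children (Seq act (if ct then Skip else push_children))])"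

lemma run_search_unfold: "run (search ct act) M Q \<longleftrightarrow>
    (if 0 < regs M rTop then run (block [
       Assign rTop (Decr (Var rTop)),
       Assign rNod (Cell aStack (Var rTop)),
       Assign rSta (Cell StateOf (Var rNod)),
       Cond (Equal (Var rSta) (Num 0)) push_children (Seq act (if ct then Skip else push_children))])
       M (\<lambda>t M'. run (search ct act) M' (\<lambda>u. Q (t + u + 1))) else Q 1 M)"
  unfolding search_def by (subst run_unfold_while) simp

abbreviation links :: "memory \<Rightarrow> (nat \<Rightarrow> nat) \<times> (nat \<Rightarrow> nat) \<times> (nat \<Rightarrow> nat)" where
  "links M \<equiv> (cells M Flink, cells M OutHead, cells M OutNext)"

lemma stack_top: "stack M = w # ws \<Longrightarrow>
  \<exists>k. regs M rTop = Suc k \<and> cells M aStack k = w \<and> rev (map (cells M aStack) [0..<k]) = ws"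
  by (cases "regs M rTop") (auto simp: stack_def)

text \<open>The action is abstracted to a function \<open>f\<close> on the three link arrays, so
  that a single induction over \<open>dfs\<close> serves both failure links and outputs.\<close>

lemma run_search:
  assumes d: "dfs ct (cells M StateOf) (children M) (stack M) vs"
    and act: "\<And>N. run act N (\<lambda>t N'. t \<le> 8 \<and> keeps {} {Flink, OutHead, OutNext} N N' \<and>
        links N' = f (regs N rFrom) (regs N rTo) (regs N rSta) (links N))"
  shows "run (search ct act) M (\<lambda>t M'. t \<le> 30 * length vs + 1 \<and>
     keeps {rTop, rNod, rSta, rPtr, rNum} {aStack, Flink, OutHead, OutNext} M M' \<and>
     links M' = fold (f (regs M rFrom) (regs M rTo)) (filter (\<lambda>s. s \<noteq> 0) (map (cells M StateOf) vs)) (links M) \<and>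
     regs M' rTop = 0)"
proof -
  let ?K = "keeps {rTop, rNod, rSta, rPtr, rNum} {aStack, Flink, OutHead, OutNext}"
  let ?f = "f (regs M rFrom) (regs M rTo)"
  let ?R = "\<lambda>us. fold ?f (filter (\<lambda>s. s \<noteq> 0) (map (cells M StateOf) us))"
  \<comment> \<open>\<open>6 * length ws\<close> is a credit: pushing a vertex takes 6 steps, which
    are charged to its later visit as a part of the 30.\<close>
  have *: "run (search ct act) N (\<lambda>t M'. t + 6 * length ws \<le> 30 * length us + 1 \<and> ?K M M' \<and>
      links M' = ?R us (links N) \<and> regs M' rTop = 0)"
    if "dfs ct (cells M StateOf) (children M) ws us" "stack N = ws" "?K M N" for N ws us
    using that
  proof (induction arbitrary: N rule: dfs.induct)
    case Nil
    then have "regs N rTop = 0" by (simp add: stack_def)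
    then show ?case using Nil unfolding search_def run_def
      by (intro exI[of _ 1] exI[of _ N]) (auto intro: exec.WhileFalse[simplified])
  next
    case (Leaf w ws us)
    obtain k where k: "regs N rTop = Suc k" "cells N aStack k = w" "rev (map (cells N aStack) [0..<k]) = ws"
      using stack_top[OF Leaf.prems(1)] by blast
    have s: "cells N StateOf = cells M StateOf" using Leaf.prems(2) by (simp add: keeps_def)
    have ct: "ct = True" using Leaf.hyps by simp
    let ?N = "N\<lparr>regs := (regs N)(rTop := k, rNod := w, rSta := cells M StateOf w)\<rparr>"
    have r: "regs N rFrom = regs M rFrom" "regs N rTo = regs M rTo" using Leaf.prems(2) by (auto simp: keeps_def)
    show ?case
      apply (subst run_search_unfold)
      using k s Leaf.hyps
      apply simp
      apply (rule run_mono[OF act[of ?N]])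
      subgoal for t N'
        apply (rule run_mono[OF Leaf.IH[of N', unfolded ct]])
        subgoal by (simp add: stack_def keeps_def)
        subgoal using Leaf.prems(2) by (auto simp: keeps_def)
        subgoal using Leaf.hyps r by auto
        done
      done
  next
    case (Inner w ws us)
    obtain k where k: "regs N rTop = Suc k" "cells N aStack k = w" "rev (map (cells N aStack) [0..<k]) = ws"
      using stack_top[OF Inner.prems(1)] by blast
    have s: "cells N StateOf = cells M StateOf" using Inner.prems(2) by (simp add: keeps_def)
    have c: "children N' = children M" if "keeps {rTop, rNod, rSta, rPtr, rNum} {aStack, Flink, OutHead, OutNext} N N'" for N'
      using Inner.prems(2) that by (simp add: keeps_def children_def fun_eq_iff)
    let ?N = "N\<lparr>regs := (regs N)(rTop := k, rNod := w, rSta := cells M StateOf w)\<rparr>"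
    have r: "regs N rFrom = regs M rFrom" "regs N rTo = regs M rTo" using Inner.prems(2) by (auto simp: keeps_def)
    have N: "?K N ?N" "stack ?N = ws" using k by (auto simp: keeps_def stack_def)
    show ?case
    proof (cases "cells M StateOf w = 0")
      case True
      let ?N = "N\<lparr>regs := (regs N)(rTop := k, rNod := w, rSta := 0)\<rparr>"
      have N: "?K N ?N" "stack ?N = ws" using k by (auto simp: keeps_def stack_def)
      show ?thesis
        apply (subst run_search_unfold)
        using k s True
        apply simp
        apply (rule run_mono[OF run_push_children[of ?N]])
        subgoal for t N'
          apply (rule run_mono[OF Inner.IH[of N']])
          subgoal using N c[of ?N] by simp
          subgoal using Inner.prems(2) by (auto simp: keeps_def)
          subgoal using True c[of ?N] N(1) by (auto simp: keeps_def)
          done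
        done
    next
      case False
      then have ct: "ct = False" using Inner.hyps by auto
      show ?thesis
        apply (subst run_search_unfold)
        using k s False ct
        apply simp
        apply (rule run_mono[OF act[of ?N]])
        subgoal for t N'
          apply (rule run_mono[OF run_push_children[of N']])
          subgoal for t' N''
            apply (rule run_mono[OF Inner.IH[of N'', unfolded ct]])
            subgoal using N c[of N'] by (auto simp: keeps_def stack_def)
            subgoal using Inner.prems(2) by (auto simp: keeps_def)
            subgoal using False c[of N'] N(1) r by (auto simp: keeps_def)
            done
          done
        done
    qed
  qed
  show ?thesis by (rule run_mono[OF *[OF d refl keeps_refl]]) auto
qed

definition relink :: com where
  "relink = Store Flink (Var rSta) (Var rTo)"

text \<open>The head of a state and the successor of a pattern change under the same pointer
  comparison: both point to a longest output, once of the string itself and once of its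
  tail.\<close>

definition redirect :: com where
  "redirect = Seq
     (Cond (Equal (Cell OutHead (Var rSta)) (Var rFrom)) (Store OutHead (Var rSta) (Var rTo)) Skip)
     (Cond (Equal (Cell OutNext (Var rSta)) (Var rFrom)) (Store OutNext (Var rSta) (Var rTo)) Skip)"

text \<open>Neither the order of the visits nor repetitions matter, so the visits together amount to
  one simultaneous update.\<close>

lemma fold_relink:
  "fold (\<lambda>s (F, H, N). (F(s := y), H, N)) ss (F, H, N) = (\<lambda>s. if s \<in> set ss then y else F s, H, N)"
  by (induction ss arbitrary: F) auto

lemma fold_redirect:
  "fold (\<lambda>s (F, H, N). (F, if H s = x then H(s := y) else H, if N s = x then N(s := y) else N)) ss (F, H, N) =
    (F, \<lambda>s. if s \<in> set ss \<and> H s = x then y else H s, \<lambda>s. if s \<in> set ss \<and> N s = x then y else N s)"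
  by (induction ss arbitrary: H N) (auto simp: fun_eq_iff)

lemma run_search_relink:
  assumes "dfs True (cells M StateOf) (children M) (stack M) vs"
  shows "run (search True relink) M (\<lambda>t M'. t \<le> 30 * length vs + 1 \<and>
     keeps {rTop, rNod, rSta, rPtr, rNum} {aStack, Flink} M M' \<and>
     cells M' Flink = (\<lambda>s. if s \<noteq> 0 \<and> s \<in> cells M StateOf ` set vs then regs M rTo else cells M Flink s) \<and>
     regs M' rTop = 0)"
proof -
  have "run relink N (\<lambda>t N'. t \<le> 8 \<and> keeps {} {Flink, OutHead, OutNext} N N' \<and>
     links N' = (\<lambda>x y s (F, H, N). (F(s := y), H, N)) (regs N rFrom) (regs N rTo) (regs N rSta) (links N))" for N
    by (simp add: relink_def keeps_def)
  from run_search[OF assms this] show ?thesis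
    by (rule run_mono, simp only: fold_relink prod.inject) (auto simp: keeps_def intro!: ext)
qed

lemma run_search_redirect:
  assumes "dfs False (cells M StateOf) (children M) (stack M) vs"
  shows "run (search False redirect) M (\<lambda>t M'. t \<le> 30 * length vs + 1 \<and>
     keeps {rTop, rNod, rSta, rPtr, rNum} {aStack, OutHead, OutNext} M M' \<and>
     (\<forall>a\<in>{OutHead, OutNext}. cells M' a = (\<lambda>s. if s \<noteq> 0 \<and> s \<in> cells M StateOf ` set vs \<and>
        cells M a s = regs M rFrom then regs M rTo else cells M a s)))"
proof -
  have "run redirect N (\<lambda>t N'. t \<le> 8 \<and> keeps {} {Flink, OutHead, OutNext} N N' \<and>
     links N' = (\<lambda>x y s (F, H, N). (F, if H s = x then H(s := y) else H, if N s = x then N(s := y) else N))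
       (regs N rFrom) (regs N rTo) (regs N rSta) (links N))" for N
    by (auto simp: redirect_def keeps_def)
  from run_search[OF assms this] show ?thesis
    by (rule run_mono, simp only: fold_redirect prod.inject) (auto simp: keeps_def intro!: ext)
qed

section \<open>The memory before an update\<close>

lemma code_len_pos: "0 < code_len \<sigma>" by (simp add: code_len_def)

lemma code_len_pow: "\<sigma> \<le> 2 ^ code_len \<sigma>"
proof (cases "\<sigma> = 0")
  case False
  have "log 2 (real \<sigma>) \<le> real (code_len \<sigma>)" unfolding code_len_def by linarith
  then have "real \<sigma> \<le> 2 powr real (code_len \<sigma>)" using False by (simp add: log_le_iff)
  then have "real \<sigma> \<le> real (2 ^ code_len \<sigma>)" by (simp add: powr_realpow)
  then show ?thesis by (simp only: of_nat_le_iff)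
qed simp

text \<open>Rounding up adds at most 1, whence the factor 2.\<close>

lemma code_len_le: "real (code_len \<sigma>) \<le> 2 * max 1 (log 2 (real \<sigma>))"
  unfolding code_len_def by (simp add: max_def) linarith

text \<open>The situation common to both updates. Whether \<open>p\<close> belongs to
  \<open>D\<close> is left open, since an insertion may repeat a pattern.\<close>

locale update_setup =
  fixes \<sigma> :: nat and D :: "str set" and p :: str
    and \<nu> :: "str \<times> bool list \<Rightarrow> nat" and \<mu> :: "str set \<times> bool list \<Rightarrow> nat" and M0 :: memory
  assumes dict: "dictionary \<sigma> D" and p_ne: "p \<noteq> []" and p_chars: "set p \<subseteq> {..<\<sigma>}"
    and ac: "represents_ac \<sigma> D \<nu> M0" and dawg: "represents_dawg \<sigma> D \<mu> M0"
    and cross: "cross_linked D \<nu> \<mu> M0" and pat: "pattern_stored p M0"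
begin

definition "L = code_len \<sigma>"
definition "nd x = \<mu> (dawg_class D x, [])"

text \<open>Registers and arrays that both programs leave alone. \<open>StateOf\<close> is absent
  because marks are stored there; the representation of the DAWG does not mention it.\<close>

definition base :: "memory \<Rightarrow> bool" where
  "base N \<longleftrightarrow> (\<forall>r\<in>{PatLen, Width, AcRoot, DawgRoot}. regs N r = regs M0 r) \<and>
     (\<forall>a\<in>{Pat, DawgChild False, DawgChild True, Slink, InvStart, InvCount, InvLinks}. cells N a = cells M0 a)"

lemma base_M0 [simp]: "base M0" by (simp add: base_def)

lemma base_keeps:
  "base N \<Longrightarrow> keeps R A N N' \<Longrightarrow> {PatLen, Width, AcRoot, DawgRoot} \<inter> R = {} \<Longrightarrow>
   {Pat, DawgChild False, DawgChild True, Slink, InvStart, InvCount, InvLinks} \<inter> A = {} \<Longrightarrow> base N'"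
  unfolding base_def keeps_def by (metis disjoint_iff)

lemma fin: "finite D" and Nil_D: "[] \<notin> D" using dict by (auto simp: dictionary_def)

lemma L_pos [simp]: "0 < L" by (simp add: L_def code_len_pos)

lemma char_code: "c < \<sigma> \<Longrightarrow> c < 2 ^ L" using code_len_pow[of \<sigma>] by (simp add: L_def)

lemma chars: "q \<in> D \<Longrightarrow> set q \<subseteq> {..<2 ^ L}" "set p \<subseteq> {..<2 ^ L}"
  using dict p_chars char_code by (auto simp: dictionary_def)

lemma chars_Substr: "x \<in> Substr D \<Longrightarrow> set x \<subseteq> {..<\<sigma>}"
  using dict set_mono_sublist by (fastforce simp: Substr_def dictionary_def)

lemma len_p: "0 < length p" using p_ne by simp

lemma base_regs: "base N \<Longrightarrow> regs N PatLen = length p" "base N \<Longrightarrow> regs N Width = L"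
  "base N \<Longrightarrow> regs N AcRoot = \<nu> ([], [])" "base N \<Longrightarrow> regs N DawgRoot = nd []"
  "base N \<Longrightarrow> i < length p \<Longrightarrow> cells N Pat i = p ! i"
  using pat ac dawg by (auto simp: base_def pattern_stored_def represents_ac_def represents_dawg_def L_def nd_def)

lemma children_base: "base N \<Longrightarrow> children N = children M0"
  by (simp add: base_def children_def fun_eq_iff)

lemma dawg_base: "base N \<Longrightarrow> represents_dawg \<sigma> D \<mu> N"
proof -
  assume b: "base N"
  have e: "(\<lambda>b. cells N (DawgChild b)) = (\<lambda>b. cells M0 (DawgChild b))"
    using b by (auto simp: base_def fun_eq_iff all_bool_eq)
  show ?thesis using dawg b unfolding represents_dawg_def e base_def by simp
qed

lemma nodes: "x \<in> Substr D \<Longrightarrow> (dawg_class D x, []) \<in> branch_keys L (dawg_nodes D) (dawg_edges D)"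
  by (auto simp: branch_keys_def dawg_nodes_def)

lemma nd_pos: "x \<in> Substr D \<Longrightarrow> 0 < nd x"
  using nodes[of x] dawg unfolding nd_def represents_dawg_def branching_def L_def
  by (metis imageI neq0_conv)

lemma nd_inj: "inj_on nd (reps D)"
proof (rule inj_onI)
  fix x y assume xy: "x \<in> reps D" "y \<in> reps D" "nd x = nd y"
  have "inj_on \<mu> (branch_keys L (dawg_nodes D) (dawg_edges D))"
    using dawg unfolding represents_dawg_def branching_def L_def by blast
  then have "dawg_class D x = dawg_class D y"
    using xy nodes[of x] nodes[of y] unfolding nd_def by (auto simp: reps_Substr dest: inj_onD)
  then show "x = y" using dawg_class_inj xy by (auto dest: inj_onD)
qed

lemma nd_ext: "x \<in> Substr D \<Longrightarrow> nd (ext D x) = nd x"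
  using ext(4)[OF fin] by (simp add: nd_def)

lemma walk_dawg:
  assumes b: "base N" and x: "x \<in> Substr D" and c: "c < \<sigma>"
  shows "walk (\<lambda>b. cells N (DawgChild b)) (nd x) (code L c) =
    (if x @ [c] \<in> Substr D then nd (x @ [c]) else 0)"
proof -
  have B: "branching L (dawg_nodes D) (dawg_edges D) \<mu> (\<lambda>b. cells N (DawgChild b))"
    using dawg_base[OF b] by (simp add: represents_dawg_def L_def)
  have v: "dawg_class D x \<in> dawg_nodes D" using x by (simp add: dawg_nodes_def)
  have E: "d < 2 ^ L" if "(dawg_class D x, d, u) \<in> dawg_edges D" for d u
    using that chars_Substr char_code by (force simp: dawg_edges_def)
  \<comment> \<open>An edge leaving the class may be given through another member \<open>y\<close>;
    this transfers it to \<open>x\<close>.\<close>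
  have e: "endPos D (y @ [c]) = endPos D (x @ [c])" if "endPos D y = endPos D x" for y
    using that by (simp add: endPos_snoc)
  note w = walk_branching[OF B L_pos v E char_code[OF c]]
  show ?thesis
  proof (cases "x @ [c] \<in> Substr D")
    case True
    then have "(dawg_class D x, c, dawg_class D (x @ [c])) \<in> dawg_edges D" using x by (auto simp: dawg_edges_def)
    then show ?thesis using w(1) True by (simp add: nd_def)
  next
    case False
    have "\<nexists>u. (dawg_class D x, c, u) \<in> dawg_edges D"
    proof
      assume "\<exists>u. (dawg_class D x, c, u) \<in> dawg_edges D"
      then obtain y where y: "y \<in> Substr D" "y @ [c] \<in> Substr D" "dawg_class D x = dawg_class D y"
        by (auto simp: dawg_edges_def)
      then have "endPos D y = endPos D x" using dawg_class_eq[OF y(1), of x] by simp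
      then have "endPos D (x @ [c]) \<noteq> {}" using e[of y] y(2) Substr_endPos[of "y @ [c]" D] by auto
      then show False using False by (simp add: Substr_endPos)
    qed
    then show ?thesis using w(2) False by (simp add: nd_def)
  qed
qed

text \<open>The array segment lists classes. Inverting \<open>dawg_class\<close>, which is injective
  on representatives, turns it into a list of the children without repetitions.\<close>

lemma kids_nodes:
  assumes z: "z \<in> reps D"
  shows "\<exists>ys. distinct ys \<and> set ys = kids D z \<and> children M0 (nd z) = map nd ys"
proof -
  have "dawg_class D z \<in> dawg_nodes D" using reps_Substr[OF z] by (simp add: dawg_nodes_def)
  then obtain vs where vs: "distinct vs" "set vs = {v. (v, dawg_class D z) \<in> slinks D}"
    "cells M0 InvCount (nd z) = length vs"
    "\<forall>i<length vs. cells M0 InvLinks (cells M0 InvStart (nd z) + i) = \<mu> (vs ! i, [])"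
    using dawg unfolding represents_dawg_def nd_def by blast
  have ch: "children M0 (nd z) = map (\<lambda>v. \<mu> (v, [])) vs"
    unfolding children_def by (rule nth_equalityI) (simp_all add: vs(3,4))
  have sv: "set vs = dawg_class D ` kids D z" using vs(2) slinks_to_rep[OF fin z] by simp
  have inj: "inj_on (dawg_class D) (kids D z)"
    by (rule inj_on_subset[OF dawg_class_inj]) (use kids_reps[OF fin] in auto)
  define ys where "ys = map (inv_into (kids D z) (dawg_class D)) vs"
  have "map (dawg_class D) ys = vs"
    unfolding ys_def map_map o_def by (rule map_idI) (simp add: f_inv_into_f flip: sv)
  moreover from this have "distinct ys" using vs(1) by (metis distinct_map)
  moreover have "set ys = kids D z" unfolding ys_def set_map sv using inv_into_image_cancel[OF inj order_refl] .
  ultimately show ?thesis using ch by (intro exI[of _ ys]) (auto simp: nd_def)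
qed

lemma StateOf_M0:
  assumes z: "z \<in> reps D"
  shows "cells M0 StateOf (nd z) = (if z \<in> Pref D then \<nu> (z, []) else 0)"
proof (cases "z \<in> Pref D")
  case False
  then have "dawg_class D z \<inter> Pref D = {}" using class_Pref[OF z] by auto
  moreover have "dawg_class D z \<in> dawg_nodes D" using reps_Substr[OF z] by (simp add: dawg_nodes_def)
  ultimately show ?thesis using cross False by (auto simp: cross_linked_def nd_def)
qed (use cross in \<open>auto simp: cross_linked_def nd_def\<close>)

lemma NodeOf_M0: "s \<in> Pref D \<Longrightarrow> cells M0 NodeOf (\<nu> (s, [])) = nd s"
  using cross by (auto simp: cross_linked_def nd_def)

lemma initial_trie:
  obtains a where "trie (code_words L D) a (\<lambda>b. cells M0 (AcChild b)) (regs M0 FreeId)"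
    "\<And>v w. (v, w) \<in> branch_keys L (Pref D) (goto_edges D) \<Longrightarrow> a (bits L v @ w) = \<nu> (v, w)"
proof -
  have B: "branching L (Pref D) (goto_edges D) \<nu> (\<lambda>b. cells M0 (AcChild b))"
    and F: "\<forall>k\<in>branch_keys L (Pref D) (goto_edges D). \<nu> k < regs M0 FreeId"
    using ac unfolding represents_ac_def L_def by blast+
  have D: "set q \<subseteq> {..<2 ^ L}" if "q \<in> D" for q
    by (rule chars(1)[OF that])
  obtain a where a: "trie (code_words L D) a (\<lambda>b. cells M0 (AcChild b)) (regs M0 FreeId)"
    "\<And>v w. (v, w) \<in> branch_keys L (Pref D) (goto_edges D) \<Longrightarrow> a (bits L v @ w) = \<nu> (v, w)"
    using trie_of_branching[OF L_pos D B F] by metis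
  show thesis by (rule that[OF a])
qed

lemma marked_dawgI:
  assumes "Pref D \<subseteq> Mk" "Mk \<subseteq> reps D" "base N"
    "\<And>z. z \<in> reps D \<Longrightarrow> cells N StateOf (nd z) \<noteq> 0 \<longleftrightarrow> z \<in> Mk"
  shows "marked_dawg D Mk nd (cells N StateOf) (children N)"
proof
  show "\<exists>ys. distinct ys \<and> set ys = kids D z \<and> children N (nd z) = map nd ys" if "z \<in> reps D" for z
    using kids_nodes[OF that] by (simp only: children_base[OF assms(3)])
qed (fact fin assms)+

lemma initial_outputs:
  "s \<in> Pref D \<Longrightarrow> cells M0 OutHead (\<nu> (s, [])) = out_addr \<nu> (top_out D s)"
  "q \<in> D \<Longrightarrow> cells M0 OutNext (\<nu> (q, [])) = out_addr \<nu> (top_out D (tl q))"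
  using ac output_lists_iff[OF fin Nil_D, of "cells M0 OutNext" "cells M0 OutHead" \<nu>]
  by (auto simp: represents_ac_def)

end

text \<open>Every stacked vertex is visited; this bounds the cost of pushing the first children by
  the number of visits.\<close>

lemma dfs_stack_le: "dfs ct st ch ws vs \<Longrightarrow> length ws \<le> length vs"
  by (induction rule: dfs.induct) auto

section \<open>Extending the trie\<close>

text \<open>Old vertices keep their addresses and new ones lie at or above \<open>F\<close>.
  Comparing an address with the initial value of \<open>FreeId\<close> therefore tells old states
  from new ones.\<close>

definition grows :: "bool list set \<Rightarrow> (bool list \<Rightarrow> nat) \<Rightarrow> nat \<Rightarrow> bool list set \<Rightarrow> (bool list \<Rightarrow> nat) \<Rightarrow> nat \<Rightarrow> bool" where
  "grows T a F T' a' F' \<longleftrightarrow> T \<subseteq> T' \<and> (\<forall>\<beta>\<in>T. a' \<beta> = a \<beta>) \<and> (\<forall>\<beta>\<in>T' - T. F \<le> a' \<beta>) \<and> F \<le> F'"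

lemma grows_refl [simp]: "grows T a F T a F" by (simp add: grows_def)

lemma grows_trans: "grows T a F T' a' F' \<Longrightarrow> grows T' a' F' T'' a'' F'' \<Longrightarrow> grows T a F T'' a'' F''"
  unfolding grows_def by (smt (verit, best) DiffD1 DiffD2 DiffI le_trans subset_iff)

abbreviation ac_children :: "memory \<Rightarrow> bool \<Rightarrow> nat \<Rightarrow> nat" where
  "ac_children M \<equiv> \<lambda>b. cells M (AcChild b)"

definition descend :: "bool \<Rightarrow> com" where
  "descend b = block [
     Cond (Equal (Cell (AcChild b) (Var rCur)) (Num 0))
       (block [
         Store (AcChild False) (Var FreeId) (Num 0),
         Store (AcChild True) (Var FreeId) (Num 0),
         Store (AcChild b) (Var rCur) (Var FreeId),
         Assign FreeId (Incr (Var FreeId))])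
       Skip,
     Assign rCur (Cell (AcChild b) (Var rCur))]"

lemma run_descend:
  assumes T: "trie T a (ac_children M) (regs M FreeId)" "\<beta> \<in> T" "regs M rCur = a \<beta>"
  shows "run (descend b) M (\<lambda>t M'. t \<le> 9 \<and> keeps {rCur, FreeId} {AcChild False, AcChild True} M M' \<and>
    (\<exists>a'. trie (insert (\<beta> @ [b]) T) a' (ac_children M') (regs M' FreeId) \<and>
      grows T a (regs M FreeId) (insert (\<beta> @ [b]) T) a' (regs M' FreeId) \<and>
      regs M' rCur = a' (\<beta> @ [b])))"
proof -
  let ?F = "regs M FreeId"
  have ch: "cells M (AcChild b) (a \<beta>) = (if \<beta> @ [b] \<in> T then a (\<beta> @ [b]) else 0)"
    and aF: "a \<beta> < ?F" using T(1,2) unfolding trie_def by blast+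
  show ?thesis
  proof (cases "\<beta> @ [b] \<in> T")
    case True
    then have "0 < a (\<beta> @ [b])" using T(1) unfolding trie_def by blast
    then have "cells M (AcChild b) (regs M rCur) = a (\<beta> @ [b])" "a (\<beta> @ [b]) \<noteq> 0" using ch True T(3) by auto
    then show ?thesis using True T(1) insert_absorb[OF True]
      by (auto simp: descend_def keeps_def intro!: exI[of _ a])
  next
    case False
    let ?ch = "\<lambda>b' v. if b' = b \<and> v = a \<beta> then ?F else if v = ?F then 0 else cells M (AcChild b') v"
    let ?a = "a(\<beta> @ [b] := ?F)"
    have t: "trie (insert (\<beta> @ [b]) T) ?a ?ch (Suc ?F)" by (rule trie_extend[OF T(1,2) False]) simp
    define M' where "M' = M\<lparr>regs := (regs M)(FreeId := Suc ?F, rCur := ?F),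
      cells := (\<lambda>x. if x = AcChild False then ?ch False else if x = AcChild True then ?ch True else cells M x)\<rparr>"
    have c: "ac_children M' = ?ch" by (auto simp: M'_def fun_eq_iff all_bool_eq)
    have g: "grows T a ?F (insert (\<beta> @ [b]) T) ?a (Suc ?F)" using False by (auto simp: grows_def)
    have "run (descend b) M (\<lambda>t N. t \<le> 9 \<and> N = M')"
      using ch False T(3) aF by (cases b) (auto simp: descend_def M'_def fun_eq_iff)
    then show ?thesis
      by (rule run_mono) (use t c g in \<open>auto simp: M'_def keeps_def intro!: exI[of _ ?a]\<close>)
  qed
qed

definition descend_char :: com where
  "descend_char = block [
     Assign rCnt (Var Width),
     While (Less (Num 0) (Var rCnt)) (block [
       Cond (Equal (Parity (Var rChr)) (Num 0)) (descend False) (descend True),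
       Assign rChr (Half (Var rChr)),
       Assign rCnt (Decr (Var rCnt))])]"

text \<open>Parity yields the next digit and halving removes it. In the invariant
  \<open>\<epsilon>\<close> is the part of the code already read, and the trie has grown by the path
  for \<open>\<epsilon>\<close>.\<close>

lemma run_descend_char:
  assumes T: "trie T a (ac_children M) (regs M FreeId)" "\<beta> \<in> T" "regs M rCur = a \<beta>"
  defines "\<gamma> \<equiv> code (regs M Width) (regs M rChr)"
  defines "T' \<equiv> T \<union> {\<beta> @ \<delta> | \<delta>. prefix \<delta> \<gamma>}"
  shows "run descend_char M (\<lambda>t M'. t \<le> 14 * regs M Width + 3 \<and>
    keeps {rCur, rChr, rCnt, FreeId} {AcChild False, AcChild True} M M' \<and>
    (\<exists>a'. trie T' a' (ac_children M') (regs M' FreeId) \<and>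
      grows T a (regs M FreeId) T' a' (regs M' FreeId) \<and> regs M' rCur = a' (\<beta> @ \<gamma>)))"
proof -
  let ?T = "\<lambda>\<epsilon>. T \<union> {\<beta> @ \<delta> | \<delta>. prefix \<delta> \<epsilon>}"
  define I where "I n t N \<longleftrightarrow> n = regs N rCnt \<and> t + 14 * n \<le> 14 * regs M Width \<and>
     keeps {rCur, rChr, rCnt, FreeId} {AcChild False, AcChild True} M N \<and>
     (\<exists>\<epsilon> a'. \<epsilon> @ code n (regs N rChr) = \<gamma> \<and> trie (?T \<epsilon>) a' (ac_children N) (regs N FreeId) \<and>
      grows T a (regs M FreeId) (?T \<epsilon>) a' (regs N FreeId) \<and> regs N rCur = a' (\<beta> @ \<epsilon>))" for n t N
  have step: "run (block [
       Cond (Equal (Parity (Var rChr)) (Num 0)) (descend False) (descend True),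
       Assign rChr (Half (Var rChr)), Assign rCnt (Decr (Var rCnt))]) N (\<lambda>u N'. \<exists>n'<n. I n' (t + u + 1) N')"
    if I: "I n t N" and b: "0 < regs N rCnt" for n t N
  proof -
    from I b obtain k where k: "n = Suc k" "regs N rCnt = Suc k" unfolding I_def by (metis Suc_pred)
    from I obtain \<epsilon> a' where e: "\<epsilon> @ code n (regs N rChr) = \<gamma>" "trie (?T \<epsilon>) a' (ac_children N) (regs N FreeId)"
      "grows T a (regs M FreeId) (?T \<epsilon>) a' (regs N FreeId)" "regs N rCur = a' (\<beta> @ \<epsilon>)"
      and kp: "keeps {rCur, rChr, rCnt, FreeId} {AcChild False, AcChild True} M N" and tt: "t + 14 * n \<le> 14 * regs M Width"
      unfolding I_def by blast
    let ?b = "odd (regs N rChr)"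
    have ins: "insert ((\<beta> @ \<epsilon>) @ [?b]) (?T \<epsilon>) = ?T (\<epsilon> @ [?b])" by auto
    have eq: "(if bval (Equal (Parity (Var rChr)) (Num 0)) N then descend False else descend True) = descend ?b"
      by (simp add: odd_iff_mod_2_eq_one)
    have "\<beta> @ \<epsilon> \<in> ?T \<epsilon>" by auto
    from run_descend[OF e(2) this e(4), of ?b]
    have "run (descend ?b) N (\<lambda>u N'. run (block [Assign rChr (Half (Var rChr)), Assign rCnt (Decr (Var rCnt))]) N'
       (\<lambda>v N''. I k (t + (Suc u + v) + 1) N''))"
    proof (rule run_mono, elim conjE exE)
      fix u :: nat and N' a''
      assume u: "u \<le> 9" "keeps {rCur, FreeId} {AcChild False, AcChild True} N N'"
        and a: "trie (insert ((\<beta> @ \<epsilon>) @ [?b]) (?T \<epsilon>)) a'' (ac_children N') (regs N' FreeId)"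
        "grows (?T \<epsilon>) a' (regs N FreeId) (insert ((\<beta> @ \<epsilon>) @ [?b]) (?T \<epsilon>)) a'' (regs N' FreeId)"
        "regs N' rCur = a'' ((\<beta> @ \<epsilon>) @ [?b])"
      have g: "grows T a (regs M FreeId) (?T (\<epsilon> @ [?b])) a'' (regs N' FreeId)"
        using grows_trans[OF e(3)] a(2) ins by simp
      have c: "(\<epsilon> @ [?b]) @ code k (regs N rChr div 2) = \<gamma>" using e(1) k by (simp add: code_Suc)
      have r: "regs N' rChr = regs N rChr" "regs N' rCnt = Suc k" using u(2) k by (auto simp: keeps_def)
      let ?N = "N'\<lparr>regs := (regs N')(rChr := regs N rChr div 2, rCnt := k)\<rparr>"
      have "keeps {rCur, rChr, rCnt, FreeId} {AcChild False, AcChild True} M ?N"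
        using kp u(2) by (auto simp: keeps_def)
      moreover have "\<exists>\<epsilon> a'. \<epsilon> @ code k (regs ?N rChr) = \<gamma> \<and> trie (?T \<epsilon>) a' (ac_children ?N) (regs ?N FreeId) \<and>
          grows T a (regs M FreeId) (?T \<epsilon>) a' (regs ?N FreeId) \<and> regs ?N rCur = a' (\<beta> @ \<epsilon>)"
        by (rule exI[of _ "\<epsilon> @ [?b]"], rule exI[of _ a'']) (use c g a ins in simp)
      moreover have "t + (Suc u + 3) + 1 + 14 * k \<le> 14 * regs M Width" using tt u k by simp
      ultimately have "I k (t + (Suc u + 3) + 1) ?N" unfolding I_def by simp
      then show "run (block [Assign rChr (Half (Var rChr)), Assign rCnt (Decr (Var rCnt))]) N'
          (\<lambda>v N''. I k (t + (Suc u + v) + 1) N'')"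
        using r by (simp add: numeral_3_eq_3)
    qed
    then show ?thesis using k eq
      by (simp only: block.simps run_Seq run_Cond) (erule run_mono, simp, metis lessI)
  qed
  show ?thesis unfolding descend_char_def
    apply (simp only: block.simps run_Seq run_Assign run_Skip)
    apply (rule run_while[where I = I and n = "regs M Width"])
    subgoal
    proof -
      have "?T [] = T" using T(2) by auto
      then show ?thesis using T unfolding I_def
        by (auto simp: keeps_def \<gamma>_def intro!: exI[of _ "[]"] exI[of _ a])
    qed
    subgoal for n t N using step[of n t N] by simp
    subgoal for n t N unfolding I_def T'_def by auto
    done
qed

text \<open>\<open>rOld\<close> remembers the first free address before the trie grows.
  \<open>aState\<close> records the states of all prefixes of \<open>p\<close> by length, as the
  later parts address them in this way.\<close>

definition build :: com where
  "build = block [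
     Assign rOld (Var FreeId),
     Assign rCur (Var AcRoot),
     Assign rIdx (Num 0),
     Store aState (Num 0) (Var rCur),
     While (Less (Var rIdx) (Var PatLen)) (block [
       Assign rChr (Cell Pat (Var rIdx)),
       descend_char,
       Assign rIdx (Incr (Var rIdx)),
       Store aState (Var rIdx) (Var rCur)])]"

lemma bits_take_prefix: "i \<le> j \<Longrightarrow> prefix (bits L (take i q)) (bits L (take j q))"
proof -
  assume "i \<le> j"
  then have "take i q = take i (take j q)" by simp
  then have "prefix (take i q) (take j q)" by (metis take_is_prefix)
  then show ?thesis by (auto simp: prefix_def)
qed

lemma (in update_setup) run_build:
  assumes T: "trie (code_words L D) a (ac_children M0) (regs M0 FreeId)" "regs M0 AcRoot = a []"
  shows "run build M0 (\<lambda>t M'. t \<le> 30 * L * length p + 6 \<and>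
    keeps {rOld, rIdx, rCur, rChr, rCnt, FreeId} {AcChild False, AcChild True, aState} M0 M' \<and>
    regs M' rOld = regs M0 FreeId \<and>
    (\<exists>a'. trie (code_words L (D \<union> {p})) a' (ac_children M') (regs M' FreeId) \<and>
      grows (code_words L D) a (regs M0 FreeId) (code_words L (D \<union> {p})) a' (regs M' FreeId) \<and>
      (\<forall>i\<le>length p. cells M' aState i = a' (bits L (take i p)))))"
proof -
  let ?T = "\<lambda>j. code_words L D \<union> {\<beta>. prefix \<beta> (bits L (take j p))}"
  let ?K = "keeps {rOld, rIdx, rCur, rChr, rCnt, FreeId} {AcChild False, AcChild True, aState}"
  define I where "I n t N \<longleftrightarrow> n + regs N rIdx = length p \<and> t \<le> 30 * L * regs N rIdx \<and> ?K M0 N \<and>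
     regs N rOld = regs M0 FreeId \<and>
     (\<exists>a'. trie (?T (regs N rIdx)) a' (ac_children N) (regs N FreeId) \<and>
      grows (code_words L D) a (regs M0 FreeId) (?T (regs N rIdx)) a' (regs N FreeId) \<and>
      regs N rCur = a' (bits L (take (regs N rIdx) p)) \<and>
      (\<forall>i\<le>regs N rIdx. cells N aState i = a' (bits L (take i p))))" for n t N
  have step: "run (block [Assign rChr (Cell Pat (Var rIdx)), descend_char, Assign rIdx (Incr (Var rIdx)),
       Store aState (Var rIdx) (Var rCur)]) N (\<lambda>u N'. \<exists>n'<n. I n' (t + u + 1) N')"
    if I: "I n t N" and b: "regs N rIdx < length p" for n t N
  proof -
    define j where "j = regs N rIdx"
    from I obtain a' where tr: "trie (?T j) a' (ac_children N) (regs N FreeId)"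
      and gr: "grows (code_words L D) a (regs M0 FreeId) (?T j) a' (regs N FreeId)"
      and cu: "regs N rCur = a' (bits L (take j p))"
      and st: "\<forall>i\<le>j. cells N aState i = a' (bits L (take i p))" unfolding I_def j_def by blast
    have kp: "?K M0 N" and tt: "t \<le> 30 * L * j" and n: "n + j = length p" and old: "regs N rOld = regs M0 FreeId"
      using I unfolding I_def j_def by blast+
    then obtain k where k: "n = Suc k" using b by (cases n) (auto simp: j_def)
    have bN: "base N" by (rule base_keeps[OF base_M0 kp]) auto
    let ?c = "p ! j"
    let ?N = "N\<lparr>regs := (regs N)(rChr := ?c)\<rparr>"
    have pc: "cells N Pat (regs N rIdx) = ?c" using base_regs(5)[OF bN] b by (simp add: j_def)
    have "trie (?T j) a' (ac_children ?N) (regs ?N FreeId)" "bits L (take j p) \<in> ?T j"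
      "regs ?N rCur = a' (bits L (take j p))" using tr cu by auto
    note rd = run_descend_char[OF this]
    have W: "regs ?N Width = L" using base_regs(2)[OF bN] by simp
    have tk: "take (Suc j) p = take j p @ [?c]" using b by (simp add: j_def take_Suc_conv_app_nth)
    have Tj: "?T j \<union> {bits L (take j p) @ \<delta> | \<delta>. prefix \<delta> (code L ?c)} = ?T (Suc j)"
      unfolding tk by (auto simp: prefix_append)
    have "run descend_char ?N (\<lambda>u N'. run (block [Assign rIdx (Incr (Var rIdx)), Store aState (Var rIdx) (Var rCur)]) N'
       (\<lambda>v N''. I k (t + (Suc u + v) + 1) N''))"
      using rd
    proof (rule run_mono, elim conjE exE, unfold W)
      fix u :: nat and N' a''
      assume u: "u \<le> 14 * L + 3" "keeps {rCur, rChr, rCnt, FreeId} {AcChild False, AcChild True} ?N N'"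
        and a0: "trie (?T j \<union> {bits L (take j p) @ \<delta> |\<delta>. prefix \<delta> (code L (regs ?N rChr))}) a'' (ac_children N') (regs N' FreeId)"
        "grows (?T j) a' (regs ?N FreeId) (?T j \<union> {bits L (take j p) @ \<delta> |\<delta>. prefix \<delta> (code L (regs ?N rChr))}) a'' (regs N' FreeId)"
        "regs N' rCur = a'' (bits L (take j p) @ code L (regs ?N rChr))"
      have a: "trie (?T (Suc j)) a'' (ac_children N') (regs N' FreeId)"
        "grows (?T j) a' (regs N FreeId) (?T (Suc j)) a'' (regs N' FreeId)"
        "regs N' rCur = a'' (bits L (take (Suc j) p))"
        using a0 Tj tk by auto
      have r: "regs N' rIdx = j" "cells N' aState = cells N aState" using u(2) by (auto simp: keeps_def j_def)
      let ?N' = "N'\<lparr>regs := (regs N')(rIdx := Suc j), cells := (cells N')(aState := (cells N' aState)(Suc j := regs N' rCur))\<rparr>"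
      have g: "grows (code_words L D) a (regs M0 FreeId) (?T (Suc j)) a'' (regs N' FreeId)"
        by (rule grows_trans[OF gr a(2)])
      have "a'' (bits L (take i p)) = a' (bits L (take i p))" if "i \<le> j" for i
        using a(2) bits_take_prefix[OF that, of L p] by (simp add: grows_def)
      then have "\<forall>i\<le>Suc j. cells ?N' aState i = a'' (bits L (take i p))"
        using st a(3) r by (auto simp: le_Suc_eq)
      moreover have "?K M0 ?N'" using kp u(2) by (auto simp: keeps_def)
      moreover have "t + (Suc u + 3) + 1 \<le> 30 * L * Suc j"
      proof -
        have "30 * L * Suc j = 30 * L * j + 30 * L" by simp
        moreover have "Suc u + 3 + 1 \<le> 30 * L" using u(1) L_pos by linarith
        ultimately show ?thesis using tt by linarith
      qed
      moreover have "regs ?N' rOld = regs M0 FreeId" using u(2) old by (auto simp: keeps_def)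
      ultimately have "I k (t + (Suc u + 3) + 1) ?N'"
        unfolding I_def using a g n k by (auto intro!: exI[of _ a''])
      then show "run (block [Assign rIdx (Incr (Var rIdx)), Store aState (Var rIdx) (Var rCur)]) N'
          (\<lambda>v N''. I k (t + (Suc u + v) + 1) N'')"
        using r by (simp add: numeral_3_eq_3)
    qed
    then show ?thesis using k pc
      by (simp only: block.simps run_Seq run_Assign aval.simps) (erule run_mono, simp, metis lessI)
  qed
  have bits0: "{\<beta>. prefix \<beta> (bits L (take 0 p))} = {[]}" by auto
  have T0: "?T 0 = code_words L D" by (auto simp: code_words_def)
  have Tp: "?T (length p) = code_words L (D \<union> {p})" by (auto simp: code_words_def)
  show ?thesis unfolding build_def
    apply (simp only: block.simps run_Seq run_Assign run_Store run_Skip)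
    apply (rule run_while[where I = I and n = "length p"])
    subgoal
      unfolding I_def using T T0 by (auto simp: keeps_def intro!: exI[of _ a])
    subgoal for n t N
    proof -
      assume I: "I n t N" "bval (Less (Var rIdx) (Var PatLen)) N"
      then have "base N" unfolding I_def by (auto intro: base_keeps[OF base_M0])
      then show ?thesis using step[OF I(1)] I(2) base_regs(1) by simp
    qed
    subgoal for n t N
    proof -
      assume I: "I n t N" "\<not> bval (Less (Var rIdx) (Var PatLen)) N"
      then have "base N" unfolding I_def by (auto intro: base_keeps[OF base_M0])
      then have i: "regs N rIdx = length p" using I base_regs(1) by (auto simp: I_def)
      show ?thesis using I(1) Tp unfolding I_def i by (auto simp: mult.assoc)
    qed
    done
qed

section \<open>Insertion\<close>

text \<open>Treats the prefix of length \<open>rIdx\<close>, whose node is \<open>rNod\<close>; an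
  address below \<open>rOld\<close> belongs to an old state and is skipped. If the node carries no
  state, it becomes the root of a later search. If it carries one, the mark is about to hide that
  state, so its failure link is set first. \<open>rSave\<close> keeps the previous entry of
  \<open>StateOf\<close>.\<close>

definition mark :: com where
  "mark = block [
     Assign rSave (Cell StateOf (Var rNod)),
     Cond (Less (Cell aState (Var rIdx)) (Var rOld)) Skip (block [
       Cond (Equal (Var rSave) (Num 0))
         (block [Store aRoots (Var rRoots) (Var rNod), Assign rRoots (Incr (Var rRoots))])
         (Store Flink (Var rSave) (Cell aState (Var rIdx))),
       Store StateOf (Var rNod) (Cell aState (Var rIdx))])]"

definition scan :: com where
  "scan = block [
     Assign rNod (Var DawgRoot), Assign rIdx (Num 0), Assign rRoots (Num 0),
     While (Conj (Less (Var rIdx) (Var PatLen)) (Neg (Equal (Var rNod) (Num 0)))) (block [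
       Assign rCur (Var rNod),
       Assign rChr (Cell Pat (Var rIdx)),
       walk_com DawgChild,
       Assign rNod (Var rCur),
       Assign rIdx (Incr (Var rIdx)),
       Cond (Equal (Var rNod) (Num 0)) Skip mark])]"

text \<open>The situation after \<open>build\<close>: \<open>sa\<close> maps the states of the new
  automaton to their addresses, and \<open>F0\<close> separates old addresses from new ones.\<close>

locale insertion = update_setup +
  fixes sa :: "str \<Rightarrow> nat" and F0 :: nat and D' :: "str set"
  assumes D': "D' = D \<union> {p}"
    and sa_old: "\<And>s. s \<in> Pref D \<Longrightarrow> sa s = \<nu> (s, []) \<and> sa s < F0"
    and sa_new: "\<And>s. s \<in> Pref D' \<Longrightarrow> s \<notin> Pref D \<Longrightarrow> F0 \<le> sa s"
    and sa_inj: "inj_on sa (Pref D')"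
    and sa_pos: "\<And>s. s \<in> Pref D' \<Longrightarrow> 0 < sa s"
begin

abbreviation "new \<equiv> fresh D p"
abbreviation "near x \<equiv> reach True (reps D) (marked D p) (ext D x)"

definition states :: "memory \<Rightarrow> bool" where
  "states N \<longleftrightarrow> regs N rOld = F0 \<and> (\<forall>i\<le>length p. cells N aState i = sa (take i p))"

lemma states_keeps: "states N \<Longrightarrow> keeps R A N N' \<Longrightarrow> rOld \<notin> R \<Longrightarrow> aState \<notin> A \<Longrightarrow> states N'"
  by (auto simp: states_def keeps_def)

lemma Pref_D'_iff: "u \<in> Pref D' \<longleftrightarrow> u \<in> Pref D \<or> prefix u p"
  using Pref_insert[OF p_ne] by (auto simp: D')

lemma take_Pref [simp]: "take i p \<in> Pref D'" by (simp add: Pref_D'_iff take_is_prefix)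

lemma Pref_mono: "u \<in> Pref D \<Longrightarrow> u \<in> Pref D'" by (simp add: Pref_D'_iff)

lemma sa_eq: "x \<in> Pref D' \<Longrightarrow> y \<in> Pref D' \<Longrightarrow> sa x = sa y \<longleftrightarrow> x = y"
  using sa_inj by (auto dest: inj_onD)

lemma sa_less_F0: "x \<in> Pref D' \<Longrightarrow> sa x < F0 \<longleftrightarrow> x \<in> Pref D"
  using sa_old sa_new by (meson not_less)

lemma newD: "x \<in> new \<Longrightarrow> prefix x p \<and> x \<notin> Pref D \<and> x \<in> Substr D \<and> x \<in> Pref D' \<and> ext D x \<in> reps D \<and> 0 < sa x"
  using ext(1)[OF fin] by (auto simp: fresh_def Pref_D'_iff intro: sa_pos)

definition state_addr :: "str \<Rightarrow> nat" where
  "state_addr z = (if z \<in> Pref D then sa z else 0)"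

lemma StateOf_initial: "z \<in> reps D \<Longrightarrow> cells M0 StateOf (nd z) = state_addr z"
  using StateOf_M0 sa_old by (simp add: state_addr_def)

text \<open>\<open>X\<close> holds the fresh prefixes treated so far. Only those whose node carries
  no state are listed in \<open>aRoots\<close>; for the others the link of the hidden state is
  already final.\<close>

definition scanned :: "str set \<Rightarrow> memory \<Rightarrow> bool" where
  "scanned X N \<longleftrightarrow>
     (\<forall>x\<in>X. ext D x \<in> Pref D \<longrightarrow> cells N Flink (sa (ext D x)) = sa x) \<and>
     (\<forall>s\<in>Pref D. s \<notin> ext D ` X \<longrightarrow> cells N Flink (sa s) = cells M0 Flink (sa s)) \<and>
     (\<forall>x\<in>X. cells N StateOf (nd (ext D x)) = sa x) \<and>
     (\<forall>z\<in>reps D. z \<notin> ext D ` X \<longrightarrow> cells N StateOf (nd z) = state_addr z) \<and>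
     (\<exists>xs. distinct xs \<and> set xs = {x \<in> X. ext D x \<notin> Pref D} \<and> regs N rRoots = length xs \<and>
        (\<forall>i<length xs. cells N aRoots i = nd (ext D (xs ! i))))"

lemma ext_neq:
  assumes "x \<in> Substr D" "prefix x p" "X \<subseteq> new" "x \<notin> X"
  shows "ext D x \<notin> ext D ` X"
proof
  assume "ext D x \<in> ext D ` X"
  then obtain y where y: "y \<in> X" "ext D x = ext D y" by auto
  then have "x = y" using newD[of y] assms by (intro ext_inj_prefixes[OF fin assms(2)]) auto
  then show False using y assms(4) by simp
qed

text \<open>The earlier marks sit at other nodes, because different prefixes of \<open>p\<close>
  have different representatives; so marking \<open>x\<close> overwrites nothing that the invariant
  records for \<open>X\<close>.\<close>

lemma run_mark:
  assumes x: "x \<in> Substr D" "prefix x p" and X: "X \<subseteq> new" "x \<notin> X" and sc: "scanned X N"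
    and N: "regs N rNod = nd x" "cells N aState (regs N rIdx) = sa x" "regs N rOld = F0"
  shows "run mark N (\<lambda>t N'. t \<le> 12 \<and> keeps {rSave, rRoots} {aRoots, Flink, StateOf} N N' \<and>
    scanned (if x \<in> Pref D then X else insert x X) N' \<and> regs N' rSave = state_addr (ext D x))"
proof -
  note e = ext[OF fin x(1)]
  have ne: "ext D x \<notin> ext D ` X" by (rule ext_neq[OF x X])
  have ne': "ext D y \<noteq> ext D x" if "y \<in> X" for y using ne that by (metis imageI)
  note nx = nd_ext[OF x(1), symmetric]
  have xP: "x \<in> Pref D'" using x(2) by (simp add: Pref_D'_iff)
  have save: "cells N StateOf (nd x) = state_addr (ext D x)"
    using sc ne e(1) by (simp add: scanned_def nx)
  show ?thesis
  proof (cases "x \<in> Pref D")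
    case True
    then have "sa x < F0" using sa_less_F0[OF xP] by simp
    then show ?thesis using N save sc True
      by (simp add: mark_def keeps_def scanned_def)
  next
    case False
    then have old: "\<not> sa x < F0" using sa_less_F0[OF xP] by simp
    let ?S' = "(cells N StateOf)(nd x := sa x)"
    have S: "\<forall>y\<in>insert x X. ?S' (nd (ext D y)) = sa y"
    proof
      fix y assume y: "y \<in> insert x X"
      show "?S' (nd (ext D y)) = sa y"
      proof (cases "y = x")
        case False
        then have yX: "y \<in> X" using y by simp
        have "ext D y \<noteq> ext D x" "ext D y \<in> reps D" using ne' newD X(1) yX by auto
        then have "nd (ext D y) \<noteq> nd x" using nd_inj e(1) nx by (auto simp: inj_on_def)
        then show ?thesis using sc yX by (simp add: scanned_def)
      qed (simp add: nx)
    qed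
    have S2: "?S' (nd z) = state_addr z" if z: "z \<in> reps D" "z \<notin> ext D ` insert x X" for z
    proof -
      have "nd z \<noteq> nd x" using nd_inj e(1) nx z by (auto simp: inj_on_def)
      then show ?thesis using sc z by (simp add: scanned_def)
    qed
    from sc obtain xs where xs: "distinct xs" "set xs = {x \<in> X. ext D x \<notin> Pref D}" "regs N rRoots = length xs"
        "\<forall>i<length xs. cells N aRoots i = nd (ext D (xs ! i))" unfolding scanned_def by blast
    show ?thesis
    proof (cases "ext D x \<in> Pref D")
      case True
      then have sv: "state_addr (ext D x) = sa (ext D x)" "0 < sa (ext D x)"
        using sa_pos Pref_mono by (auto simp: state_addr_def)
      let ?F' = "(cells N Flink)(sa (ext D x) := sa x)"
      have F: "\<forall>y\<in>insert x X. ext D y \<in> Pref D \<longrightarrow> ?F' (sa (ext D y)) = sa y"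
        using sc ne' True by (auto simp: scanned_def sa_eq Pref_mono)
      have F2: "?F' (sa s) = cells M0 Flink (sa s)" if s: "s \<in> Pref D" "s \<notin> ext D ` insert x X" for s
        using sc s True by (auto simp: scanned_def sa_eq Pref_mono)
      have xs': "set xs = {x' \<in> insert x X. ext D x' \<notin> Pref D}" using xs(2) True by auto
      let ?N = "N\<lparr>regs := (regs N)(rSave := sa (ext D x)), cells := (cells N)(Flink := ?F', StateOf := ?S')\<rparr>"
      have "scanned (insert x X) ?N"
        unfolding scanned_def using F F2 S S2 xs xs' by (auto intro!: exI[of _ xs])
      moreover have "run mark N (\<lambda>t N'. t \<le> 12 \<and> N' = ?N)"
        using N save sv old by (simp add: mark_def fun_upd_twist)
      ultimately show ?thesis using False sv
        by (elim run_mono) (auto simp: keeps_def)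
    next
      case nP: False
      then have sv: "state_addr (ext D x) = 0" by (simp add: state_addr_def)
      have F: "\<forall>y\<in>insert x X. ext D y \<in> Pref D \<longrightarrow> cells N Flink (sa (ext D y)) = sa y"
        using sc nP by (auto simp: scanned_def)
      have F2: "cells N Flink (sa s) = cells M0 Flink (sa s)" if s: "s \<in> Pref D" "s \<notin> ext D ` insert x X" for s
        using sc s by (auto simp: scanned_def)
      let ?R = "(cells N aRoots)(length xs := nd x)"
      let ?xs = "xs @ [x]"
      have xs': "distinct ?xs" "set ?xs = {x' \<in> insert x X. ext D x' \<notin> Pref D}" using xs(1,2) nP X(2) by auto
      have R: "\<forall>i<length ?xs. ?R i = nd (ext D (?xs ! i))" using xs(4) nx by (auto simp: nth_append less_Suc_eq)
      let ?N = "N\<lparr>regs := (regs N)(rSave := 0, rRoots := length ?xs), cells := (cells N)(aRoots := ?R, StateOf := ?S')\<rparr>"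
      have "scanned (insert x X) ?N"
        unfolding scanned_def using F F2 S S2 xs' R by (auto intro!: exI[of _ ?xs])
      moreover have "run mark N (\<lambda>t N'. t \<le> 12 \<and> N' = ?N)"
        using N save sv old xs(3) by (simp add: mark_def fun_upd_twist)
      ultimately show ?thesis using False sv
        by (elim run_mono) (auto simp: keeps_def)
    qed
  qed
qed

text \<open>\<open>rSave\<close> is overwritten for each prefix that occurs in \<open>D\<close>. If
  \<open>p\<close> itself occurs, the final value is the original entry at its node, which
  \<open>emit_new\<close> puts back.\<close>

lemma run_scan:
  assumes b: "base N0" and st: "states N0"
    and same: "cells N0 StateOf = cells M0 StateOf" "cells N0 Flink = cells M0 Flink"
  shows "run scan N0 (\<lambda>t N. t \<le> 40 * L * length p + 5 \<and>
    keeps {rCur, rChr, rCnt, rNod, rIdx, rRoots, rSave} {aRoots, Flink, StateOf} N0 N \<and> scanned new N \<and>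
    regs N rNod = (if p \<in> Substr D then nd p else 0) \<and>
    (p \<in> Substr D \<longrightarrow> regs N rSave = state_addr (ext D p)))"
proof -
  let ?K = "keeps {rCur, rChr, rCnt, rNod, rIdx, rRoots, rSave} {aRoots, Flink, StateOf} N0"
  let ?X = "\<lambda>j. {x \<in> new. length x \<le> j}"
  define I where "I n t N \<longleftrightarrow> n + regs N rIdx = length p \<and> t \<le> 40 * L * regs N rIdx \<and> ?K N \<and>
     scanned (?X (regs N rIdx)) N \<and>
     regs N rNod = (if take (regs N rIdx) p \<in> Substr D then nd (take (regs N rIdx) p) else 0) \<and>
     (0 < regs N rIdx \<and> take (regs N rIdx) p \<in> Substr D \<longrightarrow> regs N rSave = state_addr (ext D (take (regs N rIdx) p)))" for n t N
  have baseN: "base N" "states N" if "?K N" for N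
    by (rule base_keeps[OF b that]; auto) (rule states_keeps[OF st that]; auto)
  have step: "run (block [
       Assign rCur (Var rNod), Assign rChr (Cell Pat (Var rIdx)), walk_com DawgChild, Assign rNod (Var rCur),
       Assign rIdx (Incr (Var rIdx)), Cond (Equal (Var rNod) (Num 0)) Skip mark]) N (\<lambda>u N'. \<exists>n'<n. I n' (t + u + 1) N')"
    if I: "I n t N" and j: "regs N rIdx < length p" and nod: "regs N rNod \<noteq> 0" for n t N
  proof -
    define j where "j = regs N rIdx"
    have kp: "?K N" and tt: "t \<le> 40 * L * j" and n: "n + j = length p" and sc: "scanned (?X j) N"
      and nd: "regs N rNod = (if take j p \<in> Substr D then nd (take j p) else 0)"
      using I unfolding I_def j_def by blast+
    then obtain k where k: "n = Suc k" using j by (cases n) (auto simp: j_def)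
    note bN = baseN(1)[OF kp] and sN = baseN(2)[OF kp]
    let ?c = "p ! j" and ?x = "take (Suc j) p"
    have tk: "?x = take j p @ [?c]" using j by (simp add: j_def take_Suc_conv_app_nth)
    have c: "?c < \<sigma>" using p_chars nth_mem[OF j] by (auto simp: j_def)
    have sub: "take j p \<in> Substr D" and rn: "regs N rNod = nd (take j p)" using nod nd by (auto split: if_splits)
    let ?N = "N\<lparr>regs := (regs N)(rCur := regs N rNod, rChr := ?c)\<rparr>"
    have bN': "base ?N" by (rule base_keeps[OF bN, of "{rCur, rChr}" "{}"]) (auto simp: keeps_def)
    have W: "regs ?N Width = L" using base_regs(2)[OF bN'] .
    let ?v = "if ?x \<in> Substr D then nd ?x else 0"
    have wk: "walk (\<lambda>b. cells ?N (DawgChild b)) (regs ?N rCur) (code L (regs ?N rChr)) = ?v"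
      using walk_dawg[OF bN' sub c] rn tk by simp
    have Xj: "?X (Suc j) = (if ?x \<in> Substr D \<and> ?x \<notin> Pref D then insert ?x (?X j) else ?X j)"
    proof -
      have "x = ?x" if "x \<in> new" "length x = Suc j" for x
        using newD[OF that(1)] that(2) by (auto simp: prefix_def)
      moreover have "length ?x = Suc j" using j by (simp add: j_def)
      ultimately show ?thesis by (auto simp: le_Suc_eq fresh_def take_is_prefix)
    qed
    have main: "run (block [Assign rNod (Var rCur), Assign rIdx (Incr (Var rIdx)), Cond (Equal (Var rNod) (Num 0)) Skip mark]) N'
        (\<lambda>v N''. I k (t + (2 + u + v) + 1) N'')"
      if u: "u \<le> 6 * L + 3" and k1: "keeps {rCur, rChr, rCnt} {} ?N N'" and cur: "regs N' rCur = ?v" for u :: nat and N'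
    proof -
      let ?N' = "N'\<lparr>regs := (regs N')(rNod := ?v, rIdx := Suc j)\<rparr>"
      have idx: "regs N' rIdx = j" using k1 by (simp add: keeps_def j_def)
      have kp': "?K ?N'" using kp k1 by (auto simp: keeps_def)
      have sc': "scanned (?X j) ?N'" using sc k1 by (simp add: scanned_def keeps_def)
      have sv: "40 * L * Suc j = 40 * L * j + 40 * L" by simp
      have L1: "1 \<le> L" using L_pos by linarith
      show ?thesis
      proof (cases "?x \<in> Substr D")
        case False
        have tb: "t + (2 + u + 5) + 1 \<le> 40 * L * Suc j" using sv u tt L1 by linarith
        have "I k (t + (2 + u + 5) + 1) ?N'"
          unfolding I_def using n k tb kp' sc' Xj False by simp
        then show ?thesis using False cur idx by (simp add: eval_nat_numeral)
      next
        case True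
        have xp: "prefix ?x p" by (simp add: take_is_prefix)
        have lx: "length ?x = Suc j" using j j j_def by simp
        have 1: "?X j \<subseteq> new" "?x \<notin> ?X j" using lx by auto
        have 2: "regs ?N' rNod = nd ?x" "cells ?N' aState (regs ?N' rIdx) = sa ?x" "regs ?N' rOld = F0"
          using True baseN(2)[OF kp'] lx j by (auto simp: states_def j_def)
        have Xj': "(if ?x \<in> Pref D then ?X j else insert ?x (?X j)) = ?X (Suc j)" using Xj True by auto
        have pos: "0 < nd ?x" by (rule nd_pos[OF True])
        have "run mark ?N' (\<lambda>v N''. I k (t + (2 + u + (3 + v)) + 1 + 1) N'')"
          using run_mark[OF True xp 1 sc' 2] unfolding Xj'
        proof (rule run_mono, elim conjE)
          fix v :: nat and N'' assume v: "v \<le> 12" "keeps {rSave, rRoots} {aRoots, Flink, StateOf} ?N' N''"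
            "scanned (?X (Suc j)) N''" "regs N'' rSave = state_addr (ext D ?x)"
          have r: "regs N'' rIdx = Suc j" "regs N'' rNod = nd ?x" using v(2) True by (auto simp: keeps_def)
          have "?K N''" using kp' v(2) by (auto simp: keeps_def)
          moreover have "t + (2 + u + (3 + v)) + 1 + 1 \<le> 40 * L * Suc j" using sv u tt v(1) L1 by linarith
          ultimately show "I k (t + (2 + u + (3 + v)) + 1 + 1) N''"
            unfolding I_def using n k v r True by simp
        qed
        then show ?thesis using True cur idx pos by (simp add: eval_nat_numeral)
      qed
    qed
    have "run (walk_com DawgChild) ?N (\<lambda>u N'. run (block [Assign rNod (Var rCur), Assign rIdx (Incr (Var rIdx)),
        Cond (Equal (Var rNod) (Num 0)) Skip mark]) N' (\<lambda>v N''. I k (t + (2 + u + v) + 1) N''))"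
      using run_walk_com[of DawgChild ?N] unfolding wk W
    proof (rule run_mono, elim conjE)
      fix u N' assume "u \<le> 6 * L + 3" "keeps {rCur, rChr, rCnt} {} ?N N'" "regs N' rCur = ?v"
      then show "run (block [Assign rNod (Var rCur), Assign rIdx (Incr (Var rIdx)),
        Cond (Equal (Var rNod) (Num 0)) Skip mark]) N' (\<lambda>v N''. I k (t + (2 + u + v) + 1) N'')"
        by (rule main)
    qed
    moreover have "cells N Pat (regs N rIdx) = ?c" using base_regs(5)[OF bN j] by (simp add: j_def)
    ultimately show ?thesis using k
      apply (simp only: block.simps run_Seq run_Assign aval.simps)
      apply simp
      apply (erule run_mono)
      subgoal for ta N'
        by (cases "regs N' rCur = 0") (auto elim!: run_mono)
      done
  qed
  have X0: "?X 0 = {}" by (auto simp: fresh_def)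
  have Xp: "?X (length p) = new" using newD prefix_length_le by blast
  show ?thesis unfolding scan_def
    apply (simp only: block.simps run_Seq run_Assign run_Skip)
    apply (rule run_while[where I = I and n = "length p"])
    subgoal unfolding I_def using X0 same StateOf_initial base_regs(4)[OF b]
      by (simp add: scanned_def keeps_def)
    subgoal for n t N
      using step[of n t N] baseN(1) base_regs(1) by (simp add: I_def)
    subgoal for n t N
    proof -
      assume I: "I n t N" "\<not> bval (Conj (Less (Var rIdx) (Var PatLen)) (Neg (Equal (Var rNod) (Num 0)))) N"
      define j where "j = regs N rIdx"
      have kp: "?K N" and tt: "t \<le> 40 * L * j" and n: "n + j = length p" and sc: "scanned (?X j) N"
        and nd: "regs N rNod = (if take j p \<in> Substr D then nd (take j p) else 0)"
        and sv: "0 < j \<and> take j p \<in> Substr D \<longrightarrow> regs N rSave = state_addr (ext D (take j p))"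
        using I(1) unfolding I_def j_def by blast+
      have le: "40 * L * j \<le> 40 * L * length p" using n by simp
      have "j = length p \<or> regs N rNod = 0" using I(2) n base_regs(1)[OF baseN(1)[OF kp]] by (auto simp: j_def)
      then consider "j = length p" | "take j p \<notin> Substr D" using nd nd_pos by (fastforce split: if_splits)
      then show ?thesis
      proof cases
        case 1
        then show ?thesis using kp tt sc nd sv Xp len_p by (auto split: if_splits)
      next
        case 2
        \<comment> \<open>The walk has left the DAWG: all longer prefixes contain
          \<open>take j p\<close> and do not occur in \<open>D\<close> either.\<close>
        have "x \<in> ?X j" if "x \<in> new" for x
        proof (rule ccontr)
          assume "x \<notin> ?X j"
          then have "prefix (take j p) x" using newD[OF that] that
            by (metis (mono_tags, lifting) length_take mem_Collect_eq min.cobounded2 not_le order.strict_implies_order order.trans prefix_length_prefix take_is_prefix)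
          then show False using 2 newD[OF that] Substr_sublist by blast
        qed
        then have X: "?X j = new" by auto
        have "prefix (take j p) p" by (simp add: take_is_prefix)
        then have "p \<notin> Substr D" using 2 Substr_sublist by blast
        moreover have "t \<le> 40 * L * length p" using tt le by linarith
        ultimately show ?thesis using 2 kp sc nd X by auto
      qed
    qed
    done
qed

end

section \<open>Redirecting the failure links of old states\<close>

definition relink_children :: com where
  "relink_children = block [Assign rTop (Num 0), push_children, search True relink]"

definition redirect_below :: com where
  "redirect_below = block [
     Store aStack (Num 0) (Var rLast), Assign rTop (Num 1), search False redirect]"

text \<open>The mark found at a root is the address of the fresh prefix itself, hence the target of
  all links found below it.\<close>

definition relink_all :: com where
  "relink_all = While (Less (Num 0) (Var rRoots)) (block [
     Assign rRoots (Decr (Var rRoots)),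
     Assign rNod (Cell aRoots (Var rRoots)),
     Assign rTo (Cell StateOf (Var rNod)),
     relink_children])"

text \<open>By \<open>dfs_near\<close> at most two nodes are visited per mark met. A visit takes 30
  steps, and 6 more pay for pushing the first children, all of which are visited:
  \<open>72 = 2 * (30 + 6)\<close>.\<close>

lemma run_relink_children:
  assumes "marked_dawg D Mk n (cells N StateOf) (children N)" "z \<in> reps D" "regs N rNod = n z"
  shows "run relink_children N (\<lambda>t N'. t \<le> 10 + 72 * card (reach True (reps D) Mk z \<inter> Mk) \<and>
    keeps {rTop, rNod, rSta, rPtr, rNum} {aStack, Flink} N N' \<and>
    cells N' Flink = (\<lambda>s. if s \<noteq> 0 \<and> s \<in> cells N StateOf ` n ` reach True (reps D) Mk z
      then regs N rTo else cells N Flink s))"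
proof -
  interpret marked_dawg D Mk n "cells N StateOf" "children N" by fact
  obtain zs where zs: "dfs True (cells N StateOf) (children N) (rev (children N (n z))) (map n zs)"
    "set zs = reach True (reps D) Mk z" "length zs \<le> 2 * card (reach True (reps D) Mk z \<inter> Mk)"
    using dfs_near[OF assms(2)] by blast
  have len: "length (children N (n z)) \<le> length zs" using dfs_stack_le[OF zs(1)] by simp
  let ?N = "N\<lparr>regs := (regs N)(rTop := 0)\<rparr>"
  have N: "stack ?N = []" "children ?N = children N" "regs ?N rNod = n z"
    using assms(3) by (simp_all add: stack_def children_def fun_eq_iff)
  have "run push_children ?N (\<lambda>t N'. run (search True relink) N' (\<lambda>u N''. 1 + t + u + 1 \<le> 10 + 72 * card (reach True (reps D) Mk z \<inter> Mk) \<and>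
    keeps {rTop, rNod, rSta, rPtr, rNum} {aStack, Flink} N N'' \<and>
    cells N'' Flink = (\<lambda>s. if s \<noteq> 0 \<and> s \<in> cells N StateOf ` n ` reach True (reps D) Mk z
      then regs N rTo else cells N Flink s)))"
    using run_push_children[of ?N] unfolding N
  proof (rule run_mono, elim conjE)
    fix t N' assume t: "t \<le> 6 * length (children N (n z)) + 4" "keeps {rTop, rPtr, rNum} {aStack} ?N N'"
      "stack N' = rev (children N (n z)) @ []"
    have s: "cells N' StateOf = cells N StateOf" "children N' = children N" "regs N' rTo = regs N rTo" "cells N' Flink = cells N Flink"
      using t(2) by (auto simp: keeps_def children_def fun_eq_iff)
    have d: "dfs True (cells N' StateOf) (children N') (stack N') (map n zs)" using zs(1) s t(3) by simp
    show "run (search True relink) N' (\<lambda>u N''. 1 + t + u + 1 \<le> 10 + 72 * card (reach True (reps D) Mk z \<inter> Mk) \<and>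
      keeps {rTop, rNod, rSta, rPtr, rNum} {aStack, Flink} N N'' \<and>
      cells N'' Flink = (\<lambda>s. if s \<noteq> 0 \<and> s \<in> cells N StateOf ` n ` reach True (reps D) Mk z
        then regs N rTo else cells N Flink s))"
      using run_search_relink[OF d]
    proof (rule run_mono, elim conjE)
      fix u N''
      assume u: "u \<le> 30 * length (map n zs) + 1" "keeps {rTop, rNod, rSta, rPtr, rNum} {aStack, Flink} N' N''"
        "cells N'' Flink = (\<lambda>s. if s \<noteq> 0 \<and> s \<in> cells N' StateOf ` set (map n zs) then regs N' rTo else cells N' Flink s)"
      have "1 + t + u + 1 \<le> 10 + 72 * card (reach True (reps D) Mk z \<inter> Mk)"
        using t(1) u(1) len zs(3) by simp
      moreover have "keeps {rTop, rNod, rSta, rPtr, rNum} {aStack, Flink} N N''"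
        using t(2) u(2) by (auto simp: keeps_def)
      ultimately show "1 + t + u + 1 \<le> 10 + 72 * card (reach True (reps D) Mk z \<inter> Mk) \<and>
        keeps {rTop, rNod, rSta, rPtr, rNum} {aStack, Flink} N N'' \<and>
        cells N'' Flink = (\<lambda>s. if s \<noteq> 0 \<and> s \<in> cells N StateOf ` n ` reach True (reps D) Mk z
          then regs N rTo else cells N Flink s)"
        using u(3) zs(2) s by (simp cong: if_cong)
    qed
  qed
  then show ?thesis unfolding relink_children_def
    by (simp only: block.simps run_Seq run_Assign run_Skip aval.simps add.assoc)
qed

lemma run_redirect_below:
  assumes "marked_dawg D Mk n (cells N StateOf) (children N)" "z \<in> reps D" "regs N rLast = n z"
  shows "run redirect_below N (\<lambda>t N'. t \<le> 10 + 60 * card ({y. suffix z y} \<inter> Mk) \<and>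
    keeps {rTop, rNod, rSta, rPtr, rNum} {aStack, OutHead, OutNext} N N' \<and>
    (\<forall>a\<in>{OutHead, OutNext}. cells N' a = (\<lambda>s. if s \<noteq> 0 \<and> s \<in> cells N StateOf ` n ` {y \<in> reps D. suffix z y} \<and>
        cells N a s = regs N rFrom then regs N rTo else cells N a s)))"
proof -
  interpret marked_dawg D Mk n "cells N StateOf" "children N" by fact
  obtain zs where zs: "dfs False (cells N StateOf) (children N) [n z] (map n zs)"
    "set zs = {y \<in> reps D. suffix z y}" "length zs \<le> 2 * card ({y. suffix z y} \<inter> Mk)"
    using dfs_below[OF assms(2)] by blast
  let ?N = "N\<lparr>cells := (cells N)(aStack := (cells N aStack)(0 := n z)), regs := (regs N)(rTop := 1)\<rparr>"
  have N: "stack ?N = [n z]" "children ?N = children N" "cells ?N StateOf = cells N StateOf"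
    by (simp_all add: stack_def children_def fun_eq_iff)
  then have d: "dfs False (cells ?N StateOf) (children ?N) (stack ?N) (map n zs)" using zs(1) by simp
  let ?Q = "\<lambda>t N'. t \<le> 10 + 60 * card ({y. suffix z y} \<inter> Mk) \<and>
    keeps {rTop, rNod, rSta, rPtr, rNum} {aStack, OutHead, OutNext} N N' \<and>
    (\<forall>a\<in>{OutHead, OutNext}. cells N' a = (\<lambda>s. if s \<noteq> 0 \<and> s \<in> cells N StateOf ` n ` {y \<in> reps D. suffix z y} \<and>
        cells N a s = regs N rFrom then regs N rTo else cells N a s))"
  have "run (search False redirect) ?N (\<lambda>t. ?Q (1 + (1 + (t + 1))))"
    using run_search_redirect[OF d]
  proof (rule run_mono, elim conjE)
    fix t N'
    assume t: "t \<le> 30 * length (map n zs) + 1"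
      "keeps {rTop, rNod, rSta, rPtr, rNum} {aStack, OutHead, OutNext} ?N N'"
      "\<forall>a\<in>{OutHead, OutNext}. cells N' a = (\<lambda>s. if s \<noteq> 0 \<and> s \<in> cells ?N StateOf ` set (map n zs) \<and>
        cells ?N a s = regs ?N rFrom then regs ?N rTo else cells ?N a s)"
    have "1 + (1 + (t + 1)) \<le> 10 + 60 * card ({y. suffix z y} \<inter> Mk)" using t(1) zs(3) by simp
    moreover have "keeps {rTop, rNod, rSta, rPtr, rNum} {aStack, OutHead, OutNext} N N'"
      using t(2) by (auto simp: keeps_def)
    ultimately show "?Q (1 + (1 + (t + 1))) N'" using t(3) zs(2) by (simp cong: if_cong)
  qed
  then show ?thesis unfolding redirect_below_def
    by (simp only: block.simps run_Seq run_Assign run_Store run_Skip aval.simps assms(3)) simp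
qed

context insertion
begin

lemma flink_M0: "s \<in> Pref D \<Longrightarrow> s \<noteq> [] \<Longrightarrow> cells M0 Flink (sa s) = sa (flink D s)"
  using ac sa_old flink_longest longest(1)[OF Nil_in_Pref] unfolding represents_ac_def by auto

text \<open>In the invariant a state has its new link if it sits at the node of a fresh prefix,
  where \<open>mark\<close> has set it, or if it lies in the region of a root already treated, and
  otherwise its original link. At the end \<open>flink_insert_changed\<close> shows that the states
  of the second kind have the right link as well.\<close>

lemma run_relink_all:
  assumes b: "base N0" and sc: "scanned new N0"
  shows "run relink_all N0 (\<lambda>t N. t \<le> 172 * length p + 72 * u_f D D' + 1 \<and>
    keeps {rRoots, rTo, rTop, rNod, rSta, rPtr, rNum} {aStack, Flink} N0 N \<and>
    (\<forall>s\<in>Pref D. s \<noteq> [] \<longrightarrow> cells N Flink (sa s) = sa (flink D' s)))"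
proof -
  note pne = p_ne
  obtain xs where xs: "distinct xs" "set xs = {x \<in> new. ext D x \<notin> Pref D}" "regs N0 rRoots = length xs"
    "\<forall>i<length xs. cells N0 aRoots i = nd (ext D (xs ! i))" using sc unfolding scanned_def by blast
  let ?K = "keeps {rRoots, rTo, rTop, rNod, rSta, rPtr, rNum} {aStack, Flink} N0"
  \<comment> \<open>The budget of a root: 100 covers the fixed cost, and \<open>near_sum\<close>
    bounds the total of the cardinalities. There are at most \<open>length p\<close> roots, which
    gives \<open>172 = 100 + 72\<close>.\<close>
  let ?w = "\<lambda>x. 100 + 72 * card (near x \<inter> marked D p)"
  let ?done = "\<lambda>k s. s \<in> ext D ` new \<or> (\<exists>x\<in>set (drop k xs). s \<in> near x)"
  define I where "I k t N \<longleftrightarrow> k = regs N rRoots \<and> k \<le> length xs \<and> ?K N \<and>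
    t + sum_list (map ?w (take k xs)) \<le> sum_list (map ?w xs) \<and>
    (\<forall>s\<in>Pref D. s \<noteq> [] \<longrightarrow> cells N Flink (sa s) = sa (if ?done k s then flink D' s else flink D s))" for k t N
  have st: "cells N0 StateOf (nd z) = (if z \<in> ext D ` new then sa (inv_into new (ext D) z) else state_addr z)"
    if "z \<in> reps D" for z
    using sc that ext_fresh_inj[OF fin, of p] by (auto simp: scanned_def)
  have inv: "inv_into new (ext D) z \<in> new" if "z \<in> ext D ` new" for z using that by (rule inv_into_into)
  have md: "marked_dawg D (marked D p) nd (cells N StateOf) (children N)" if "?K N" for N
  proof (rule marked_dawgI)
    show "Pref D \<subseteq> marked D p" "marked D p \<subseteq> reps D" using marked_reps[OF fin p_ne D'] by blast+
    show "base N" by (rule base_keeps[OF b that]) auto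
    fix z assume z: "z \<in> reps D"
    have "cells N StateOf = cells N0 StateOf" using that by (simp add: keeps_def)
    then show "cells N StateOf (nd z) \<noteq> 0 \<longleftrightarrow> z \<in> marked D p"
      using st[OF z] inv newD sa_pos[OF Pref_mono, of z] by (auto simp: marked_def state_addr_def)
  qed
  \<comment> \<open>At the node of a fresh prefix the search finds the address of a new state. It
    may thus write the link of a new state, which \<open>failures\<close> sets afterwards, but it
    leaves the hidden old state alone.\<close>
  have old_state: "sa s \<in> cells N0 StateOf ` nd ` near x \<longleftrightarrow> s \<in> near x \<and> s \<notin> ext D ` new"
    if s: "s \<in> Pref D" for s x
  proof
    assume "sa s \<in> cells N0 StateOf ` nd ` near x"
    then obtain z where z: "z \<in> near x" "sa s = cells N0 StateOf (nd z)" by auto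
    then have zr: "z \<in> reps D" by (simp add: reach_def)
    have "0 < sa s" using sa_pos Pref_mono s by blast
    have "z \<notin> ext D ` new"
    proof
      assume "z \<in> ext D ` new"
      then have "sa s = sa (inv_into new (ext D) z)" "inv_into new (ext D) z \<in> new" using st[OF zr] z(2) inv by auto
      then show False using sa_eq[of s] newD[of "inv_into new (ext D) z"] Pref_mono[OF s] s by auto
    qed
    then have "z \<in> Pref D" "sa s = sa z" using st[OF zr] z(2) \<open>0 < sa s\<close> by (auto simp: state_addr_def split: if_splits)
    then have "s = z" using sa_eq Pref_mono s by blast
    then show "s \<in> near x \<and> s \<notin> ext D ` new" using z \<open>z \<notin> ext D ` new\<close> by simp
  next
    assume "s \<in> near x \<and> s \<notin> ext D ` new"
    then show "sa s \<in> cells N0 StateOf ` nd ` near x" using st[OF Pref_reps[OF s]] s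
      by (auto simp: state_addr_def image_iff intro!: bexI[of _ s])
  qed
  have step: "run (block [Assign rRoots (Decr (Var rRoots)), Assign rNod (Cell aRoots (Var rRoots)),
     Assign rTo (Cell StateOf (Var rNod)), relink_children]) N (\<lambda>u N'. \<exists>k'<k. I k' (t + u + 1) N')"
    if I: "I k t N" and pos: "0 < regs N rRoots" for k t N
  proof -
    from I pos obtain j where j: "k = Suc j" "regs N rRoots = Suc j" unfolding I_def by (metis Suc_pred)
    have kp: "?K N" and jl: "j < length xs" and tt: "t + sum_list (map ?w (take k xs)) \<le> sum_list (map ?w xs)"
      and fl: "\<And>s. s \<in> Pref D \<Longrightarrow> s \<noteq> [] \<Longrightarrow> cells N Flink (sa s) = sa (if ?done k s then flink D' s else flink D s)"
      using I j unfolding I_def by auto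
    let ?x = "xs ! j"
    have x: "?x \<in> new" "ext D ?x \<notin> Pref D" using xs(2) nth_mem[OF jl] by auto
    note nx = newD[OF x(1)]
    have cN: "cells N aRoots j = nd (ext D ?x)" "cells N StateOf = cells N0 StateOf"
      using kp xs(4) jl by (auto simp: keeps_def)
    have to: "cells N StateOf (nd (ext D ?x)) = sa ?x" using sc x cN(2) by (simp add: scanned_def)
    let ?N = "N\<lparr>regs := (regs N)(rRoots := j, rNod := nd (ext D ?x), rTo := sa ?x)\<rparr>"
    have kp': "?K ?N" using kp by (auto simp: keeps_def)
    have r: "ext D ?x \<in> reps D" "regs ?N rNod = nd (ext D ?x)" using nx by auto
    have "run relink_children ?N (\<lambda>u N'. I j (t + (3 + u + 1) + 1) N')"
      using run_relink_children[OF md[OF kp'] r]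
    proof (rule run_mono, elim conjE)
      fix u :: nat and N'
      assume u: "u \<le> 10 + 72 * card (near ?x \<inter> marked D p)"
        "keeps {rTop, rNod, rSta, rPtr, rNum} {aStack, Flink} ?N N'"
        and F: "cells N' Flink = (\<lambda>s. if s \<noteq> 0 \<and> s \<in> cells ?N StateOf ` nd ` near ?x then regs ?N rTo else cells ?N Flink s)"
      have tk: "take k xs = take j xs @ [?x]" using j jl by (simp add: take_Suc_conv_app_nth)
      have dk: "drop j xs = ?x # drop k xs" using j jl by (simp add: Cons_nth_drop_Suc)
      have "t + (3 + u + 1) + 1 + sum_list (map ?w (take j xs)) \<le> sum_list (map ?w xs)"
        using tt u(1) unfolding tk by simp
      moreover have "?K N'" using kp u(2) by (auto simp: keeps_def)
      moreover have "cells N' Flink (sa s) = sa (if ?done j s then flink D' s else flink D s)"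
        if s: "s \<in> Pref D" "s \<noteq> []" for s
      proof (cases "s \<in> near ?x \<and> s \<notin> ext D ` new")
        case True
        then have "flink D' s = ?x"
          using flink_fresh_near[OF fin pne D' x s(1)] by blast
        moreover have "cells N' Flink (sa s) = sa ?x"
          using F True old_state[OF s(1)] cN(2) sa_pos[OF Pref_mono[OF s(1)]] by simp
        ultimately show ?thesis using True dk by auto
      next
        case False
        then have "cells N' Flink (sa s) = cells N Flink (sa s)" using F old_state[OF s(1)] cN(2) by auto
        moreover have "?done j s \<longleftrightarrow> ?done k s" using False dk by auto
        ultimately show ?thesis using fl[OF s] by presburger
      qed
      moreover have "regs N' rRoots = j" using u(2) by (simp add: keeps_def)
      ultimately show "I j (t + (3 + u + 1) + 1) N'" unfolding I_def using jl by auto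
    qed
    then show ?thesis using j cN to
      by (simp add: eval_nat_numeral) (erule run_mono, auto)
  qed
  show ?thesis unfolding relink_all_def
  proof (rule run_while[where I = I and n = "length xs"])
    have "cells N0 Flink (sa s) = sa (if s \<in> ext D ` new then flink D' s else flink D s)"
      if s: "s \<in> Pref D" "s \<noteq> []" for s
    proof (cases "s \<in> ext D ` new")
      case True
      then obtain x where x: "x \<in> new" "s = ext D x" by auto
      then have "flink D' s = x" using flink_fresh_ext[OF fin pne D' x(1)] s by simp
      then show ?thesis using sc x s True by (simp add: scanned_def)
    next
      case False
      then show ?thesis using sc s flink_M0 by (simp add: scanned_def)
    qed
    then show "I (length xs) 0 N0" unfolding I_def using xs(3) by simp
  next
    fix k t N assume "I k t N" "bval (Less (Num 0) (Var rRoots)) N"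
    then show "run (block [Assign rRoots (Decr (Var rRoots)), Assign rNod (Cell aRoots (Var rRoots)),
       Assign rTo (Cell StateOf (Var rNod)), relink_children]) N (\<lambda>u N'. \<exists>k'<k. I k' (t + u + 1) N')"
      using step by simp
  next
    fix k t N assume I: "I k t N" "\<not> bval (Less (Num 0) (Var rRoots)) N"
    then have k: "k = 0" by (simp add: I_def)
    have t: "t \<le> sum_list (map ?w xs)" and kp: "?K N"
      and fl: "\<And>s. s \<in> Pref D \<Longrightarrow> s \<noteq> [] \<Longrightarrow> cells N Flink (sa s) = sa (if ?done 0 s then flink D' s else flink D s)"
      using I(1) k unfolding I_def by auto
    have "sum_list (map ?w xs) = (\<Sum>x\<in>set xs. ?w x)" using xs(1) by (simp add: sum_list_distinct_conv_sum_set)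
    also have "\<dots> = 100 * card (set xs) + 72 * (\<Sum>x\<in>set xs. card (near x \<inter> marked D p))"
      by (simp add: sum.distrib sum_distrib_left)
    also have "(\<Sum>x\<in>set xs. card (near x \<inter> marked D p)) \<le> u_f D D' + length p"
      unfolding xs(2) by (rule near_sum[OF fin pne D'])
    also have "card (set xs) \<le> card new" unfolding xs(2) by (rule card_mono[OF finite_fresh]) auto
    finally have "t + 1 \<le> 172 * length p + 72 * u_f D D' + 1" using t card_fresh[of D p] by simp
    moreover have "cells N Flink (sa s) = sa (flink D' s)" if s: "s \<in> Pref D" "s \<noteq> []" for s
    proof (cases "flink D' s = flink D s")
      case True
      then show ?thesis using fl[OF s] by simp
    next
      case False
      then obtain x where "x \<in> new" "s = ext D x \<or> (s \<notin> ext D ` new \<and> ext D x \<notin> Pref D \<and> s \<in> near x)"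
        using flink_insert_changed[OF fin pne D' s] by blast
      then have "?done 0 s" using xs(2) by auto
      then show ?thesis using fl[OF s] by simp
    qed
    ultimately show "t + 1 \<le> 172 * length p + 72 * u_f D D' + 1 \<and>
      ?K N \<and> (\<forall>s\<in>Pref D. s \<noteq> [] \<longrightarrow> cells N Flink (sa s) = sa (flink D' s))"
      using kp by blast
  qed
qed

end

section \<open>Failure links of the new states\<close>

lemma flink_props:
  assumes "s \<noteq> []"
  shows "flink D s \<in> Pref D" "suffix (flink D s) (tl s)" "length (flink D s) < length s"
    "\<And>t. t \<in> Pref D \<Longrightarrow> suffix t (tl s) \<Longrightarrow> suffix t (flink D s)"
proof -
  note l = longest[of "Pref D", OF Nil_in_Pref, where s = "tl s"]
  show "flink D s \<in> Pref D" "suffix (flink D s) (tl s)"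
    "\<And>t. t \<in> Pref D \<Longrightarrow> suffix t (tl s) \<Longrightarrow> suffix t (flink D s)"
    using l assms by (auto simp: flink_longest)
  then show "length (flink D s) < length s"
    using assms suffix_length_less suffix_tl_iff by blast
qed

text \<open>The potential of the amortized analysis: one more character lengthens the failure link
  by at most one.\<close>

lemma flink_snoc_length: "x \<noteq> [] \<Longrightarrow> length (flink D (x @ [c])) \<le> Suc (length (flink D x))"
proof -
  assume x: "x \<noteq> []"
  note f = flink_props[where s = "x @ [c]" and D = D]
  have s: "suffix (flink D (x @ [c])) (tl x @ [c])" using f(2) x by simp
  show ?thesis
  proof (cases "flink D (x @ [c])" rule: rev_cases)
    case (snoc u d)
    then have "suffix u (tl x)" "u \<in> Pref D" using s f(1) Pref_prefix[of _ D u] by auto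
    then have "suffix u (flink D x)" using flink_props(4)[OF x] by blast
    then show ?thesis using snoc by (auto dest: suffix_length_le)
  qed simp
qed

lemma flink_single: "flink D [c] = []"
  using flink_props(3)[of "[c]" D] by simp

text \<open>As \<open>x\<close> is no pattern, its longest output is a proper suffix and a state,
  hence a suffix of the failure link. Links refer to the larger dictionary \<open>E\<close> and
  outputs still to \<open>D\<close>, since \<open>p\<close> enters the output lists only after all
  links are final.\<close>

lemma top_out_flink:
  assumes "x \<notin> D" "x \<noteq> []" "D \<subseteq> E"
  shows "top_out D x = top_out D (flink E x)"
proof -
  have N: "[] \<in> insert [] D" by simp
  note l = longest[OF N, where s = x]
  have "top_out D x \<in> Pref E" using l(1) assms(3) by (auto simp: Pref_def)
  moreover have "suffix (top_out D x) (tl x)"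
    using l assms by (auto simp: suffix_tl_iff strict_suffix_iff)
  ultimately have "suffix (top_out D x) (flink E x)" using flink_props(4)[OF assms(2)] by blast
  moreover have "suffix (flink E x) x" using flink_props(2)[OF assms(2)] suffix_order.trans suffix_tl by blast
  ultimately show ?thesis using longest_trans[OF N] by metis
qed

definition try_goto :: com where
  "try_goto = block [
     Assign rCur (Var rFail), Assign rChr (Cell Pat (Decr (Var rIdx))), walk_com AcChild]"

definition find_link :: com where
  "find_link = block [
     try_goto,
     While (Conj (Equal (Var rCur) (Num 0)) (Neg (Equal (Var rFail) (Var AcRoot))))
       (block [Assign rFail (Cell Flink (Var rFail)), try_goto]),
     Cond (Equal (Var rCur) (Num 0)) (Assign rCur (Var AcRoot)) Skip]"

text \<open>A prefix of length 1 is treated separately: its parent is the root, which has no failure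
  link to start from.\<close>

definition link_new :: com where
  "link_new = block [
     Cond (Equal (Var rIdx) (Num 1)) (Assign rCur (Var AcRoot))
       (block [Assign rFail (Cell Flink (Cell aState (Decr (Var rIdx)))), find_link]),
     Store Flink (Cell aState (Var rIdx)) (Var rCur),
     Store OutHead (Cell aState (Var rIdx)) (Cell OutHead (Var rCur))]"

definition failures :: com where
  "failures = block [
     Assign rIdx (Num 0),
     While (Less (Var rIdx) (Var PatLen)) (block [
       Assign rIdx (Incr (Var rIdx)),
       Cond (Less (Cell aState (Var rIdx)) (Var rOld)) Skip link_new])]"

context insertion
begin

definition goto_ok :: "memory \<Rightarrow> bool" where
  "goto_ok N \<longleftrightarrow> (\<forall>f\<in>Pref D'. \<forall>c<\<sigma>. walk (ac_children N) (sa f) (code L c) =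
     (if f @ [c] \<in> Pref D' then sa (f @ [c]) else 0))"

lemma goto_ok_keeps: "goto_ok N \<Longrightarrow> keeps R A N N' \<Longrightarrow> AcChild False \<notin> A \<Longrightarrow> AcChild True \<notin> A \<Longrightarrow> goto_ok N'"
proof -
  assume a: "goto_ok N" "keeps R A N N'" "AcChild False \<notin> A" "AcChild True \<notin> A"
  have "cells N' (AcChild b) = cells N (AcChild b)" for b using a(2-4) by (cases b) (auto simp: keeps_def)
  then show ?thesis using a(1) by (simp add: goto_ok_def)
qed

definition out :: "str \<Rightarrow> nat" where
  "out q = (if q = [] then 0 else sa q)"

lemma out_eq: "q \<in> Pref D' \<Longrightarrow> r \<in> Pref D' \<Longrightarrow> out q = out r \<longleftrightarrow> q = r"
  using sa_eq sa_pos by (auto simp: out_def)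

lemma top_out_Pref: "top_out D s \<in> Pref D" "top_out D s \<in> Pref D'"
proof -
  show "top_out D s \<in> Pref D" using longest(1)[of "insert [] D" s] by (auto simp: Pref_def)
  then show "top_out D s \<in> Pref D'" by (rule Pref_mono)
qed

lemma sa_Nil: "base N \<Longrightarrow> regs N AcRoot = sa []"
  using base_regs(3) sa_old[of "[]"] by simp

lemma run_try_goto:
  assumes b: "base N" and g: "goto_ok N" and f: "f \<in> Pref D'" "regs N rFail = sa f"
    and j: "regs N rIdx = Suc j" "j < length p"
  shows "run try_goto N (\<lambda>t N'. t \<le> 6 * L + 6 \<and> keeps {rCur, rChr, rCnt} {} N N' \<and>
    regs N' rCur = (if f @ [p ! j] \<in> Pref D' then sa (f @ [p ! j]) else 0))"
proof -
  let ?N = "N\<lparr>regs := (regs N)(rCur := sa f, rChr := p ! j)\<rparr>"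
  have bN: "base ?N" by (rule base_keeps[OF b, of "{rCur, rChr}" "{}"]) (auto simp: keeps_def)
  have W: "regs ?N Width = L" using base_regs(2)[OF bN] .
  have c: "p ! j < \<sigma>" using p_chars nth_mem[OF j(2)] by auto
  have wk: "walk (ac_children ?N) (regs ?N rCur) (code L (regs ?N rChr)) = (if f @ [p ! j] \<in> Pref D' then sa (f @ [p ! j]) else 0)"
    using g f(1) c by (simp add: goto_ok_def)
  have pc: "cells N Pat j = p ! j" using base_regs(5)[OF b j(2)] .
  have "run (walk_com AcChild) ?N (\<lambda>t N'. 1 + (1 + (t + 1)) \<le> 6 * L + 6 \<and> keeps {rCur, rChr, rCnt} {} N N' \<and>
    regs N' rCur = (if f @ [p ! j] \<in> Pref D' then sa (f @ [p ! j]) else 0))"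
    using run_walk_com[of AcChild ?N] unfolding W wk
    by (rule run_mono) (auto simp: keeps_def)
  then show ?thesis unfolding try_goto_def using f(2) j pc by simp
qed

text \<open>Each failed attempt shortens the candidate by at least one, which pays for the next one:
  \<open>6 * L + 12\<close> covers one attempt with its loop overhead. The links that are followed
  start at states shorter than \<open>j\<close>, whose links are already final.\<close>

lemma run_find_link:
  assumes b: "base N0" and g: "goto_ok N0" and j: "regs N0 rIdx = Suc j" "0 < j" "j < length p"
    and f0: "regs N0 rFail = sa (flink D' (take j p))"
    and fl: "\<And>s. s \<in> Pref D' \<Longrightarrow> s \<noteq> [] \<Longrightarrow> length s < j \<Longrightarrow> cells N0 Flink (sa s) = sa (flink D' s)"
  shows "run find_link N0 (\<lambda>t N. keeps {rCur, rChr, rCnt, rFail} {} N0 N \<and>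
    regs N rCur = sa (flink D' (take (Suc j) p)) \<and>
    t + (6 * L + 12) * length (flink D' (take (Suc j) p)) \<le> (6 * L + 12) * (length (flink D' (take j p)) + 2))"
proof -
  let ?x = "take j p" and ?c = "p ! j" and ?G = "6 * L + 12"
  let ?K = "keeps {rCur, rChr, rCnt, rFail} {} N0"
  let ?g = "\<lambda>f. if f @ [?c] \<in> Pref D' then sa (f @ [?c]) else 0"
  have x: "?x \<noteq> []" using j p_ne by auto
  have tk: "take (Suc j) p = ?x @ [?c]" using j by (simp add: take_Suc_conv_app_nth)
  note fx = flink_props[OF x, where D = D']
  \<comment> \<open>Every suffix of \<open>tl ?x\<close> with a transition by \<open>?c\<close> is
    still a suffix of \<open>f\<close>; so passing on to the failure link of \<open>f\<close> skips
    no candidate.\<close>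
  define best where "best f \<longleftrightarrow> f \<in> Pref D' \<and> suffix f (tl ?x) \<and>
     (\<forall>t\<in>Pref D'. suffix t (tl ?x) \<longrightarrow> t @ [?c] \<in> Pref D' \<longrightarrow> suffix t f)" for f
  define I where "I n t N \<longleftrightarrow> (\<exists>f. n = length f \<and> best f \<and> regs N rFail = sa f \<and> regs N rCur = ?g f \<and>
     ?K N \<and> t + ?G * length f \<le> ?G * length (flink D' ?x))" for n t N
  have b0: "best (flink D' ?x)" using fx by (auto simp: best_def)
  have pres: "base N" "goto_ok N" "regs N rIdx = Suc j" "cells N Flink = cells N0 Flink" if "?K N" for N
    using base_keeps[OF b that] goto_ok_keeps[OF g that] that j by (auto simp: keeps_def)
  have loop: "run (While (Conj (Equal (Var rCur) (Num 0)) (Neg (Equal (Var rFail) (Var AcRoot))))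
       (block [Assign rFail (Cell Flink (Var rFail)), try_goto])) N
     (\<lambda>t N'. \<exists>f. best f \<and> regs N' rCur = ?g f \<and> (f @ [?c] \<in> Pref D' \<or> f = []) \<and> ?K N' \<and>
        t + ?G * length f \<le> ?G * length (flink D' ?x) + 1)"
    if N: "?K N" "regs N rFail = sa (flink D' ?x)" "regs N rCur = ?g (flink D' ?x)" for N
  proof (rule run_while[where I = I and n = "length (flink D' ?x)"])
    show "I (length (flink D' ?x)) 0 N" unfolding I_def using N b0 by auto
  next
    fix n t N assume I: "I n t N"
      and bv: "bval (Conj (Equal (Var rCur) (Num 0)) (Neg (Equal (Var rFail) (Var AcRoot)))) N"
    from I obtain f where f: "n = length f" "best f" "regs N rFail = sa f" "regs N rCur = ?g f"
      "?K N" "t + ?G * length f \<le> ?G * length (flink D' ?x)" unfolding I_def by blast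
    note pN = pres[OF f(5)]
    have fP: "f \<in> Pref D'" using f(2) by (simp add: best_def)
    have no: "f @ [?c] \<notin> Pref D'" using bv f(4) sa_pos[of "f @ [?c]"] by (auto split: if_splits)
    have ne: "f \<noteq> []" using bv f(3) sa_Nil[OF pN(1)] by auto
    let ?f = "flink D' f"
    note ff = flink_props[OF ne, where D = D']
    have fs: "suffix f (tl ?x)" using f(2) by (simp add: best_def)
    have "length f \<le> length (tl ?x)" by (rule suffix_length_le[OF fs])
    then have "length f < j" using j by simp
    then have fl': "cells N Flink (sa f) = sa ?f" using fl[OF fP ne] pN(4) by simp
    have "best ?f" unfolding best_def
    proof (intro conjI ballI impI)
      show "?f \<in> Pref D'" by (rule ff)
      show "suffix ?f (tl ?x)" using ff(2) fs suffix_tl suffix_order.trans by blast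
      fix t assume t: "t \<in> Pref D'" "suffix t (tl ?x)" "t @ [?c] \<in> Pref D'"
      then have "suffix t f" "t \<noteq> f" using f(2) no by (auto simp: best_def)
      then show "suffix t ?f" using ff(4)[OF t(1)] by (simp add: suffix_tl_iff[OF ne] strict_suffix_iff)
    qed
    let ?N = "N\<lparr>regs := (regs N)(rFail := sa ?f)\<rparr>"
    have kN: "?K ?N" using f(5) by (auto simp: keeps_def)
    have "run try_goto ?N (\<lambda>u N'. I (length ?f) (t + (1 + (u + 1)) + 1) N')"
      using run_try_goto[OF pres(1,2)[OF kN] ff(1) _ pres(3)[OF kN] j(3)]
    proof (rule run_mono, simp, elim conjE)
      fix u N' assume u: "u \<le> 6 * L + 6" "keeps {rCur, rChr, rCnt} {} ?N N'" "regs N' rCur = ?g ?f"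
      have k: "?K N'" "regs N' rFail = sa ?f" using kN u(2) by (auto simp: keeps_def)
      have "?G * length ?f + ?G \<le> ?G * length f" using mult_le_mono2[of "Suc (length ?f)" "length f" ?G] ff(3) by simp
      then have "t + (1 + (u + 1)) + 1 + ?G * length ?f \<le> ?G * length (flink D' ?x)" using f(6) u(1) by linarith
      then show "I (length ?f) (t + (1 + (u + 1)) + 1) N'" unfolding I_def using \<open>best ?f\<close> k u(3) by blast
    qed
    then show "run (block [Assign rFail (Cell Flink (Var rFail)), try_goto]) N (\<lambda>u N'. \<exists>n'<n. I n' (t + u + 1) N')"
      using ff(3) f(1,3) fl' by simp (erule run_mono, auto)
  next
    fix n t N assume I: "I n t N"
      and bv: "\<not> bval (Conj (Equal (Var rCur) (Num 0)) (Neg (Equal (Var rFail) (Var AcRoot)))) N"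
    from I obtain f where f: "best f" "regs N rFail = sa f" "regs N rCur = ?g f"
      "?K N" "t + ?G * length f \<le> ?G * length (flink D' ?x)" unfolding I_def by blast
    have "f @ [?c] \<in> Pref D' \<or> f = []"
      using bv f(2,3) sa_Nil[OF pres(1)[OF f(4)]] sa_eq[of f "[]"] f(1) by (auto simp: best_def split: if_splits)
    then show "\<exists>f. best f \<and> regs N rCur = ?g f \<and> (f @ [?c] \<in> Pref D' \<or> f = []) \<and> ?K N \<and>
        t + 1 + ?G * length f \<le> ?G * length (flink D' ?x) + 1" using f by auto
  qed
  have fin': "sa (flink D' (?x @ [?c])) = (if ?g f = 0 then sa [] else ?g f)"
    "length (flink D' (?x @ [?c])) \<le> Suc (length f)"
    if f: "best f" "f @ [?c] \<in> Pref D' \<or> f = []" for f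
  proof -
    have "flink D' (?x @ [?c]) = (if f @ [?c] \<in> Pref D' then f @ [?c] else [])"
    proof (cases "f @ [?c] \<in> Pref D'")
      case True
      then show ?thesis using flink_snoc[OF x, of f D' ?c] f(1) by (simp add: best_def)
    next
      case False
      then have "f = []" using f by simp
      then have "t = []" if "t \<in> Pref D'" "suffix t (tl ?x)" "t @ [?c] \<in> Pref D'" for t
        using f(1) that by (auto simp: best_def)
      then have "t @ [?c] \<notin> Pref D'" if "t \<in> Pref D'" "suffix t (tl ?x)" for t
        using that False \<open>f = []\<close> by blast
      then show ?thesis using flink_snoc_Nil[OF x, of D' ?c] False by simp
    qed
    then show "sa (flink D' (?x @ [?c])) = (if ?g f = 0 then sa [] else ?g f)"
      "length (flink D' (?x @ [?c])) \<le> Suc (length f)"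
      using sa_pos[of "f @ [?c]"] by auto
  qed
  let ?d = "length (flink D' ?x)" and ?d' = "length (flink D' (take (Suc j) p))"
  let ?Q = "\<lambda>t N. ?K N \<and> regs N rCur = sa (flink D' (take (Suc j) p)) \<and> t + ?G * ?d' \<le> ?G * (?d + 2)"
  show ?thesis unfolding find_link_def
    apply (simp only: block.simps run_Seq)
    apply (rule run_mono[OF run_try_goto[OF b g fx(1) f0 j(1,3)]])
    apply (elim conjE)
    subgoal for t N
      apply (rule run_mono[OF loop[unfolded block.simps]])
      subgoal by (auto simp: keeps_def)
      subgoal using f0 by (auto simp: keeps_def)
      subgoal .
      subgoal for u N'
      proof (elim exE conjE)
        fix f assume t: "t \<le> 6 * L + 6" and f: "best f" "regs N' rCur = ?g f" "f @ [?c] \<in> Pref D' \<or> f = []" "?K N'"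
          "u + ?G * length f \<le> ?G * ?d + 1"
        have "?G * ?d' \<le> ?G * length f + ?G" using mult_le_mono2[OF fin'(2)[OF f(1,3)], of ?G] unfolding tk by simp
        then have tm: "t + (u + 3) + ?G * ?d' \<le> ?G * (?d + 2)" using t f(5) by (simp add: add_mult_distrib2)
        have cur: "sa (flink D' (take (Suc j) p)) = (if regs N' rCur = 0 then regs N' AcRoot else regs N' rCur)"
          using fin'(1)[OF f(1,3)] f(2) sa_Nil[OF pres(1)[OF f(4)]] tk by simp
        have kk: "?K (N'\<lparr>regs := (regs N')(rCur := regs N' AcRoot)\<rparr>)" using f(4) by (auto simp: keeps_def)
        show "run (Cond (Equal (Var rCur) (Num 0)) (Assign rCur (Var AcRoot)) Skip) N'
          (\<lambda>ta M'. run Skip M' (\<lambda>ua. ?Q (t + (u + (ta + ua)))))"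
          using tm cur kk f(4) by (cases "regs N' rCur = 0") (auto simp: eval_nat_numeral)
      qed
      done
    done
qed

text \<open>The states whose link and list head agree with the specification once the prefixes up to
  length \<open>j\<close> are treated; old states belong to it from the start.\<close>

definition covered :: "nat \<Rightarrow> str set" where
  "covered j = Pref D \<union> {take i p | i. i \<le> j}"

definition linked :: "nat \<Rightarrow> memory \<Rightarrow> bool" where
  "linked j N \<longleftrightarrow> (\<forall>s\<in>covered j. (s \<noteq> [] \<longrightarrow> cells N Flink (sa s) = sa (flink D' s)) \<and>
     cells N OutHead (sa s) = out (top_out D s))"

lemma covered_short: "s \<in> Pref D' \<Longrightarrow> length s \<le> j \<Longrightarrow> s \<in> covered j"
  by (auto simp: Pref_D'_iff covered_def prefix_def)

lemma covered_Pref: "covered j \<subseteq> Pref D'"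
  by (auto simp: covered_def Pref_mono)

lemma covered_Suc: "covered (Suc j) = insert (take (Suc j) p) (covered j)"
  by (auto simp: covered_def le_Suc_eq)

definition depth :: "nat \<Rightarrow> nat" where
  "depth j = (if j = 0 then 0 else length (flink D' (take j p)))"

lemma depth_Suc: "j < length p \<Longrightarrow> depth (Suc j) \<le> Suc (depth j)"
  using flink_snoc_length[of "take j p" D' "p ! j"] flink_single[of D' "p ! 0"] p_ne
  by (cases "j = 0") (simp_all add: depth_def take_Suc_conv_app_nth)

text \<open>The list head is copied from the failure link, which is shorter than the prefix and
  therefore covered; by \<open>top_out_flink\<close> it is the right one.\<close>

lemma run_link_new:
  assumes b: "base N" and st: "states N" and g: "goto_ok N" and lk: "linked j N"
    and j: "regs N rIdx = Suc j" "j < length p" and new: "take (Suc j) p \<notin> Pref D"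
  shows "run link_new N (\<lambda>t N'. keeps {rCur, rChr, rCnt, rFail} {Flink, OutHead} N N' \<and> linked (Suc j) N' \<and>
    t + (6 * L + 12) * depth (Suc j) \<le> (6 * L + 12) * (depth j + 3))"
proof -
  let ?x = "take (Suc j) p"
  define G where "G = 6 * L + 12"
  then have G: "12 \<le> G" by simp
  have x: "?x \<noteq> []" "?x \<in> Pref D'" "length ?x = Suc j" using p_ne j(2) by auto
  note fx = flink_props[OF x(1), where D = D']
  have ax: "cells N aState (Suc j) = sa ?x" using st j(2) by (auto simp: states_def)
  have fin: "linked (Suc j) (N'\<lparr>cells := (cells N')(Flink := (cells N' Flink)(sa ?x := r),
        OutHead := (cells N' OutHead)(sa ?x := cells N' OutHead r))\<rparr>)"
    if k: "keeps {rCur, rChr, rCnt, rFail} {} N N'" and r: "r = sa (flink D' ?x)" for N' r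
  proof -
    let ?N = "N'\<lparr>cells := (cells N')(Flink := (cells N' Flink)(sa ?x := r),
        OutHead := (cells N' OutHead)(sa ?x := cells N' OutHead r))\<rparr>"
    have c: "cells N' = cells N" using k by (auto simp: keeps_def)
    have "take i p \<noteq> ?x" if "i \<le> j" for i
    proof -
      have "length (take i p) \<noteq> length ?x" using that j(2) by simp
      then show ?thesis by metis
    qed
    then have nx: "?x \<notin> covered j" using new by (auto simp: covered_def) (metis)
    have "flink D' ?x \<in> covered j" using covered_short[OF fx(1)] fx(3) x(3) by simp
    then have "cells N' OutHead r = out (top_out D (flink D' ?x))" using lk r c by (simp add: linked_def)
    moreover have "?x \<notin> D" using new by (auto simp: Pref_def)
    then have "top_out D ?x = top_out D (flink D' ?x)" by (rule top_out_flink[OF _ x(1)]) (simp add: D' subset_insertI)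
    ultimately have "cells N' OutHead r = out (top_out D ?x)" by simp
    moreover have "sa s \<noteq> sa ?x" if "s \<in> covered j" for s
      using that sa_eq[OF _ x(2)] covered_Pref nx by blast
    ultimately show ?thesis using lk r c unfolding linked_def covered_Suc by auto
  qed
  have "run link_new N (\<lambda>t N'. keeps {rCur, rChr, rCnt, rFail} {Flink, OutHead} N N' \<and> linked (Suc j) N' \<and>
    t + G * depth (Suc j) \<le> G * (depth j + 3))"
  proof (cases "j = 0")
    case True
    have "flink D' ?x = []" using flink_single[of D' "p ! 0"] True p_ne by (simp add: take_Suc_conv_app_nth)
    then have r: "regs N AcRoot = sa (flink D' ?x)" using sa_Nil[OF b] by simp
    have k: "keeps {rCur, rChr, rCnt, rFail} {} N (N\<lparr>regs := (regs N)(rCur := regs N AcRoot)\<rparr>)"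
      by (auto simp: keeps_def)
    have "depth (Suc j) \<le> 1" using depth_Suc[OF j(2)] True by (simp add: depth_def)
    then have "G * depth (Suc j) \<le> G" using mult_le_mono2[of "depth (Suc j)" 1 G] by simp
    then have t: "5 + G * depth (Suc j) \<le> G * (depth j + 3)"
    proof -
      have "G * (depth j + 3) = G * depth j + 3 * G" by (simp add: add_mult_distrib2)
      then show ?thesis using G \<open>G * depth (Suc j) \<le> G\<close> by linarith
    qed
    show ?thesis using fin[OF k r] j True ax t unfolding link_new_def
      by (auto simp: keeps_def eval_nat_numeral fun_upd_twist)
  next
    case False
    have aj: "cells N aState j = sa (take j p)" using st j(2) by (auto simp: states_def)
    have fj: "cells N Flink (sa (take j p)) = sa (flink D' (take j p))"
    proof -
      have "take j p \<in> covered j" "take j p \<noteq> []" using False p_ne by (auto simp: covered_def)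
      then show ?thesis using lk by (simp add: linked_def)
    qed
    let ?N = "N\<lparr>regs := (regs N)(rFail := sa (flink D' (take j p)))\<rparr>"
    have k0: "keeps {rFail} {} N ?N" by (auto simp: keeps_def)
    have bN: "base ?N" by (rule base_keeps[OF b k0]) auto
    have gN: "goto_ok ?N" by (rule goto_ok_keeps[OF g k0]) auto
    have "cells ?N Flink (sa s) = sa (flink D' s)" if "s \<in> Pref D'" "s \<noteq> []" "length s < j" for s
      using lk covered_short[OF that(1), of j] that by (simp add: linked_def)
    from run_find_link[OF bN gN _ _ j(2) _ this, folded G_def] j(1) False
    have fl: "run find_link ?N (\<lambda>t N'. keeps {rCur, rChr, rCnt, rFail} {} ?N N' \<and>
      regs N' rCur = sa (flink D' ?x) \<and> t + G * length (flink D' ?x) \<le> G * (length (flink D' (take j p)) + 2))"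
      by simp
    have d: "depth j = length (flink D' (take j p))" "depth (Suc j) = length (flink D' ?x)"
      using False by (auto simp: depth_def)
    have "run find_link ?N (\<lambda>t N'. keeps {rCur, rChr, rCnt, rFail} {} N N' \<and>
      regs N' rCur = sa (flink D' ?x) \<and> t + 7 + G * depth (Suc j) \<le> G * (depth j + 3))"
      by (rule run_mono[OF fl]) (use G in \<open>auto simp: keeps_def d add_mult_distrib2\<close>)
    then show ?thesis using j(1) False aj fj unfolding link_new_def
      apply (simp add: j)
      apply (erule run_mono)
      apply (elim conjE)
      subgoal for t N'
        using fin[of N' "regs N' rCur"] ax j(1)
        by (auto simp: keeps_def fun_upd_twist)
      done
  qed
  then show ?thesis unfolding G_def .
qed

text \<open>The differences of \<open>depth\<close> telescope. For a new prefix
  \<open>run_link_new\<close> uses \<open>3 * G\<close> beyond the change of potential; for an old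
  prefix, which is skipped, \<open>depth\<close> may still grow by one. \<open>5 * G\<close> covers
  either case with the loop overhead.\<close>

lemma run_failures:
  assumes b: "base N0" and st: "states N0" and g: "goto_ok N0"
    and fl: "\<forall>s\<in>Pref D. s \<noteq> [] \<longrightarrow> cells N0 Flink (sa s) = sa (flink D' s)"
    and oh: "cells N0 OutHead = cells M0 OutHead"
  shows "run failures N0 (\<lambda>t N. t \<le> 100 * L * length p + 3 \<and>
    keeps {rIdx, rCur, rChr, rCnt, rFail} {Flink, OutHead} N0 N \<and> linked (length p) N)"
proof -
  let ?K = "keeps {rIdx, rCur, rChr, rCnt, rFail} {Flink, OutHead} N0"
  define G where "G = 6 * L + 12"
  define I where "I n t N \<longleftrightarrow> n + regs N rIdx = length p \<and> ?K N \<and> linked (regs N rIdx) N \<and>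
     t + G * depth (regs N rIdx) \<le> 5 * G * regs N rIdx" for n t N
  have pres: "base N" "states N" "goto_ok N" if "?K N" for N
    using base_keeps[OF b that] states_keeps[OF st that] goto_ok_keeps[OF g that] by auto
  have G: "12 \<le> G" by (simp add: G_def)
  show ?thesis unfolding failures_def
    apply (simp only: block.simps run_Seq run_Assign run_Skip)
    apply (rule run_while[where I = I and n = "length p"])
    subgoal
    proof -
      have "covered 0 = Pref D" by (auto simp: covered_def)
      moreover have "cells M0 OutHead (sa s) = out (top_out D s)" if "s \<in> Pref D" for s
        using initial_outputs(1)[OF that] sa_old that top_out_Pref(1) by (simp add: out_def out_addr_def)
      ultimately show ?thesis unfolding I_def linked_def using fl oh by (auto simp: keeps_def depth_def)
    qed
    subgoal for n t N
    proof -
      assume I: "I n t N" and "bval (Less (Var rIdx) (Var PatLen)) N"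
      define j where "j = regs N rIdx"
      then have ji: "regs N rIdx = j" by simp
      have kN: "?K N" and lk: "linked j N" and tt: "t + G * depth j \<le> 5 * G * j" and n: "n + j = length p"
        using I unfolding I_def j_def by blast+
      have jl: "j < length p" using \<open>bval _ N\<close> base_regs(1)[OF pres(1)[OF kN]] by (simp add: j_def)
      then obtain k where k: "n = Suc k" using n by (cases n) auto
      let ?N = "N\<lparr>regs := (regs N)(rIdx := Suc j)\<rparr>"
      have kN': "?K ?N" using kN by (auto simp: keeps_def)
      note pN = pres[OF kN']
      have lN: "linked j ?N" using lk by (simp add: linked_def)
      have ax: "cells N aState (Suc j) = sa (take (Suc j) p)" "regs N rOld = F0" using pN(2) jl by (auto simp: states_def)
      have sv: "5 * G * Suc j = 5 * G * j + 5 * G" by simp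
      show ?thesis
      proof (cases "take (Suc j) p \<in> Pref D")
        case True
        then have "covered (Suc j) = covered j" unfolding covered_Suc by (auto simp: covered_def)
        then have l: "linked (Suc j) ?N" using lN by (simp add: linked_def)
        have "G * depth (Suc j) \<le> G * depth j + G" using mult_le_mono2[OF depth_Suc[OF jl], of G] by simp
        then have "t + 4 + 1 + G * depth (Suc j) \<le> 5 * G * Suc j" using tt sv G by linarith
        then have "I k (t + 4 + 1) ?N" unfolding I_def using n k kN' l by simp
        then have "I k (Suc (Suc (Suc (Suc (Suc t))))) ?N" by (simp add: eval_nat_numeral)
        moreover have "sa (take (Suc j) p) < F0" using True sa_old by blast
        ultimately show ?thesis using ax k by (auto simp: ji)
      next
        case False
        have "run link_new ?N (\<lambda>u N'. I k (t + (u + 3) + 1) N')"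
          using run_link_new[OF pN lN _ jl False, folded G_def]
        proof (rule run_mono, simp, elim conjE)
          fix u N' assume u: "keeps {rCur, rChr, rCnt, rFail} {Flink, OutHead} ?N N'" "linked (Suc j) N'"
            "u + G * depth (Suc j) \<le> G * (depth j + 3)"
          have "G * (depth j + 3) = G * depth j + 3 * G" by (simp add: add_mult_distrib2)
          then have "t + (u + 3) + 1 + G * depth (Suc j) \<le> 5 * G * Suc j" using tt sv u(3) G by linarith
          moreover have "?K N'" "regs N' rIdx = Suc j" using kN' u(1) by (auto simp: keeps_def)
          ultimately show "I k (t + (u + 3) + 1) N'" unfolding I_def using n k u(2) by simp
        qed
        moreover have "\<not> sa (take (Suc j) p) < F0" using False sa_new[OF take_Pref] by (simp add: not_less)
        ultimately show ?thesis using ax k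
          by (simp add: ji) (erule run_mono, auto simp: eval_nat_numeral)
      qed
    qed
    subgoal for n t N
    proof -
      assume I: "I n t N" and "\<not> bval (Less (Var rIdx) (Var PatLen)) N"
      then have i: "regs N rIdx = length p" using base_regs(1)[OF pres(1)] by (auto simp: I_def)
      have "t \<le> 5 * G * length p" using I i by (auto simp: I_def)
      \<comment> \<open>\<open>5 * (6 * L + 12) <= 90 * L\<close> because
        \<open>1 <= L\<close>.\<close>
      also have "\<dots> \<le> 90 * L * length p" unfolding G_def by (intro mult_right_mono) (use Suc_leI[OF L_pos] in \<open>simp_all add: algebra_simps\<close>)
      finally show ?thesis using I i by (auto simp: I_def)
    qed
    done
qed

end

section \<open>Outputs after an insertion\<close>

definition emit_new :: com where
  "emit_new = block [
     Assign rFrom (Cell OutHead (Var rTo)),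
     Cond (Equal (Var rLast) (Num 0)) Skip
       (block [Store StateOf (Var rLast) (Var rSave), redirect_below]),
     Store OutNext (Var rTo) (Var rFrom),
     Store OutHead (Var rTo) (Var rTo)]"

text \<open>A pattern heads its own output list. The test therefore recognizes that \<open>p\<close>
  was in the dictionary before, in which case nothing is left to do.\<close>

definition emit :: com where
  "emit = block [
     Assign rTo (Cell aState (Var PatLen)),
     Cond (Equal (Cell OutHead (Var rTo)) (Var rTo)) Skip emit_new]"

definition insert_com :: com where
  "insert_com = block [build, scan, Assign rLast (Var rNod), relink_all, failures, emit]"

lemma suffix_tl_neq: "q \<noteq> [] \<Longrightarrow> q \<noteq> p \<Longrightarrow> suffix p (tl q) \<longleftrightarrow> suffix p q"
  by (auto simp: suffix_tl_iff strict_suffix_iff)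

context insertion
begin

text \<open>Otherwise \<open>x\<close>, being no longer than \<open>p\<close>, would be a suffix of
  \<open>p\<close>, and \<open>between_fresh\<close> would give \<open>p = ext D x\<close>. Then
  \<open>p\<close> would be equivalent to its proper prefix \<open>x\<close>.\<close>

lemma new_not_below:
  assumes "x \<in> new" "x \<noteq> p" shows "\<not> suffix p (ext D x)"
proof
  assume s: "suffix p (ext D x)"
  note x = newD[OF assms(1)]
  have sx: "suffix x (ext D x)" using ext(3)[OF fin] x by blast
  have "length x \<le> length p" using x prefix_length_le by blast
  then have "suffix x p" using sx s suffix_length_suffix by blast
  then have "p = ext D x" using between_fresh[OF fin p_ne D' assms(1), of p] s assms(2) by (auto simp: Pref_D'_iff)
  moreover have "endPos D (ext D x) = endPos D x" using ext(2)[OF fin] x by blast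
  moreover have "strict_prefix x p" using x assms(2) by (simp add: strict_prefix_def)
  ultimately show False using endPos_strict_prefix[of x p D] ext(1)[OF fin, of x] x reps_Substr by metis
qed

text \<open>With the entry at the node of \<open>p\<close> restored, a state stored there is visible
  again. By \<open>new_not_below\<close> no mark of another prefix lies in the subtree, so the
  search meets exactly the states that have \<open>p\<close> as a suffix, and \<open>u_o\<close>
  counts these.\<close>

lemma run_redirect_states:
  assumes p: "p \<in> Substr D" and nD: "p \<notin> D" and b: "base N"
    and rl: "regs N rLast = nd p" "cells N StateOf (nd p) = state_addr (ext D p)"
    and so: "\<And>x. x \<in> new \<Longrightarrow> x \<noteq> p \<Longrightarrow> cells N StateOf (nd (ext D x)) = sa x"
      "\<And>z. z \<in> reps D \<Longrightarrow> z \<notin> ext D ` new \<Longrightarrow> cells N StateOf (nd z) = state_addr z"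
  shows "run redirect_below N (\<lambda>t N'. t \<le> 10 + 60 * u_o D D' \<and>
    keeps {rTop, rNod, rSta, rPtr, rNum} {aStack, OutHead, OutNext} N N' \<and>
    (\<forall>a\<in>{OutHead, OutNext}. \<forall>s\<in>Pref D'. cells N' a (sa s) =
       (if s \<in> Pref D \<and> suffix p s \<and> cells N a (sa s) = regs N rFrom then regs N rTo else cells N a (sa s))))"
proof -
  let ?e = "ext D p" and ?Mk = "Pref D \<union> ext D ` (new - {p})"
  note e = ext[OF fin p]
  have en: "?e \<notin> ext D ` (new - {p})"
    by (rule ext_neq[OF p]) auto
  have st: "cells N StateOf (nd z) = (if z \<in> ext D ` (new - {p}) then sa (inv_into (new - {p}) (ext D) z) else state_addr z)"
    if z: "z \<in> reps D" for z
  proof (cases "z \<in> ext D ` (new - {p})")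
    case True
    then obtain x where "x \<in> new - {p}" "z = ext D x" by blast
    moreover have "inj_on (ext D) (new - {p})" using ext_fresh_inj[OF fin, of p] inj_on_diff by blast
    ultimately show ?thesis using so(1)[of x] by simp
  next
    case False
    then have "z = ?e \<or> z \<notin> ext D ` new" by auto
    then show ?thesis using False so(2)[OF z] rl(2) nd_ext[OF p] by auto
  qed
  have inv: "inv_into (new - {p}) (ext D) z \<in> new" if "z \<in> ext D ` (new - {p})" for z
    using inv_into_into[OF that] by simp
  have md: "marked_dawg D ?Mk nd (cells N StateOf) (children N)"
  proof (rule marked_dawgI)
    show "Pref D \<subseteq> ?Mk" by simp
    show "?Mk \<subseteq> reps D" using Pref_reps newD by auto
    show "base N" by (rule b)
    show "cells N StateOf (nd z) \<noteq> 0 \<longleftrightarrow> z \<in> ?Mk" if "z \<in> reps D" for z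
      using st[OF that] inv newD sa_pos[OF Pref_mono, of z] by (auto simp: state_addr_def)
  qed
  have below: "{y. suffix ?e y} \<inter> ?Mk = {s \<in> Pref D. suffix p s}"
  proof (intro equalityI subsetI)
    fix y assume "y \<in> {y. suffix ?e y} \<inter> ?Mk"
    moreover from this have "suffix p y" using e(3) suffix_order.trans by blast
    ultimately show "y \<in> {s \<in> Pref D. suffix p s}" using new_not_below by auto
  next
    fix y assume "y \<in> {s \<in> Pref D. suffix p s}"
    then show "y \<in> {y. suffix ?e y} \<inter> ?Mk" using ext_suffix_rep[OF fin Pref_reps] by auto
  qed
  have mem: "s \<in> Pref D \<and> suffix p s \<longleftrightarrow> sa s \<in> cells N StateOf ` nd ` {y \<in> reps D. suffix ?e y}"
    if s: "s \<in> Pref D'" for s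
  proof
    assume a: "s \<in> Pref D \<and> suffix p s"
    then have "s \<in> reps D" "suffix ?e s" using Pref_reps ext_suffix_rep[OF fin Pref_reps] by auto
    moreover from this have "s \<notin> ext D ` (new - {p})" using a new_not_below by auto
    ultimately show "sa s \<in> cells N StateOf ` nd ` {y \<in> reps D. suffix ?e y}"
      using st[of s] a by (auto simp: state_addr_def image_iff intro!: bexI[of _ s])
  next
    assume "sa s \<in> cells N StateOf ` nd ` {y \<in> reps D. suffix ?e y}"
    then obtain y where y: "y \<in> reps D" "suffix ?e y" "sa s = cells N StateOf (nd y)" by auto
    have py: "suffix p y" using y(2) e(3) suffix_order.trans by blast
    then have "y \<notin> ext D ` (new - {p})" using new_not_below by auto
    then have "y \<in> Pref D" "sa s = sa y" using st[OF y(1)] y(3) sa_pos[OF s]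
      by (auto simp: state_addr_def split: if_splits)
    then show "s \<in> Pref D \<and> suffix p s" using sa_eq[OF s Pref_mono] py by auto
  qed
  have uo: "card ({y. suffix ?e y} \<inter> ?Mk) = u_o D D'"
    unfolding below D' by (rule u_o_insert[OF nD p_ne, symmetric])
  have rl': "regs N rLast = nd ?e" using rl nd_ext[OF p] by simp
  show ?thesis using run_redirect_below[OF md e(1) rl'] unfolding uo
    by (rule run_mono) (simp add: mem[symmetric] sa_pos cong: if_cong)
qed

text \<open>By \<open>top_out_insert\<close> a pointer has to be changed to \<open>p\<close> if it
  equals the head \<open>?h\<close> of \<open>p\<close> and the state has \<open>p\<close> as a
  suffix; for the successor of \<open>q\<close> the same criterion is applied to
  \<open>tl q\<close>. If \<open>p\<close> does not occur in \<open>D\<close>, no old state has it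
  as a suffix and the search is skipped.\<close>

lemma run_emit:
  assumes b: "base N" and st: "states N"
    and rl: "regs N rLast = (if p \<in> Substr D then nd p else 0)"
      "p \<in> Substr D \<longrightarrow> regs N rSave = state_addr (ext D p)"
    and so': "\<forall>x\<in>new. cells N StateOf (nd (ext D x)) = sa x"
      "\<forall>z\<in>reps D. z \<notin> ext D ` new \<longrightarrow> cells N StateOf (nd z) = state_addr z"
    and oh': "\<forall>s\<in>Pref D'. cells N OutHead (sa s) = out (top_out D s)"
    and on': "\<forall>q\<in>D. cells N OutNext (sa q) = out (top_out D (tl q))"
  shows "run emit N (\<lambda>t N'. t \<le> 30 + 60 * u_o D D' \<and>
    keeps {rTo, rFrom, rTop, rNod, rSta, rPtr, rNum} {StateOf, aStack, OutHead, OutNext} N N' \<and>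
    (\<forall>s\<in>Pref D'. cells N' OutHead (sa s) = out (top_out D' s)) \<and>
    (\<forall>q\<in>D'. cells N' OutNext (sa q) = out (top_out D' (tl q))))"
proof -
  note so = so'(1)[rule_format] so'(2)[rule_format] and oh = oh'[rule_format] and on = on'[rule_format]
  let ?K = "keeps {rTo, rFrom, rTop, rNod, rSta, rPtr, rNum} {StateOf, aStack, OutHead, OutNext}"
  have to: "cells N aState (regs N PatLen) = sa p" using st base_regs(1)[OF b] by (simp add: states_def)
  have pP: "p \<in> Pref D'" by (simp add: Pref_D'_iff)
  have op: "out p = sa p" using p_ne by (simp add: out_def)
  show ?thesis
  proof (cases "p \<in> D")
    case True
    then have "D' = D" by (auto simp: D')
    moreover have "cells N OutHead (sa p) = sa p" using oh[OF pP] True op by (simp add: longest_self)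
    ultimately show ?thesis using to oh on unfolding emit_def by (auto simp: keeps_def)
  next
    case False
    let ?h = "out (top_out D p)"
    have "top_out D p \<noteq> p" using longest(1)[of "insert [] D" p] False p_ne by auto
    then have hp: "?h \<noteq> sa p" using out_eq[OF top_out_Pref(2) pP] op by metis
    have ohp: "cells N OutHead (sa p) = ?h" using oh[OF pP] .
    let ?N = "N\<lparr>regs := (regs N)(rTo := sa p, rFrom := ?h)\<rparr>"
    let ?mid = "\<lambda>N'. ?K N N' \<and> regs N' rTo = sa p \<and> regs N' rFrom = ?h \<and>
      (\<forall>a\<in>{OutHead, OutNext}. \<forall>s\<in>Pref D'. cells N' a (sa s) =
       (if s \<in> Pref D \<and> suffix p s \<and> cells N a (sa s) = ?h then sa p else cells N a (sa s)))"
    have mid: "run (Cond (Equal (Var rLast) (Num 0)) Skip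
       (block [Store StateOf (Var rLast) (Var rSave), redirect_below])) ?N
       (\<lambda>t N'. t \<le> 13 + 60 * u_o D D' \<and> ?mid N')"
    proof (cases "p \<in> Substr D")
      case F: False
      have "\<not> suffix p s" if "s \<in> Pref D" for s
        using F Pref_Substr[OF that] Substr_sublist suffix_imp_sublist by blast
      then show ?thesis using rl F by (auto simp: keeps_def)
    next
      case T: True
      let ?N' = "?N\<lparr>cells := (cells N)(StateOf := (cells N StateOf)(nd p := state_addr (ext D p)))\<rparr>"
      have k: "keeps {rTo, rFrom} {StateOf} N ?N'" by (auto simp: keeps_def)
      have b': "base ?N'" by (rule base_keeps[OF b k]) auto
      have ndp: "nd (ext D x) \<noteq> nd p" if "x \<in> new" "x \<noteq> p" for x
      proof -
        have "ext D p \<notin> ext D ` (new - {p})" by (rule ext_neq[OF T]) auto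
        then have "ext D x \<noteq> ext D p" using that by (metis Diff_iff empty_iff imageI insert_iff)
        then show ?thesis using nd_inj newD[OF that(1)] ext(1)[OF fin T] nd_ext[OF T] by (metis inj_onD)
      qed
      have s1: "cells ?N' StateOf (nd (ext D x)) = sa x" if "x \<in> new" "x \<noteq> p" for x
        using so(1) that ndp[OF that] by simp
      have s2: "cells ?N' StateOf (nd z) = state_addr z" if "z \<in> reps D" "z \<notin> ext D ` new" for z
        using so(2) that nd_inj ext(1)[OF fin T] nd_ext[OF T] by (auto simp: inj_on_def)
      have "regs ?N' rLast = nd p" "cells ?N' StateOf (nd p) = state_addr (ext D p)" using rl T by auto
      from run_redirect_states[OF T False b' this s1 s2]
      have "run redirect_below ?N' (\<lambda>t N'. t + 3 \<le> 13 + 60 * u_o D D' \<and> ?mid N')"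
        by (rule run_mono) (auto simp: keeps_def)
      then show ?thesis using rl T nd_pos[OF T] by simp
    qed
    have fin2: "?K N Mf \<and> (\<forall>s\<in>Pref D'. cells Mf OutHead (sa s) = out (top_out D' s)) \<and>
        (\<forall>q\<in>D'. cells Mf OutNext (sa q) = out (top_out D' (tl q)))"
      if m: "?mid N'" and M: "Mf = N'\<lparr>cells := (cells N')(OutNext := (cells N' OutNext)(sa p := ?h),
         OutHead := (cells N' OutHead)(sa p := sa p))\<rparr>" for N' Mf
    proof (intro conjI ballI)
      have D'i: "D' = insert p D" by (simp add: D')
      note ti = top_out_insert[OF False p_ne, folded D'i]
      show "?K N Mf" using m M by (auto simp: keeps_def)
      fix s assume s: "s \<in> Pref D'"
      show "cells Mf OutHead (sa s) = out (top_out D' s)"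
      proof (cases "s = p")
        case True
        then show ?thesis using M op by (simp add: longest_self D'i)
      next
        case ne: False
        \<comment> \<open>A state that is not old is a prefix of \<open>p\<close>; having
          \<open>p\<close> as a suffix, it would be \<open>p\<close>.\<close>
        have "s \<in> Pref D" if "suffix p s"
        proof (rule ccontr)
          assume "s \<notin> Pref D"
          then have "prefix s p" using s by (simp add: Pref_D'_iff)
          then have "length s = length p" using that by (simp add: prefix_length_le suffix_length_le le_antisym)
          then show False using that ne by (auto simp: suffix_def)
        qed
        then have "cells N' OutHead (sa s) = (if suffix p s \<and> top_out D s = top_out D p then sa p else out (top_out D s))"
          using m s oh[OF s] out_eq[OF top_out_Pref(2) top_out_Pref(2)] by auto
        also have "\<dots> = out (top_out D' s)" using ti[of s] op by simp
        finally show ?thesis using M sa_eq[OF s pP] ne by simp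
      qed
    next
      fix q assume q: "q \<in> D'"
      have D'i: "D' = insert p D" by (simp add: D')
      note ti = top_out_insert[OF False p_ne, folded D'i]
      show "cells Mf OutNext (sa q) = out (top_out D' (tl q))"
      proof (cases "q = p")
        case True
        have "\<not> suffix p (tl p)" using p_ne by (auto simp: suffix_tl_iff)
        then have "top_out D' (tl p) = top_out D (tl p)" using ti[of "tl p"] by simp
        also have "\<dots> = top_out D p" using longest_tl[of "insert [] D" p] False p_ne by simp
        finally show ?thesis using M True by simp
      next
        case ne: False
        then have qD: "q \<in> D" using q D' by auto
        then have qP: "q \<in> Pref D" "q \<noteq> []" using Nil_D by (auto simp: Pref_def)
        have "cells N' OutNext (sa q) = (if suffix p q \<and> top_out D (tl q) = top_out D p then sa p else out (top_out D (tl q)))"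
          using m Pref_mono[OF qP(1)] qP on[OF qD] out_eq[OF top_out_Pref(2) top_out_Pref(2)] by auto
        also have "\<dots> = out (top_out D' (tl q))" using ti[of "tl q"] op suffix_tl_neq[OF qP(2) ne] by simp
        finally show ?thesis using M sa_eq[OF Pref_mono[OF qP(1)] pP] ne by simp
      qed
    qed
    let ?Q = "\<lambda>t N'. t \<le> 30 + 60 * u_o D D' \<and> ?K N N' \<and>
      (\<forall>s\<in>Pref D'. cells N' OutHead (sa s) = out (top_out D' s)) \<and>
      (\<forall>q\<in>D'. cells N' OutNext (sa q) = out (top_out D' (tl q)))"
    have "run (Cond (Equal (Var rLast) (Num 0)) Skip
       (block [Store StateOf (Var rLast) (Var rSave), redirect_below])) ?N
       (\<lambda>t N'. run (block [Store OutNext (Var rTo) (Var rFrom), Store OutHead (Var rTo) (Var rTo)]) N'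
         (\<lambda>u. ?Q (1 + (1 + (t + u) + 1 + 1))))"
      using mid
    proof (rule run_mono, elim conjE)
      fix t N' assume t: "t \<le> 13 + 60 * u_o D D'" and m: "?K N N'" "regs N' rTo = sa p" "regs N' rFrom = ?h"
        "\<forall>a\<in>{OutHead, OutNext}. \<forall>s\<in>Pref D'. cells N' a (sa s) =
          (if s \<in> Pref D \<and> suffix p s \<and> cells N a (sa s) = ?h then sa p else cells N a (sa s))"
      have "?mid N'" using m by blast
      note f = fin2[OF this refl]
      show "run (block [Store OutNext (Var rTo) (Var rFrom), Store OutHead (Var rTo) (Var rTo)]) N'
         (\<lambda>u. ?Q (1 + (1 + (t + u) + 1 + 1)))"
        using f m(2,3) t by (simp add: fun_upd_twist split: if_split_asm) blast
    qed
    then show ?thesis unfolding emit_def emit_new_def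
      using to ohp hp
      by (simp only: block.simps run_Seq run_Assign run_Cond run_Skip aval.simps bval.simps) simp
  qed
qed

end

section \<open>Correctness and cost of the whole insertion\<close>

lemma runE:
  assumes "run c M Q" obtains t M' where "exec c M t M'" "Q t M'"
  using assms by (auto simp: run_def)

lemma (in update_setup) state_addr_trie:
  assumes T: "trie (code_words L E) a ch F" and E: "\<forall>q\<in>E. set q \<subseteq> {..<2 ^ L}"
  shows "inj_on (\<lambda>s. a (bits L s)) (Pref E)"
    "\<And>s. s \<in> Pref E \<Longrightarrow> 0 < a (bits L s) \<and> a (bits L s) < F"
    "\<And>f c. f \<in> Pref E \<Longrightarrow> c < \<sigma> \<Longrightarrow> walk ch (a (bits L f)) (code L c) =
      (if f @ [c] \<in> Pref E then a (bits L (f @ [c])) else 0)"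
proof -
  have ch: "set s \<subseteq> {..<2 ^ L}" if "s \<in> Pref E" for s
    using that E set_mono_prefix by (fastforce simp: Pref_def)
  have mem: "bits L s \<in> code_words L E \<longleftrightarrow> s \<in> Pref E" if "set s \<subseteq> {..<2 ^ L}" for s
    using bits_code_words[of L E s] E that by auto
  show "inj_on (\<lambda>s. a (bits L s)) (Pref E)"
  proof (rule inj_onI)
    fix x y assume xy: "x \<in> Pref E" "y \<in> Pref E" "a (bits L x) = a (bits L y)"
    then have "bits L x = bits L y" using T mem[OF ch] unfolding trie_def by (auto dest: inj_onD)
    then show "x = y" using bits_inj[OF L_pos ch[OF xy(1)] ch[OF xy(2)], of "[]" "[]"] by simp
  qed
  show "0 < a (bits L s) \<and> a (bits L s) < F" if "s \<in> Pref E" for s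
    using T mem[OF ch[OF that]] that unfolding trie_def by blast
  show "walk ch (a (bits L f)) (code L c) = (if f @ [c] \<in> Pref E then a (bits L (f @ [c])) else 0)"
    if "f \<in> Pref E" "c < \<sigma>" for f c
  proof -
    have "set (f @ [c]) \<subseteq> {..<2 ^ L}" using ch[OF that(1)] char_code[OF that(2)] by simp
    then show ?thesis using walk_trie[OF T, of "bits L f" "code L c"] mem[OF ch[OF that(1)]] mem[of "f @ [c]"] that by simp
  qed
qed

text \<open>Collects what either program has to establish: the trie accounts for the transitions,
  and by \<open>output_lists_iff\<close> the lists reduce to heads and successors.\<close>

lemma (in update_setup) represents_acI:
  assumes E: "finite E" "[] \<notin> E" "\<And>q. q \<in> E \<Longrightarrow> set q \<subseteq> {..<2 ^ L}" and b: "base N"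
    and T: "trie (code_words L E) a (ac_children N) (regs N FreeId)" and root: "a [] = \<nu> ([], [])"
    and fl: "\<And>s. s \<in> Pref E \<Longrightarrow> s \<noteq> [] \<Longrightarrow> cells N Flink (a (bits L s)) = a (bits L (flink E s))"
    and oh: "\<And>s. s \<in> Pref E \<Longrightarrow> cells N OutHead (a (bits L s)) =
      (if top_out E s = [] then 0 else a (bits L (top_out E s)))"
    and on: "\<And>q. q \<in> E \<Longrightarrow> cells N OutNext (a (bits L q)) =
      (if top_out E (tl q) = [] then 0 else a (bits L (top_out E (tl q))))"
  shows "represents_ac \<sigma> E (\<lambda>(v, w). a (bits L v @ w)) N"
proof -
  let ?\<nu> = "\<lambda>(v, w). a (bits L v @ w)"
  note br = branching_of_trie[OF L_pos E(3) T]
  have "(\<forall>s \<in> Pref E. \<exists>qs. set qs = outputs E s \<and> sorted_wrt (\<lambda>q r. length q > length r) qs \<and>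
        linked_list (cells N OutNext) (cells N OutHead (?\<nu> (s, []))) (map (\<lambda>q. ?\<nu> (q, [])) qs))"
    unfolding output_lists_iff[OF E(1,2)] using oh on by (simp add: out_addr_def)
  moreover have "regs N Width = code_len \<sigma>" "regs N AcRoot = ?\<nu> ([], [])"
    using base_regs(2,3)[OF b] root by (auto simp: L_def)
  moreover have "\<forall>s \<in> Pref E - {[]}. cells N Flink (?\<nu> (s, [])) = ?\<nu> (flink E s, [])" using fl by simp
  ultimately show ?thesis using br unfolding represents_ac_def L_def[symmetric] by blast
qed

lemma (in update_setup) insert_correct:
  "\<exists>t M' \<nu>'. exec insert_com M0 t M' \<and>
     t \<le> 500 * (L * length p + u_f D (D \<union> {p}) + u_o D (D \<union> {p})) \<and>
     represents_ac \<sigma> (D \<union> {p}) \<nu>' M' \<and> (\<forall>s \<in> Pref D \<inter> Pref (D \<union> {p}). \<nu>' (s, []) = \<nu> (s, [])) \<and>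
     represents_dawg \<sigma> D \<mu> M'"
proof -
  define D' where "D' = D \<union> {p}"
  obtain a0 where a0: "trie (code_words L D) a0 (ac_children M0) (regs M0 FreeId)"
    "\<And>v w. (v, w) \<in> branch_keys L (Pref D) (goto_edges D) \<Longrightarrow> a0 (bits L v @ w) = \<nu> (v, w)"
    using initial_trie by metis
  have a0': "a0 (bits L s) = \<nu> (s, [])" if "s \<in> Pref D" for s
    using a0(2)[of s "[]"] that by (simp add: branch_keys_def)
  have root: "regs M0 AcRoot = a0 []" using a0'[of "[]"] base_regs(3)[OF base_M0] by simp
  obtain t1 M1 where e1: "exec build M0 t1 M1" and t1: "t1 \<le> 30 * L * length p + 6"
    and k1: "keeps {rOld, rIdx, rCur, rChr, rCnt, FreeId} {AcChild False, AcChild True, aState} M0 M1"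
    and old: "regs M1 rOld = regs M0 FreeId"
    and ex: "\<exists>a'. trie (code_words L D') a' (ac_children M1) (regs M1 FreeId) \<and>
      grows (code_words L D) a0 (regs M0 FreeId) (code_words L D') a' (regs M1 FreeId) \<and>
      (\<forall>i\<le>length p. cells M1 aState i = a' (bits L (take i p)))"
    using run_build[OF a0(1) root, folded D'_def] by (elim runE conjE) blast
  then obtain a where T: "trie (code_words L D') a (ac_children M1) (regs M1 FreeId)"
    and gr: "grows (code_words L D) a0 (regs M0 FreeId) (code_words L D') a (regs M1 FreeId)"
    and sti: "\<forall>i\<le>length p. cells M1 aState i = a (bits L (take i p))" by blast
  define sa where "sa s = a (bits L s)" for s
  have fin': "finite D'" "[] \<notin> D'" "\<And>q. q \<in> D' \<Longrightarrow> set q \<subseteq> {..<2 ^ L}"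
    using fin Nil_D p_ne chars by (auto simp: D'_def)
  have "\<forall>q\<in>D'. set q \<subseteq> {..<2 ^ L}" using fin'(3) by blast
  note sat = state_addr_trie[OF T this]
  have old_addr: "sa s = \<nu> (s, []) \<and> sa s < regs M0 FreeId" if "s \<in> Pref D" for s
  proof -
    have s: "set s \<subseteq> {..<2 ^ L}" using chars_Substr[OF Pref_Substr[OF that]] char_code by auto
    have "bits L s \<in> code_words L D" using bits_code_words[OF L_pos chars(1) s] that by blast
    then have "sa s = a0 (bits L s)" "a0 (bits L s) < regs M0 FreeId"
      using gr a0(1) unfolding sa_def grows_def trie_def by blast+
    then show ?thesis using a0'[OF that] by simp
  qed
  interpret insertion \<sigma> D p \<nu> \<mu> M0 sa "regs M0 FreeId" D'
  proof
    show "D' = D \<union> {p}" by (simp add: D'_def)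
    show "sa s = \<nu> (s, []) \<and> sa s < regs M0 FreeId" if "s \<in> Pref D" for s by (rule old_addr[OF that])
    show "regs M0 FreeId \<le> sa s" if "s \<in> Pref D'" "s \<notin> Pref D" for s
    proof -
      have s: "set s \<subseteq> {..<2 ^ L}" using that(1) fin'(3) set_mono_prefix by (fastforce simp: Pref_def)
      have "bits L s \<in> code_words L D' - code_words L D"
        using bits_code_words[OF L_pos chars(1) s] bits_code_words[OF L_pos fin'(3) s] that by blast
      then show ?thesis using gr by (simp add: sa_def grows_def)
    qed
    show "inj_on sa (Pref D')" using sat(1) unfolding sa_def .
    show "0 < sa s" if "s \<in> Pref D'" for s using sat(2)[OF that] by (simp add: sa_def)
  qed
  have b1: "base M1" by (rule base_keeps[OF base_M0 k1]) auto
  have s1: "states M1" using old sti by (simp add: states_def sa_def)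
  have g1: "goto_ok M1" using sat(3) by (simp add: goto_ok_def sa_def)
  have c1: "cells M1 StateOf = cells M0 StateOf" "cells M1 Flink = cells M0 Flink"
    "cells M1 OutHead = cells M0 OutHead" "cells M1 OutNext = cells M0 OutNext"
    using k1 by (simp_all add: keeps_def)
  obtain t2 M2 where e2: "exec scan M1 t2 M2" and t2: "t2 \<le> 40 * L * length p + 5"
    and k2: "keeps {rCur, rChr, rCnt, rNod, rIdx, rRoots, rSave} {aRoots, Flink, StateOf} M1 M2"
    and sc: "scanned new M2" and nod: "regs M2 rNod = (if p \<in> Substr D then nd p else 0)"
    and sav: "p \<in> Substr D \<longrightarrow> regs M2 rSave = state_addr (ext D p)"
    using run_scan[OF b1 s1 c1(1,2)] by (elim runE conjE)
  define M3 where "M3 = M2\<lparr>regs := (regs M2)(rLast := regs M2 rNod)\<rparr>"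
  have e3: "exec (Assign rLast (Var rNod)) M2 1 M3" using exec.Assign[of rLast "Var rNod" M2] by (simp add: M3_def)
  have k3: "keeps {rLast} {} M2 M3" by (auto simp: M3_def keeps_def)
  have b3: "base M3" by (rule base_keeps[OF base_keeps[OF b1 k2] k3]) auto
  have s3: "states M3" by (rule states_keeps[OF states_keeps[OF s1 k2] k3]) auto
  have g3: "goto_ok M3" by (rule goto_ok_keeps[OF goto_ok_keeps[OF g1 k2] k3]) auto
  have sc3: "scanned new M3" using sc by (simp add: scanned_def M3_def)
  obtain t4 M4 where e4: "exec relink_all M3 t4 M4" and t4: "t4 \<le> 172 * length p + 72 * u_f D D' + 1"
    and k4: "keeps {rRoots, rTo, rTop, rNod, rSta, rPtr, rNum} {aStack, Flink} M3 M4"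
    and f4: "\<forall>s\<in>Pref D. s \<noteq> [] \<longrightarrow> cells M4 Flink (sa s) = sa (flink D' s)"
    using run_relink_all[OF b3 sc3] by (elim runE conjE)
  have b4: "base M4" by (rule base_keeps[OF b3 k4]) auto
  have s4: "states M4" by (rule states_keeps[OF s3 k4]) auto
  have g4: "goto_ok M4" by (rule goto_ok_keeps[OF g3 k4]) auto
  have oh4: "cells M4 OutHead = cells M0 OutHead" "cells M4 OutNext = cells M0 OutNext"
    using c1 k2 k3 k4 by (simp_all add: keeps_def)
  obtain t5 M5 where e5: "exec failures M4 t5 M5" and t5: "t5 \<le> 100 * L * length p + 3"
    and k5: "keeps {rIdx, rCur, rChr, rCnt, rFail} {Flink, OutHead} M4 M5" and l5: "linked (length p) M5"
    using run_failures[OF b4 s4 g4 f4 oh4(1)] by (elim runE conjE)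
  have b5: "base M5" by (rule base_keeps[OF b4 k5]) auto
  have s5: "states M5" by (rule states_keeps[OF s4 k5]) auto
  have cov: "s \<in> covered (length p)" if "s \<in> Pref D'" for s
  proof (cases "s \<in> Pref D")
    case False
    then show ?thesis using that covered_short[OF that] prefix_length_le[of s p] by (simp add: Pref_D'_iff)
  qed (simp add: covered_def)
  have rl5: "regs M5 rLast = (if p \<in> Substr D then nd p else 0)"
    and rs5: "p \<in> Substr D \<longrightarrow> regs M5 rSave = state_addr (ext D p)"
    using nod sav k4 k5 by (simp_all add: keeps_def M3_def)
  have so5: "cells M5 StateOf = cells M2 StateOf" using k3 k4 k5 by (simp add: keeps_def)
  have on5: "cells M5 OutNext (sa q) = out (top_out D (tl q))" if "q \<in> D" for q
  proof -
    have "q \<in> Pref D" using that by (auto simp: Pref_def)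
    then show ?thesis using initial_outputs(2)[OF that] oh4(2) k5 old_addr[OF top_out_Pref(1)] old_addr[of q]
      by (simp add: keeps_def out_def out_addr_def)
  qed
  then have on5': "\<forall>q\<in>D. cells M5 OutNext (sa q) = out (top_out D (tl q))" by blast
  have so6: "\<forall>x\<in>new. cells M5 StateOf (nd (ext D x)) = sa x"
    "\<forall>z\<in>reps D. z \<notin> ext D ` new \<longrightarrow> cells M5 StateOf (nd z) = state_addr z"
    using sc unfolding scanned_def so5 by blast+
  have oh5: "\<forall>s\<in>Pref D'. cells M5 OutHead (sa s) = out (top_out D s)"
    using l5 cov by (simp add: linked_def)
  obtain t6 M6 where e6: "exec emit M5 t6 M6" and t6: "t6 \<le> 30 + 60 * u_o D D'"
    and k6: "keeps {rTo, rFrom, rTop, rNod, rSta, rPtr, rNum} {StateOf, aStack, OutHead, OutNext} M5 M6"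
    and o6: "\<forall>s\<in>Pref D'. cells M6 OutHead (sa s) = out (top_out D' s)"
      "\<forall>q\<in>D'. cells M6 OutNext (sa q) = out (top_out D' (tl q))"
    using run_emit[OF b5 s5 rl5 rs5 so6 oh5 on5'] by (elim runE conjE)
  have b6: "base M6" by (rule base_keeps[OF b5 k6]) auto
  let ?\<nu> = "\<lambda>(v, w). a (bits L v @ w)"
  have free: "regs M6 FreeId = regs M1 FreeId" using k2 k3 k4 k5 k6 by (simp add: keeps_def)
  have "cells M6 (AcChild b) = cells M1 (AcChild b)" for b using k2 k3 k4 k5 k6 by (simp add: keeps_def)
  then have T6: "trie (code_words L D') a (ac_children M6) (regs M6 FreeId)" using T free by simp
  have "represents_ac \<sigma> D' ?\<nu> M6"
  proof (rule represents_acI[OF fin' b6 T6])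
    show "a [] = \<nu> ([], [])" using old_addr[of "[]"] by (simp add: sa_def)
    show "cells M6 Flink (a (bits L s)) = a (bits L (flink D' s))" if "s \<in> Pref D'" "s \<noteq> []" for s
      using l5 cov[OF that(1)] that(2) k6 by (simp add: linked_def keeps_def sa_def)
  qed (use o6 in \<open>simp_all add: out_def sa_def\<close>)
  moreover have "\<forall>s\<in>Pref D \<inter> Pref D'. ?\<nu> (s, []) = \<nu> (s, [])" using old_addr by (simp add: sa_def)
  moreover have "exec insert_com M0 (t1 + (t2 + (1 + (t4 + (t5 + (t6 + 1)))))) M6"
    unfolding insert_com_def block.simps by (intro exec.Seq[OF e1] exec.Seq[OF e2] exec.Seq[OF e3]
        exec.Seq[OF e4] exec.Seq[OF e5] exec.Seq[OF e6] exec.Skip)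
  moreover have "t1 + (t2 + (1 + (t4 + (t5 + (t6 + 1))))) \<le> 500 * (L * length p + u_f D D' + u_o D D')"
  proof -
    \<comment> \<open>As \<open>L * length p\<close> is at least 1, it absorbs all additive
      constants; 500 generously exceeds the sum of the constants of the parts.\<close>
    have "1 \<le> L" "1 \<le> length p" using L_pos len_p by linarith+
    then have "length p \<le> L * length p" "1 \<le> L * length p" using mult_le_mono1[of 1 L "length p"] by auto
    moreover define m where "m = L * length p"
    ultimately have "length p \<le> m" "1 \<le> m" by simp_all
    then show ?thesis using t1 t2 t4 t5 t6 unfolding mult.assoc m_def[symmetric] by simp
  qed
  ultimately show ?thesis using dawg_base[OF b6] unfolding D'_def by blast
qed

section \<open>Deletion\<close>

text \<open>The vertices outside \<open>T'\<close> are entered only by the edge from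
  \<open>\<beta>\<close> with digit \<open>b\<close>, so clearing this one pointer detaches them
  all. The remaining vertices keep their addresses.\<close>

lemma trie_prune:
  assumes "trie T a ch F" "T' \<subseteq> T" "[] \<in> T'" "\<And>\<gamma> c. \<gamma> @ [c] \<in> T' \<Longrightarrow> \<gamma> \<in> T'"
    "\<beta> \<in> T'" "\<beta> @ [b] \<notin> T'"
    "\<And>\<gamma> c. \<gamma> \<in> T' \<Longrightarrow> \<gamma> @ [c] \<in> T \<Longrightarrow> \<gamma> @ [c] \<notin> T' \<Longrightarrow> \<gamma> = \<beta> \<and> c = b"
    "\<And>c v. ch' c v = (if c = b \<and> v = a \<beta> then 0 else ch c v)"
  shows "trie T' a ch' F"
proof -
  have T: "inj_on a T" "\<And>\<gamma>. \<gamma> \<in> T \<Longrightarrow> 0 < a \<gamma> \<and> a \<gamma> < F"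
    "\<And>\<gamma> c. \<gamma> \<in> T \<Longrightarrow> ch c (a \<gamma>) = (if \<gamma> @ [c] \<in> T then a (\<gamma> @ [c]) else 0)"
    using assms(1) unfolding trie_def by blast+
  have "ch' c (a \<gamma>) = (if \<gamma> @ [c] \<in> T' then a (\<gamma> @ [c]) else 0)" if g: "\<gamma> \<in> T'" for \<gamma> c
  proof (cases "c = b \<and> \<gamma> = \<beta>")
    case False
    then have "ch' c (a \<gamma>) = ch c (a \<gamma>)" using T(1) g assms(2,5,8) by (auto dest: inj_onD)
    moreover have "\<gamma> @ [c] \<in> T \<longleftrightarrow> \<gamma> @ [c] \<in> T'" using assms(2,7) g False by blast
    ultimately show ?thesis using T(3) g assms(2) by auto
  qed (use assms(6,8) in simp)
  then show ?thesis using T(1,2) assms(2,3,4) inj_on_subset unfolding trie_def by blast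
qed

definition set_cut :: com where
  "set_cut = block [
     Assign rCut (Var rCur), Assign rBit (Parity (Var rChr)), Assign rKeep (Var rIdx)]"

text \<open>If the other child exists, another pattern branches off here and the vertex
  survives.\<close>

definition probe :: "bool \<Rightarrow> com" where
  "probe b = block [
     Cond (Equal (Cell (AcChild (\<not> b)) (Var rCur)) (Num 0)) Skip set_cut,
     Assign rCur (Cell (AcChild b) (Var rCur))]"

text \<open>A state is the head of its own output list iff it is a pattern. As \<open>rIdx\<close>
  is still below \<open>PatLen\<close>, this is another pattern than \<open>p\<close>, which keeps
  the path up to here.\<close>

definition locate_char :: com where
  "locate_char = block [
     Cond (Equal (Cell OutHead (Var rCur)) (Var rCur)) set_cut Skip,
     Assign rCnt (Var Width),
     While (Less (Num 0) (Var rCnt)) (block [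
       Cond (Equal (Parity (Var rChr)) (Num 0)) (probe False) (probe True),
       Assign rChr (Half (Var rChr)),
       Assign rCnt (Decr (Var rCnt))])]"

text \<open>The root always survives and is the initial cut. If the vertex of \<open>p\<close> has a
  child, then \<open>p\<close> is a proper prefix of another pattern and the whole path survives,
  which is encoded by \<open>rKeep = PatLen\<close> and the null pointer as cut.\<close>

definition locate :: com where
  "locate = block [
     Assign rCur (Var AcRoot),
     Assign rIdx (Num 0),
     Store aState (Num 0) (Var rCur),
     Assign rCut (Var AcRoot), Assign rBit (Parity (Cell Pat (Num 0))), Assign rKeep (Num 0),
     While (Less (Var rIdx) (Var PatLen)) (block [
       Assign rChr (Cell Pat (Var rIdx)),
       locate_char,
       Assign rIdx (Incr (Var rIdx)),
       Store aState (Var rIdx) (Var rCur)]),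
     Cond (Conj (Equal (Cell (AcChild False) (Var rCur)) (Num 0)) (Equal (Cell (AcChild True) (Var rCur)) (Num 0)))
       Skip (block [Assign rKeep (Var PatLen), Assign rCut (Num 0)])]"

text \<open>\<open>rTo\<close> is read when all shorter removed states have been treated, so it is
  the corrected link of the state now removed.\<close>

definition relink_removed :: com where
  "relink_removed = block [
     Assign rIdx (Var rKeep),
     While (Less (Var rIdx) (Var PatLen)) (block [
       Assign rIdx (Incr (Var rIdx)),
       Assign rNod (Cell NodeOf (Cell aState (Var rIdx))),
       Assign rTo (Cell Flink (Cell aState (Var rIdx))),
       relink_children])]"

definition retract :: com where
  "retract = block [
     Assign rFrom (Cell aState (Var PatLen)),
     Assign rTo (Cell OutNext (Var rFrom)),
     Assign rLast (Cell NodeOf (Var rFrom)),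
     redirect_below]"

definition prune :: com where
  "prune = Cond (Equal (Var rCut) (Num 0)) Skip
     (Cond (Equal (Var rBit) (Num 0))
       (Store (AcChild False) (Var rCut) (Num 0)) (Store (AcChild True) (Var rCut) (Num 0)))"

definition delete_com :: com where
  "delete_com = block [locate, relink_removed, retract, prune]"

locale deletion = update_setup +
  fixes a :: "bool list \<Rightarrow> nat" and D' :: "str set"
  assumes D': "D' = D - {p}" and pD: "p \<in> D"
    and T: "trie (code_words L D) a (ac_children M0) (regs M0 FreeId)"
    and a_\<nu>: "\<And>s. s \<in> Pref D \<Longrightarrow> a (bits L s) = \<nu> (s, [])"
begin

abbreviation "sa s \<equiv> \<nu> (s, [])"
abbreviation "W \<equiv> bits L p"

lemma D_insert: "D = insert p D'" "p \<notin> D'" using pD by (auto simp: D')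

lemma take_Pref [simp]: "take i p \<in> Pref D"
  using pD take_is_prefix by (auto simp: Pref_def)

lemma p_Pref [simp]: "p \<in> Pref D" using take_Pref[of "length p"] by simp

lemma W_T: "take i W \<in> code_words L D"
  using pD take_is_prefix by (auto simp: code_words_def)

lemma Pref_D'_sub: "s \<in> Pref D' \<Longrightarrow> s \<in> Pref D" by (auto simp: D' Pref_def)

lemma chars_Pref: "s \<in> Pref D \<Longrightarrow> set s \<subseteq> {..<2 ^ L}"
  using chars_Substr[OF Pref_Substr] char_code by fastforce

lemma T_addr: "\<beta> \<in> code_words L D \<Longrightarrow> 0 < a \<beta>"
  "\<beta> \<in> code_words L D \<Longrightarrow> cells M0 (AcChild b) (a \<beta>) = (if \<beta> @ [b] \<in> code_words L D then a (\<beta> @ [b]) else 0)"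
  using T unfolding trie_def by blast+

lemma sa_pos: "s \<in> Pref D \<Longrightarrow> 0 < sa s"
proof -
  assume s: "s \<in> Pref D"
  then have "bits L s \<in> code_words L D" using bits_code_words[OF L_pos chars(1) chars_Pref[OF s]] by blast
  then show ?thesis using T_addr(1) a_\<nu>[OF s] by metis
qed

lemma sa_eq: "x \<in> Pref D \<Longrightarrow> y \<in> Pref D \<Longrightarrow> sa x = sa y \<longleftrightarrow> x = y"
proof -
  have "\<forall>q\<in>D. set q \<subseteq> {..<2 ^ L}" using chars(1) by blast
  from state_addr_trie(1)[OF T this]
  show "x \<in> Pref D \<Longrightarrow> y \<in> Pref D \<Longrightarrow> sa x = sa y \<longleftrightarrow> x = y" by (simp add: inj_on_def a_\<nu>) metis
qed

lemma bits_take: "bits L (take j p) = take (L * j) W"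
proof -
  have "take (L * j) (bits L q) = bits L (take j q)" for q
  proof (induction q arbitrary: j)
    case (Cons c q)
    then show ?case by (cases j) (simp_all add: take_add)
  qed simp
  then show ?thesis by simp
qed

lemma head_self: "s \<in> Pref D \<Longrightarrow> cells M0 OutHead (sa s) = sa s \<longleftrightarrow> s \<in> D"
proof -
  assume s: "s \<in> Pref D"
  have tP: "top_out D s \<in> Pref D" using longest(1)[of "insert [] D" s] by (auto simp: Pref_def)
  have "top_out D s = s \<and> s \<noteq> [] \<longleftrightarrow> s \<in> D"
    using longest_self[of s "insert [] D"] longest(1)[of "insert [] D" s] Nil_D by auto
  moreover have "cells M0 OutHead (sa s) = (if top_out D s = [] then 0 else sa (top_out D s))"
    using initial_outputs(1)[OF s] by (simp add: out_addr_def)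
  ultimately show ?thesis using sa_eq[OF tP s] sa_pos[OF s] by auto
qed

section \<open>Where the path of the deleted pattern is cut\<close>

definition forks :: "nat \<Rightarrow> bool" where
  "forks i \<longleftrightarrow> take i W @ [\<not> W ! i] \<in> code_words L D"

definition ends :: "nat \<Rightarrow> bool" where
  "ends i \<longleftrightarrow> L dvd i \<and> take (i div L) p \<in> D"

text \<open>A word through the other child does not belong to \<open>p\<close>, and a pattern ending
  before the end of \<open>W\<close> is shorter than \<open>p\<close>. Either way a pattern of
  \<open>D'\<close> keeps the vertex.\<close>

lemma alive:
  assumes "i < length W" "forks i \<or> ends i" shows "take i W \<in> code_words L D'"
  using assms(2)
proof
  assume "forks i"
  then obtain q where q: "q \<in> D" "prefix (take i W @ [\<not> W ! i]) (bits L q)" by (auto simp: forks_def code_words_def)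
  have "q \<noteq> p"
  proof
    assume "q = p"
    then have "prefix (take i W @ [\<not> W ! i]) W" using q(2) by simp
    then obtain r where "W = take i W @ [\<not> W ! i] @ r" by (auto simp: prefix_def)
    then have "W ! i = (take i W @ [\<not> W ! i] @ r) ! i" by metis
    then show False using assms(1) by (simp add: nth_append)
  qed
  then show ?thesis using q append_prefixD by (auto simp: code_words_def D')
next
  assume "ends i"
  then obtain j where i: "i = L * j" by (auto simp: ends_def)
  then have j: "i = L * j" "take j p \<in> D" using \<open>ends i\<close> by (simp_all add: ends_def)
  have "j < length p" using assms(1) j(1) by simp
  then have "take j p \<noteq> p" by (metis length_take min.absorb4 less_irrefl)
  then show ?thesis using j bits_take[of j] by (auto simp: code_words_def D' intro!: bexI[of _ "take j p"])
qed

text \<open>Consider the longest surviving prefix of \<open>W\<close>, of length \<open>l\<close>,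
  and a pattern of \<open>D'\<close> through it. The pattern ends there, deviates from
  \<open>W\<close> there, follows \<open>W\<close> one digit further or extends the whole of
  \<open>W\<close>. The four cases contradict the absence of ends, the absence of forks, the choice
  of \<open>l\<close> and the assumption \<open>leaf\<close>.\<close>

lemma dead:
  assumes i0: "\<And>i. i0 < i \<Longrightarrow> i < length W \<Longrightarrow> \<not> forks i \<and> \<not> ends i"
    and leaf: "\<And>b. W @ [b] \<notin> code_words L D" and i: "i0 < i" "i \<le> length W"
  shows "take i W \<notin> code_words L D'"
proof
  assume t: "take i W \<in> code_words L D'"
  define P where "P i \<longleftrightarrow> i \<le> length W \<and> take i W \<in> code_words L D'" for i
  have "P i" using t i by (simp add: P_def)
  define l where "l = Greatest P"
  have l: "P l" "i \<le> l" "\<not> P (Suc l)"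
    using GreatestI_nat[of P i "length W"] Greatest_le_nat[of P _ "length W"] \<open>P i\<close>
    by (auto simp: l_def P_def) (metis P_def Suc_n_not_le_n)
  have l': "l \<le> length W" "i0 < l" using l i by (auto simp: P_def)
  have "0 < length W" using len_p by simp
  then have ne: "take l W \<noteq> []" using l' by (metis length_greater_0_conv length_take min.absorb2 not_less_zero gr_zeroI)
  then obtain q where q: "q \<in> D'" "prefix (take l W) (bits L q)" using l(1) by (auto simp: P_def code_words_def)
  then obtain r where r: "bits L q = take l W @ r" by (auto simp: prefix_def)
  show False
  proof (cases r)
    case Nil
    have len: "l = L * length q" using r Nil l'(1) by (metis append_Nil2 length_bits length_take min.absorb2)
    then have "bits L q = bits L (take (length q) p)" using r Nil bits_take by simp
    then have "q = take (length q) p"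
      using bits_inj[OF L_pos, of q "take (length q) p" "[]" "[]"] chars(1)[of q] chars_Pref[OF take_Pref] q(1) by (auto simp: D')
    moreover have "length q < length p \<or> length q = length p" using len l'(1) by auto
    ultimately have "ends l" "l < length W" using len q(1) by (auto simp: ends_def D')
    then show False using i0[of l] l' by blast
  next
    case (Cons b r')
    then have pre: "take l W @ [b] \<in> code_words L D'" using q(1) r by (auto simp: code_words_def prefix_def)
    then have preD: "take l W @ [b] \<in> code_words L D" by (auto simp: code_words_def D')
    show False
    proof (cases "l = length W")
      case True
      then show False using leaf preD by simp
    next
      case False
      then have lt: "l < length W" using l'(1) by simp
      show False
      proof (cases "b = W ! l")
        case True
        then have "P (Suc l)" using pre lt by (simp add: P_def take_Suc_conv_app_nth)
        then show False using l(3) by simp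
      next
        case False
        then have "b = (\<not> W ! l)" by auto
        then have "forks l" using preD by (simp add: forks_def)
        then show False using i0[of l] l' lt by blast
      qed
    qed
  qed
qed

text \<open>The last vertex on the path of \<open>p\<close> that is known to survive, because another path branches off
  there or another pattern ends there.\<close>

definition cut_at :: "nat \<Rightarrow> nat \<Rightarrow> memory \<Rightarrow> bool" where
  "cut_at i i0 N \<longleftrightarrow> i0 \<le> i \<and> i0 < length W \<and> regs N rCut = a (take i0 W) \<and>
     regs N rBit = (if W ! i0 then 1 else 0) \<and> regs N rKeep = i0 div L \<and> take i0 W \<in> code_words L D' \<and>
     (\<forall>l. i0 < l \<and> l < i \<longrightarrow> \<not> forks l \<and> \<not> ends l)"

lemma run_set_cut:
  assumes i: "i < length W" "forks i \<or> ends i" and N: "regs N rCur = a (take i W)"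
    "odd (regs N rChr) = W ! i" "regs N rIdx = i div L"
  shows "run set_cut N (\<lambda>t N'. t = 4 \<and> keeps {rCut, rBit, rKeep} {} N N' \<and> cut_at i i N')"
  using alive[OF i] i N by (auto simp: set_cut_def keeps_def cut_at_def odd_iff_mod_2_eq_one)

text \<open>The probe detects forks only. The condition on \<open>ends i\<close> says that a pattern
  ending at \<open>i\<close> has already moved the cut to \<open>i\<close>.\<close>

lemma run_probe:
  assumes i: "i < length W" and c: "cut_at i i0 N" "i0 < i \<longrightarrow> \<not> ends i"
    and N: "regs N rCur = a (take i W)" "odd (regs N rChr) = W ! i" "regs N rIdx = i div L"
      "ac_children N = ac_children M0"
  shows "run (probe (W ! i)) N (\<lambda>t N'. t \<le> 7 \<and> keeps {rCut, rBit, rKeep, rCur} {} N N' \<and>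
    regs N' rCur = a (take (Suc i) W) \<and> (\<exists>i0. cut_at (Suc i) i0 N'))"
proof -
  let ?b = "W ! i"
  have chl: "cells N (AcChild b) = cells M0 (AcChild b)" for b using N(4) by metis
  have nx: "cells M0 (AcChild ?b) (a (take i W)) = a (take (Suc i) W)"
    using T_addr(2)[OF W_T, of ?b i] W_T[of "Suc i"] i by (simp add: take_Suc_conv_app_nth)
  have fk: "cells M0 (AcChild (\<not> ?b)) (a (take i W)) \<noteq> 0 \<longleftrightarrow> forks i"
    using T_addr(2)[OF W_T, of "\<not> ?b" i] T_addr(1)[of "take i W @ [\<not> ?b]"] by (auto simp: forks_def)
  show ?thesis
  proof (cases "forks i")
    case False
    have "cut_at (Suc i) i0 N" using c False unfolding cut_at_def by (auto simp: less_Suc_eq)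
    then have "cut_at (Suc i) i0 (N\<lparr>regs := (regs N)(rCur := a (take (Suc i) W))\<rparr>)" by (simp add: cut_at_def)
    then show ?thesis using fk False N(1) nx unfolding probe_def
      by (auto simp: chl keeps_def)
  next
    case True
    have "run set_cut N (\<lambda>t N'. t = 4 \<and> keeps {rCut, rBit, rKeep} {} N N' \<and> cut_at i i N')"
      by (rule run_set_cut[OF i _ N(1-3)]) (use True in simp)
    then have "run set_cut N (\<lambda>t N'. t = 4 \<and> keeps {rCut, rBit, rKeep} {} N N' \<and> cut_at (Suc i) i N')"
      by (rule run_mono) (auto simp: cut_at_def less_Suc_eq)
    then show ?thesis using fk True N(1) nx unfolding probe_def
      apply (simp add: chl)
      apply (erule run_mono)
      subgoal for t N'
        by (auto simp: keeps_def chl cut_at_def intro!: exI[of _ i])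
      done
  qed
qed

text \<open>Patterns end only at multiples of \<open>L\<close>, so one test before the first digit
  suffices; inside a code only forks can move the cut.\<close>

lemma run_locate_char:
  assumes j: "j < length p" and c: "cut_at (L * j) i0 N" and W: "regs N Width = L"
    and N: "regs N rCur = a (take (L * j) W)" "regs N rChr = p ! j" "regs N rIdx = j"
      "ac_children N = ac_children M0" "cells N OutHead = cells M0 OutHead"
  shows "run locate_char N (\<lambda>t N'. t \<le> 15 * L + 10 \<and> keeps {rCut, rBit, rKeep, rCur, rChr, rCnt} {} N N' \<and>
    regs N' rCur = a (take (L * Suc j) W) \<and> (\<exists>i0. cut_at (L * Suc j) i0 N'))"
proof -
  let ?K = "keeps {rCut, rBit, rKeep, rCur, rChr, rCnt} {}"
  let ?i = "\<lambda>n. L * j + (L - n)"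
  have Wp: "W = take (L * j) W @ code L (p ! j) @ bits L (drop (Suc j) p)"
  proof -
    have "p = take j p @ p ! j # drop (Suc j) p" using id_take_nth_drop[OF j] .
    then have "W = bits L (take j p @ p ! j # drop (Suc j) p)" by (rule arg_cong)
    also have "\<dots> = take (L * j) W @ code L (p ! j) @ bits L (drop (Suc j) p)" by (simp add: bits_take)
    finally show ?thesis .
  qed
  have lW: "L * Suc j \<le> length W" using mult_le_mono2[OF Suc_leI[OF j], of L] by simp
  have lt: "length (take (L * j) W) = L * j" using lW by simp
  have Wi: "W ! ?i n = code L (p ! j) ! (L - n)" if "0 < n" "n \<le> L" for n
  proof -
    have nth: "(X @ Y @ Z) ! (length X + m) = Y ! m" if "m < length Y" for X Y Z :: "bool list" and m
      using that by (simp add: nth_append)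
    have "W ! ?i n = (take (L * j) W @ code L (p ! j) @ bits L (drop (Suc j) p)) ! ?i n"
      by (rule arg_cong[OF Wp])
    then show ?thesis using nth[of "L - n" "code L (p ! j)" "take (L * j) W"] that unfolding lt by simp
  qed
  have iW: "?i n < length W" if "0 < n" "n \<le> L" for n
  proof -
    have "?i n < L * Suc j" using that by simp
    then show ?thesis using lW by linarith
  qed
  have idx: "?i n div L = j" if "0 < n" "n \<le> L" for n
  proof -
    define m where "m = L - n"
    then have "m < L" using that by simp
    then show ?thesis unfolding m_def[symmetric] by simp
  qed
  define I where "I n t N' \<longleftrightarrow> n = regs N' rCnt \<and> n \<le> L \<and> t + 15 * n \<le> 15 * L \<and> ?K N N' \<and>
     regs N' rCur = a (take (?i n) W) \<and> drop (L - n) (code L (p ! j)) = code n (regs N' rChr) \<and>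
     (\<exists>i0. cut_at (?i n) i0 N' \<and> (0 < n \<longrightarrow> i0 < ?i n \<longrightarrow> \<not> ends (?i n)))" for n t N'
  have step: "run (block [Cond (Equal (Parity (Var rChr)) (Num 0)) (probe False) (probe True),
       Assign rChr (Half (Var rChr)), Assign rCnt (Decr (Var rCnt))]) N' (\<lambda>u N''. \<exists>n'<n. I n' (t + u + 1) N'')"
    if I: "I n t N'" and pos: "0 < regs N' rCnt" for n t N'
  proof -
    from I pos obtain k where k: "n = Suc k" "regs N' rCnt = Suc k" unfolding I_def by (metis Suc_pred)
    from I obtain i0 where ct: "cut_at (?i n) i0 N'" "i0 < ?i n \<longrightarrow> \<not> ends (?i n)" unfolding I_def using k by auto
    have nL: "n \<le> L" and tt: "t + 15 * n \<le> 15 * L" and kp: "?K N N'" and cur: "regs N' rCur = a (take (?i n) W)"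
      and dr: "drop (L - n) (code L (p ! j)) = code n (regs N' rChr)" using I unfolding I_def by blast+
    have n0: "0 < n" using k by simp
    have "code L (p ! j) ! (L - n) = hd (drop (L - n) (code L (p ! j)))" using nL n0 by (simp add: hd_drop_conv_nth)
    then have od: "odd (regs N' rChr) = W ! ?i n" using Wi[OF n0 nL] dr k by (simp add: code_Suc)
    have "drop (L - k) (code L (p ! j)) = tl (drop (L - n) (code L (p ! j)))"
    proof -
      have "L - k = Suc (L - n)" using k nL by simp
      then show ?thesis by (simp only: drop_Suc tl_drop)
    qed
    then have dr': "drop (L - k) (code L (p ! j)) = code k (regs N' rChr div 2)" using dr k by (simp add: code_Suc)
    have ik: "?i k = Suc (?i n)" using k nL by simp
    have id: "regs N' rIdx = ?i n div L" "ac_children N' = ac_children M0"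
      using kp N idx[OF n0 nL] by (auto simp: keeps_def)
    have "run (probe (W ! ?i n)) N' (\<lambda>u N''. run (block [Assign rChr (Half (Var rChr)), Assign rCnt (Decr (Var rCnt))]) N''
        (\<lambda>v N3. \<exists>n'<n. I n' (t + (u + 1 + v) + 1) N3))"
      using run_probe[OF iW[OF n0 nL] ct cur od id]
    proof (rule run_mono, elim conjE exE)
      fix u :: nat and N'' i1
      assume u: "u \<le> 7" "keeps {rCut, rBit, rKeep, rCur} {} N' N''" "regs N'' rCur = a (take (Suc (?i n)) W)"
        "cut_at (Suc (?i n)) i1 N''"
      let ?M = "N''\<lparr>regs := (regs N'')(rChr := regs N' rChr div 2, rCnt := k)\<rparr>"
      have r: "regs N'' rChr = regs N' rChr" "regs N'' rCnt = Suc k" using u(2) k by (auto simp: keeps_def)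
      have "?K N ?M" using kp u(2) by (auto simp: keeps_def)
      moreover have "cut_at (?i k) i1 ?M" using u(4) ik by (simp add: cut_at_def)
      moreover have "\<not> ends (?i k)" if "0 < k"
      proof
        assume "ends (?i k)"
        then have "L dvd L * j + (L - k)" by (simp add: ends_def)
        then have "L dvd L - k" using dvd_add_right_iff[of L "L * j" "L - k"] by simp
        moreover have "0 < L - k" "L - k < L" using that k nL by auto
        ultimately show False by (meson nat_dvd_not_less)
      qed
      moreover have "t + (u + 1 + 3) + 1 + 15 * k \<le> 15 * L" using tt u(1) k by simp
      ultimately have "I k (t + (u + 1 + 3) + 1) ?M" unfolding I_def using u(3) ik dr' nL k by auto
      then have "\<exists>n'<n. I n' (t + (u + 1 + 3) + 1) ?M" using k by blast
      then show "run (block [Assign rChr (Half (Var rChr)), Assign rCnt (Decr (Var rCnt))]) N''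
        (\<lambda>v N3. \<exists>n'<n. I n' (t + (u + 1 + v) + 1) N3)" using r by (simp add: numeral_3_eq_3)
    qed
    moreover have "(if bval (Equal (Parity (Var rChr)) (Num 0)) N' then probe False else probe True) = probe (W ! ?i n)"
      using od by (auto simp: odd_iff_mod_2_eq_one)
    ultimately show ?thesis
      by (simp only: block.simps run_Seq run_Cond)
  qed
  have start: "run (Cond (Equal (Cell OutHead (Var rCur)) (Var rCur)) set_cut Skip) N
     (\<lambda>t N'. t \<le> 5 \<and> keeps {rCut, rBit, rKeep} {} N N' \<and>
       (\<exists>i0. cut_at (L * j) i0 N' \<and> (i0 < L * j \<longrightarrow> \<not> ends (L * j))))"
  proof -
    have cs: "regs N rCur = sa (take j p)" using N(1) bits_take[of j] a_\<nu>[OF take_Pref[of j]] by simp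
    have "cells N OutHead (regs N rCur) = regs N rCur \<longleftrightarrow> take j p \<in> D"
      using head_self[OF take_Pref] N(5) cs by simp
    then have e: "cells N OutHead (regs N rCur) = regs N rCur \<longleftrightarrow> ends (L * j)" by (simp add: ends_def)
    have i: "L * j < length W" using j by simp
    have o: "odd (regs N rChr) = W ! (L * j)"
    proof -
      obtain m where "L = Suc m" using L_pos gr0_implies_Suc by blast
      then show ?thesis using Wi[of L] N(2) by (simp add: code_Suc)
    qed
    show ?thesis
    proof (cases "ends (L * j)")
      case True
      have "run set_cut N (\<lambda>t N'. t = 4 \<and> keeps {rCut, rBit, rKeep} {} N N' \<and> cut_at (L * j) (L * j) N')"
        by (rule run_set_cut[OF i _ N(1) o]) (use True N(3) in simp_all)
      then show ?thesis using e True by simp (erule run_mono, auto)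
    next
      case False
      then show ?thesis using e c by auto
    qed
  qed
  show ?thesis unfolding locate_char_def
    apply (simp only: block.simps run_Seq run_Assign run_Skip)
    apply (rule run_mono[OF start])
    apply (elim conjE exE)
    subgoal for t N' i1
      apply (rule run_while[where I = "\<lambda>n u. I n u" and n = L])
      subgoal
        using N W unfolding I_def by (auto simp: keeps_def cut_at_def intro!: exI[of _ i1])
      subgoal for n u N'' using step[of n u N''] by simp
      subgoal for n u N'' unfolding I_def by (auto simp: add.commute)
      done
    done
qed


text \<open>The null pointer is no address of a vertex, so it can encode that nothing is
  pruned.\<close>

definition located :: "memory \<Rightarrow> bool" where
  "located N \<longleftrightarrow> (regs N rKeep = length p \<and> regs N rCut = 0 \<and> W \<in> code_words L D') \<or>
     (\<exists>i0<length W. regs N rCut = a (take i0 W) \<and> regs N rBit = (if W ! i0 then 1 else 0) \<and>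
        regs N rKeep = i0 div L \<and> (\<forall>i\<le>length W. take i W \<in> code_words L D' \<longleftrightarrow> i \<le> i0))"

lemma code_words_closed: "\<beta> @ \<gamma> \<in> code_words L E \<Longrightarrow> \<beta> \<in> code_words L E"
  by (auto simp: code_words_def dest: append_prefixD)

lemma code_words_take: "take i \<beta> \<in> code_words L E \<Longrightarrow> j \<le> i \<Longrightarrow> take j \<beta> \<in> code_words L E"
proof -
  assume "take i \<beta> \<in> code_words L E" "j \<le> i"
  then have "take j \<beta> @ drop j (take i \<beta>) \<in> code_words L E"
    by (metis append_take_drop_id min.absorb1 take_take)
  then show ?thesis by (rule code_words_closed)
qed

lemma code_words_removed:
  assumes "\<beta> \<in> code_words L D" "\<beta> \<notin> code_words L D'"
  shows "\<exists>i\<le>length W. \<beta> = take i W"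
proof -
  have "prefix \<beta> W" using assms by (auto simp: code_words_def D')
  then show ?thesis by (metis append_eq_conv_conj prefix_def prefix_length_le)
qed

lemma code_words_sub: "code_words L D' \<subseteq> code_words L D"
  by (auto simp: code_words_def D')

lemma take_Pref_D': "take j p \<in> Pref D' \<longleftrightarrow> take (L * j) W \<in> code_words L D'"
proof -
  have "set q \<subseteq> {..<2 ^ L}" if "q \<in> D'" for q using chars(1) that by (simp add: D')
  then show ?thesis using bits_code_words[OF L_pos, of D' "take j p"] chars_Pref[OF take_Pref] bits_take by metis
qed

text \<open>The state of length \<open>j\<close> is the vertex at depth \<open>L * j\<close>;
  dividing the depth of the last surviving vertex by \<open>L\<close> yields the length of the
  longest surviving prefix.\<close>

lemma located_keep:
  assumes "located N"
  shows "regs N rKeep \<le> length p" "\<And>j. j \<le> length p \<Longrightarrow> take j p \<in> Pref D' \<longleftrightarrow> j \<le> regs N rKeep"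
proof -
  from assms consider (all) "regs N rKeep = length p" "W \<in> code_words L D'"
    | (some) i0 where "i0 < length W" "regs N rKeep = i0 div L"
        "\<forall>i\<le>length W. take i W \<in> code_words L D' \<longleftrightarrow> i \<le> i0"
    unfolding located_def by blast
  then have "regs N rKeep \<le> length p \<and> (\<forall>j\<le>length p. take j p \<in> Pref D' \<longleftrightarrow> j \<le> regs N rKeep)"
  proof cases
    case all
    have "take (L * j) W \<in> code_words L D'" if "j \<le> length p" for j
      using code_words_take[of "length W" W D' "L * j"] all(2) that by simp
    then show ?thesis using all(1) take_Pref_D' by simp
  next
    case some
    have "i0 div L \<le> length p" using some(1) by (metis length_bits less_imp_le_nat less_mult_imp_div_less mult.commute)
    moreover have "take j p \<in> Pref D' \<longleftrightarrow> j \<le> i0 div L" if j: "j \<le> length p" for j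
    proof -
      have "L * j \<le> length W" using j by simp
      then have "take j p \<in> Pref D' \<longleftrightarrow> L * j \<le> i0" using some(3) take_Pref_D' by simp
      then show ?thesis using less_eq_div_iff_mult_less_eq[OF L_pos, of j i0] by (simp add: mult.commute)
    qed
    ultimately show ?thesis using some(2) by simp
  qed
  then show "regs N rKeep \<le> length p" "\<And>j. j \<le> length p \<Longrightarrow> take j p \<in> Pref D' \<longleftrightarrow> j \<le> regs N rKeep" by auto
qed

lemma run_locate:
  "run locate M0 (\<lambda>t N. t \<le> 40 * L * length p + 20 \<and>
     keeps {rCur, rIdx, rCut, rBit, rKeep, rChr, rCnt} {aState} M0 N \<and>
     (\<forall>i\<le>length p. cells N aState i = sa (take i p)) \<and> located N)"
proof -
  let ?K = "keeps {rCur, rIdx, rCut, rBit, rKeep, rChr, rCnt} {aState} M0"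
  define I where "I n t N \<longleftrightarrow> n + regs N rIdx = length p \<and> t \<le> 40 * L * regs N rIdx \<and> ?K N \<and>
     regs N rCur = a (take (L * regs N rIdx) W) \<and> (\<exists>i0. cut_at (L * regs N rIdx) i0 N) \<and>
     (\<forall>i\<le>regs N rIdx. cells N aState i = sa (take i p))" for n t N
  have root: "a [] = sa []" using a_\<nu>[of "[]"] by simp
  have W0: "W ! 0 = odd (p ! 0)"
  proof -
    obtain c q where "p = c # q" using p_ne by (cases p) auto
    moreover obtain m where "L = Suc m" using L_pos gr0_implies_Suc by blast
    ultimately show ?thesis by (simp add: code_Suc)
  qed
  have Wpos: "0 < length W" using len_p by simp
  let ?step = "block [Assign rChr (Cell Pat (Var rIdx)), locate_char, Assign rIdx (Incr (Var rIdx)),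
       Store aState (Var rIdx) (Var rCur)]"
  have step: "run ?step N (\<lambda>u N'. \<exists>n'<n. I n' (t + u + 1) N')"
    if I: "I n t N" and jl: "regs N rIdx < length p" for n t N
  proof -
    define j where "j = regs N rIdx"
    then have ji: "regs N rIdx = j" by simp
    from I obtain i0 where kN: "?K N" and tt: "t \<le> 40 * L * j" and n: "n + j = length p"
      and cur: "regs N rCur = a (take (L * j) W)" and ct: "cut_at (L * j) i0 N"
      and st: "\<forall>i\<le>j. cells N aState i = sa (take i p)" unfolding I_def j_def by blast
    obtain k where k: "n = Suc k" using n jl ji by (cases n) auto
    have bN: "base N" by (rule base_keeps[OF base_M0 kN]) auto
    have jl': "j < length p" using jl ji by simp
    let ?N = "N\<lparr>regs := (regs N)(rChr := p ! j)\<rparr>"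
    have c: "cut_at (L * j) i0 ?N" using ct by (simp add: cut_at_def)
    have m: "regs ?N Width = L" "regs ?N rCur = a (take (L * j) W)" "regs ?N rChr = p ! j" "regs ?N rIdx = j"
      "cells ?N OutHead = cells M0 OutHead" using base_regs(2)[OF bN] cur ji kN by (simp_all add: keeps_def)
    have chl: "ac_children ?N = ac_children M0" using kN by (simp add: keeps_def)
    have "run locate_char ?N (\<lambda>u N'. \<exists>n'<n. I n' (t + (1 + (u + 3)) + 1)
       (N'\<lparr>regs := (regs N')(rIdx := Suc j), cells := (cells N')(aState := (cells N' aState)(Suc j := regs N' rCur))\<rparr>) \<and> regs N' rIdx = j)"
      using run_locate_char[OF jl' c m(1-4) chl m(5)]
    proof (rule run_mono, elim conjE exE)
      fix u :: nat and N' i1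
      assume u: "u \<le> 15 * L + 10" "keeps {rCut, rBit, rKeep, rCur, rChr, rCnt} {} ?N N'"
        "regs N' rCur = a (take (L * Suc j) W)" "cut_at (L * Suc j) i1 N'"
      let ?M = "N'\<lparr>regs := (regs N')(rIdx := Suc j), cells := (cells N')(aState := (cells N' aState)(Suc j := regs N' rCur))\<rparr>"
      have "?K ?M" using kN u(2) by (auto simp: keeps_def)
      moreover have "\<forall>i\<le>Suc j. cells ?M aState i = sa (take i p)"
        using st u(2,3) bits_take[of "Suc j"] a_\<nu>[OF take_Pref[of "Suc j"]] by (auto simp: keeps_def le_Suc_eq)
      moreover have "cut_at (L * Suc j) i1 ?M" using u(4) by (simp add: cut_at_def)
      moreover have "t + (1 + (u + 3)) + 1 \<le> 40 * L * Suc j"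
      proof -
        have "40 * L * Suc j = 40 * L * j + 40 * L" by simp
        then show ?thesis using tt u(1) Suc_leI[OF L_pos] by linarith
      qed
      ultimately have "I k (t + (1 + (u + 3)) + 1) ?M" unfolding I_def using n k u(3) by auto
      then show "\<exists>n'<n. I n' (t + (1 + (u + 3)) + 1) ?M \<and> regs N' rIdx = j"
        using k u(2) ji by (auto simp: keeps_def)
    qed
    moreover have "cells N Pat j = p ! j" using base_regs(5)[OF bN jl'] .
    ultimately show ?thesis using ji
      by (simp add: numeral_3_eq_3) (erule run_mono, auto)
  qed
  let ?last = "Cond (Conj (Equal (Cell (AcChild False) (Var rCur)) (Num 0)) (Equal (Cell (AcChild True) (Var rCur)) (Num 0)))
       Skip (block [Assign rKeep (Var PatLen), Assign rCut (Num 0)])"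
  \<comment> \<open>Either the vertex of \<open>p\<close> is a leaf and \<open>dead\<close> applies
    beyond the recorded cut, or a child belongs to another pattern, which keeps all of
    \<open>W\<close> alive.\<close>
  have last: "run ?last N (\<lambda>t N'. t \<le> 4 \<and> ?K N' \<and> (\<forall>i\<le>length p. cells N' aState i = sa (take i p)) \<and> located N')"
    if kN: "?K N" and cur: "regs N rCur = a W" and ct: "cut_at (length W) i0 N"
      and st: "\<forall>i\<le>length p. cells N aState i = sa (take i p)" for N i0
  proof -
    have bN: "base N" by (rule base_keeps[OF base_M0 kN]) auto
    have chl: "cells N (AcChild b) (regs N rCur) = 0 \<longleftrightarrow> W @ [b] \<notin> code_words L D" for b
      using kN cur T_addr(2)[of W b] T_addr(1)[of "W @ [b]"] W_T[of "length W"] by (auto simp: keeps_def)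
    show ?thesis
    proof (cases "\<forall>b. W @ [b] \<notin> code_words L D")
      case True
      have "take i W \<in> code_words L D' \<longleftrightarrow> i \<le> i0" if i: "i \<le> length W" for i
      proof (cases "i \<le> i0")
        case le: True
        then show ?thesis using code_words_take[of i0 W D' i] ct by (auto simp: cut_at_def)
      next
        case False
        then have "take i W \<notin> code_words L D'"
          using dead[of i0 i] ct True i by (auto simp: cut_at_def)
        then show ?thesis using False by simp
      qed
      then have "located N" using ct unfolding located_def cut_at_def by blast
      then show ?thesis using True chl kN st by simp
    next
      case False
      then obtain b where b: "W @ [b] \<in> code_words L D" by blast
      then obtain q where q: "q \<in> D" "prefix (W @ [b]) (bits L q)" by (auto simp: code_words_def)
      then have "q \<noteq> p" by (auto dest: prefix_length_le)
      then have "W \<in> code_words L D'" using q append_prefixD by (auto simp: code_words_def D')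
      then have loc: "located (N\<lparr>regs := (regs N)(rKeep := length p, rCut := 0)\<rparr>)" by (simp add: located_def)
      have "cells N (AcChild False) (regs N rCur) \<noteq> 0 \<or> cells N (AcChild True) (regs N rCur) \<noteq> 0"
        using b chl by (cases b) auto
      then show ?thesis using loc kN st base_regs(1)[OF bN] by (auto simp: keeps_def)
    qed
  qed
  show ?thesis unfolding locate_def
    apply (simp only: block.simps run_Seq run_Assign run_Store)
    apply (rule run_while[where I = I and n = "length p"])
    subgoal
    proof -
      have "cut_at 0 0 N" if "regs N rCut = sa []" "regs N rBit = p ! 0 mod 2" "regs N rKeep = 0" for N
        using that root W0 Wpos W_T[of 0]
        by (auto simp: cut_at_def odd_iff_mod_2_eq_one code_words_def)
      then show ?thesis unfolding I_def using base_regs(3,5)[OF base_M0] len_p root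
        by (auto simp: keeps_def intro!: exI[of _ 0])
    qed
    subgoal for n t N
    proof -
      assume I: "I n t N" "bval (Less (Var rIdx) (Var PatLen)) N"
      then have "base N" unfolding I_def by (auto intro: base_keeps[OF base_M0])
      then show ?thesis using step[OF I(1)] I(2) base_regs(1) by simp
    qed
    subgoal for n t N
    proof -
      assume I: "I n t N" "\<not> bval (Less (Var rIdx) (Var PatLen)) N"
      then have "base N" unfolding I_def by (auto intro: base_keeps[OF base_M0])
      then have i: "regs N rIdx = length p" using I base_regs(1) by (auto simp: I_def)
      then obtain i0 where "?K N" "regs N rCur = a W" "cut_at (length W) i0 N"
        "\<forall>i\<le>length p. cells N aState i = sa (take i p)" "t \<le> 40 * L * length p" using I(1) unfolding I_def by auto
      from last[OF this(1-4)] this(5) show ?thesis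
        by (auto elim!: run_mono)
    qed
    done
qed

section \<open>Failure links and outputs after a deletion\<close>

lemma StateOf_eq:
  assumes "cells N StateOf = cells M0 StateOf" "s \<in> Pref D" "Z \<subseteq> reps D"
  shows "sa s \<in> cells N StateOf ` nd ` Z \<longleftrightarrow> s \<in> Z"
proof
  assume "sa s \<in> cells N StateOf ` nd ` Z"
  then obtain z where z: "z \<in> Z" "sa s = cells M0 StateOf (nd z)" using assms(1) by auto
  then have "sa s = (if z \<in> Pref D then sa z else 0)" using StateOf_M0[of z] assms(3) by auto
  then have "z \<in> Pref D" "sa s = sa z" using sa_pos[OF assms(2)] by (auto split: if_splits)
  then show "s \<in> Z" using sa_eq assms(2) z(1) by blast
next
  assume "s \<in> Z"
  then show "sa s \<in> cells N StateOf ` nd ` Z" using StateOf_M0[OF Pref_reps[OF assms(2)]] assms(1,2)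
    by (auto simp: image_iff intro!: bexI[of _ s])
qed

lemma md_states:
  assumes "base N" "cells N StateOf = cells M0 StateOf"
  shows "marked_dawg D (Pref D) nd (cells N StateOf) (children N)"
proof (rule marked_dawgI[OF _ _ assms(1)])
  show "Pref D \<subseteq> reps D" using Pref_reps by blast
  show "cells N StateOf (nd z) \<noteq> 0 \<longleftrightarrow> z \<in> Pref D" if "z \<in> reps D" for z
    using StateOf_M0[OF that] assms(2) sa_pos by auto
qed simp

text \<open>The invariant describes the current links as longest suffixes among the remaining
  states; \<open>remaining_step\<close> is the step of the loop and \<open>remaining_all\<close> its
  end. Every removed prefix is charged 30 steps and 72 for each state linked to it, so
  \<open>redirected_sum\<close> yields \<open>102 * length p + 72 * u_f D D'\<close>.\<close>

lemma run_relink_removed: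
  assumes b: "base N0" and loc: "located N0" and st: "\<forall>i\<le>length p. cells N0 aState i = sa (take i p)"
    and same: "cells N0 StateOf = cells M0 StateOf" "cells N0 NodeOf = cells M0 NodeOf" "cells N0 Flink = cells M0 Flink"
  shows "run relink_removed N0 (\<lambda>t N. t \<le> 172 * length p + 72 * u_f D D' + 3 \<and>
     keeps {rIdx, rTo, rTop, rNod, rSta, rPtr, rNum} {aStack, Flink} N0 N \<and>
     (\<forall>s\<in>Pref D'. s \<noteq> [] \<longrightarrow> cells N Flink (sa s) = sa (flink D' s)))"
proof -
  define K where "K = regs N0 rKeep"
  note kp = located_keep[OF loc, folded K_def]
  let ?K = "keeps {rIdx, rTo, rTop, rNod, rSta, rPtr, rNum} {aStack, Flink} N0"
  let ?N = "\<lambda>j. {s \<in> Pref D. s \<noteq> [] \<and> flink D s = take j p}"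
  let ?w = "\<lambda>j. 30 + 72 * card (?N j)"
  let ?A = "remaining D p K"
  define I where "I n t N \<longleftrightarrow> n + regs N rIdx = length p \<and> K \<le> regs N rIdx \<and> ?K N \<and>
     t \<le> (\<Sum>j\<in>{K<..regs N rIdx}. ?w j) \<and>
     (\<forall>s\<in>Pref D. s \<noteq> [] \<longrightarrow> cells N Flink (sa s) = sa (longest (?A (regs N rIdx)) (tl s)))" for n t N
  have step: "run (block [Assign rIdx (Incr (Var rIdx)), Assign rNod (Cell NodeOf (Cell aState (Var rIdx))),
       Assign rTo (Cell Flink (Cell aState (Var rIdx))), relink_children]) N (\<lambda>u N'. \<exists>n'<n. I n' (t + u + 1) N')"
    if I: "I n t N" and jl: "regs N rIdx < length p" for n t N
  proof -
    define j where "j = regs N rIdx"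
    then have ji: "regs N rIdx = j" by simp
    have kN: "?K N" and tt: "t \<le> (\<Sum>j\<in>{K<..j}. ?w j)" and n: "n + j = length p" and Kj: "K \<le> j"
      and fl: "\<And>s. s \<in> Pref D \<Longrightarrow> s \<noteq> [] \<Longrightarrow> cells N Flink (sa s) = sa (longest (?A j) (tl s))"
      using I unfolding I_def j_def by blast+
    obtain k where k: "n = Suc k" using n jl ji by (cases n) auto
    let ?x = "take (Suc j) p"
    have jl': "j < length p" using jl ji by simp
    have x: "?x \<noteq> []" using p_ne by simp
    have sx: "cells N aState (Suc j) = sa ?x" using st kN jl' by (simp add: keeps_def)
    have nx: "cells N NodeOf (sa ?x) = nd ?x" using NodeOf_M0[OF take_Pref] same(2) kN by (simp add: keeps_def)
    \<comment> \<open>The link of the removed state at this moment and not its original one; this is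
      the value that \<open>remaining_step\<close> asks for.\<close>
    have fx: "cells N Flink (sa ?x) = sa (longest (?A j) (tl ?x))" using fl[OF take_Pref x] .
    let ?M = "N\<lparr>regs := (regs N)(rIdx := Suc j, rNod := nd ?x, rTo := sa (longest (?A j) (tl ?x)))\<rparr>"
    have kM: "?K ?M" using kN by (auto simp: keeps_def)
    have bM: "base ?M" by (rule base_keeps[OF b kM]) auto
    have sM: "cells ?M StateOf = cells M0 StateOf" using same(1) kN by (simp add: keeps_def)
    have xr: "?x \<in> reps D" by (rule Pref_reps[OF take_Pref])
    have rn: "regs ?M rNod = nd ?x" by simp
    have near: "reach True (reps D) (Pref D) ?x \<inter> Pref D = ?N (Suc j)" by (rule near_states[OF take_Pref])
    have "run relink_children ?M (\<lambda>u N'. \<exists>n'<n. I n' (t + (3 + (u + 1)) + 1) N')"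
      using run_relink_children[OF md_states[OF bM sM] xr rn, unfolded near]
    proof (rule run_mono, elim conjE)
      fix u :: nat and N'
      assume u: "u \<le> 10 + 72 * card (?N (Suc j))" "keeps {rTop, rNod, rSta, rPtr, rNum} {aStack, Flink} ?M N'"
        and F: "cells N' Flink = (\<lambda>s. if s \<noteq> 0 \<and> s \<in> cells ?M StateOf ` nd ` reach True (reps D) (Pref D) ?x
           then regs ?M rTo else cells ?M Flink s)"
      have "{K<..Suc j} = insert (Suc j) {K<..j}" using Kj by auto
      then have "t + (3 + (u + 1)) + 1 \<le> (\<Sum>j\<in>{K<..Suc j}. ?w j)" using tt u(1) by simp
      moreover have "cells N' Flink (sa s) = sa (longest (?A (Suc j)) (tl s))" if s: "s \<in> Pref D" "s \<noteq> []" for s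
      proof -
        have "sa s \<in> cells ?M StateOf ` nd ` reach True (reps D) (Pref D) ?x \<longleftrightarrow> s \<in> reach True (reps D) (Pref D) ?x"
          by (rule StateOf_eq[OF sM s(1)]) (auto simp: reach_def)
        also have "\<dots> \<longleftrightarrow> flink D s = ?x" using near s by blast
        finally have "cells N' Flink (sa s) = (if flink D s = ?x then sa (longest (?A j) (tl ?x)) else sa (longest (?A j) (tl s)))"
          using F sa_pos[OF s(1)] fl[OF s] by simp
        then show ?thesis using remaining_step[OF pD p_ne Kj jl' s(2)] by simp
      qed
      moreover have "?K N'" "regs N' rIdx = Suc j" using kM u(2) by (auto simp: keeps_def)
      ultimately have "I k (t + (3 + (u + 1)) + 1) N'" unfolding I_def using n k Kj by simp
      then show "\<exists>n'<n. I n' (t + (3 + (u + 1)) + 1) N'" using k by auto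
    qed
    then show ?thesis using ji sx nx fx
      by (simp add: numeral_3_eq_3)
  qed
  show ?thesis unfolding relink_removed_def
    apply (simp only: block.simps run_Seq run_Assign run_Skip)
    apply (rule run_while[where I = I and n = "length p - K"])
    subgoal
    proof -
      have "?A K = Pref D" by (auto simp: remaining_def)
      moreover have "cells M0 Flink (sa s) = sa (longest (Pref D) (tl s))" if "s \<in> Pref D" "s \<noteq> []" for s
        using ac that by (simp add: represents_ac_def flink_longest)
      ultimately show ?thesis unfolding I_def using kp(1) same(3) by (simp add: keeps_def K_def)
    qed
    subgoal for n t N
    proof -
      assume I: "I n t N" "bval (Less (Var rIdx) (Var PatLen)) N"
      then have "base N" unfolding I_def by (auto intro: base_keeps[OF b])
      then show ?thesis using step[OF I(1)] I(2) base_regs(1) by simp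
    qed
    subgoal for n t N
    proof -
      assume I: "I n t N" "\<not> bval (Less (Var rIdx) (Var PatLen)) N"
      then have "base N" unfolding I_def by (auto intro: base_keeps[OF b])
      then have i: "regs N rIdx = length p" using I base_regs(1) by (auto simp: I_def)
      then have kN: "?K N" and tt: "t \<le> (\<Sum>j\<in>{K<..length p}. ?w j)"
        and fl: "\<And>s. s \<in> Pref D \<Longrightarrow> s \<noteq> [] \<Longrightarrow> cells N Flink (sa s) = sa (longest (?A (length p)) (tl s))"
        using I(1) unfolding I_def by auto
      have A: "?A (length p) = Pref D'" using remaining_all[OF pD, of K] kp(2) by (simp add: D')
      have "(\<Sum>j\<in>{K<..length p}. ?w j) = 30 * (length p - K) + 72 * (\<Sum>j\<in>{K<..length p}. card (?N j))"
        unfolding sum.distrib sum_distrib_left[symmetric] by simp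
      also have "(\<Sum>j\<in>{K<..length p}. card (?N j)) \<le> u_f D D' + length p"
        unfolding D' by (rule redirected_sum[OF fin]) (use kp(2) in \<open>auto simp: D'\<close>)
      finally have "t \<le> 102 * length p + 72 * u_f D D'" using tt by simp
      moreover have "cells N Flink (sa s) = sa (flink D' s)" if "s \<in> Pref D'" "s \<noteq> []" for s
        using fl[OF Pref_D'_sub[OF that(1)] that(2)] that(2) A by (simp add: flink_longest)
      ultimately show ?thesis using kN by (auto simp: keeps_def)
    qed
    done
qed

text \<open>\<open>top_out_insert\<close> is read backwards, with \<open>D\<close> arising from
  \<open>D'\<close> by adding \<open>p\<close>: pointers to \<open>p\<close> are replaced by the
  successor of \<open>p\<close>, which is the longest output of \<open>p\<close> in
  \<open>D'\<close>. A state whose head is \<open>p\<close> has \<open>p\<close> as a suffix, so all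
  pointers concerned are found below the node of \<open>p\<close>.\<close>

lemma run_retract:
  assumes b: "base N" and st: "cells N aState (length p) = sa p"
    and same: "cells N StateOf = cells M0 StateOf" "cells N NodeOf = cells M0 NodeOf"
      "cells N OutHead = cells M0 OutHead" "cells N OutNext = cells M0 OutNext"
  shows "run retract N (\<lambda>t N'. t \<le> 80 + 60 * u_o D D' \<and>
     keeps {rFrom, rTo, rLast, rTop, rNod, rSta, rPtr, rNum} {aStack, OutHead, OutNext} N N' \<and>
     (\<forall>s\<in>Pref D'. cells N' OutHead (sa s) = out_addr \<nu> (top_out D' s)) \<and>
     (\<forall>q\<in>D'. cells N' OutNext (sa q) = out_addr \<nu> (top_out D' (tl q))))"
proof -
  let ?h = "out_addr \<nu> (top_out D (tl p))"
  let ?M = "N\<lparr>regs := (regs N)(rFrom := sa p, rTo := ?h, rLast := nd p)\<rparr>"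
  have kM: "keeps {rFrom, rTo, rLast} {} N ?M" by (auto simp: keeps_def)
  have bM: "base ?M" by (rule base_keeps[OF b kM]) auto
  have sM: "cells ?M StateOf = cells M0 StateOf" using same(1) by simp
  have rl: "regs ?M rLast = nd p" by simp
  have tP: "top_out D s \<in> Pref D" for s using longest(1)[of "insert [] D" s] by (auto simp: Pref_def)
  have oa: "out_addr \<nu> (top_out D s) = sa p \<longleftrightarrow> top_out D s = p" for s
    using sa_eq[OF tP p_Pref] sa_pos[OF p_Pref] p_ne by (auto simp: out_addr_def)
  note ti = top_out_insert[OF D_insert(2) p_ne, folded D_insert(1)]
  have nptl: "\<not> suffix p (tl p)" using p_ne by (auto simp: suffix_tl_iff)
  have h: "top_out D (tl p) = top_out D' p"
    using ti[of "tl p"] nptl longest_tl[of "insert [] D'" p] D_insert(2) p_ne by simp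
  have np: "top_out D' s \<noteq> p" for s using longest(1)[of "insert [] D'" s] D_insert(2) p_ne by auto
  have tD': "top_out D' s = (if top_out D s = p then top_out D (tl p) else top_out D s)" for s
    using ti[of s] np[of s] h by auto
  have tp: "suffix p s" if "top_out D s = p" for s using longest(2)[of "insert [] D" s] that by auto
  have mem: "sa s \<in> cells ?M StateOf ` nd ` {y \<in> reps D. suffix p y} \<longleftrightarrow> suffix p s" if "s \<in> Pref D" for s
    using StateOf_eq[OF sM that, of "{y \<in> reps D. suffix p y}"] Pref_reps[OF that] by auto
  \<comment> \<open>The state \<open>p\<close> may disappear and escape \<open>u_o\<close>; its 60
    steps go into the additive constant.\<close>
  have card: "card ({y. suffix p y} \<inter> Pref D) \<le> Suc (u_o D D')"
  proof -
    have "{y. suffix p y} \<inter> Pref D = {s \<in> Pref D. suffix p s}" by auto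
    then show ?thesis using u_o_delete[OF pD fin] by (simp only: D')
  qed
  let ?Q = "\<lambda>N'. keeps {rFrom, rTo, rLast, rTop, rNod, rSta, rPtr, rNum} {aStack, OutHead, OutNext} N N' \<and>
     (\<forall>s\<in>Pref D'. cells N' OutHead (sa s) = out_addr \<nu> (top_out D' s)) \<and>
     (\<forall>q\<in>D'. cells N' OutNext (sa q) = out_addr \<nu> (top_out D' (tl q)))"
  have "run redirect_below ?M (\<lambda>t N'. t \<le> 70 + 60 * u_o D D' \<and> ?Q N')"
    using run_redirect_below[OF md_states[OF bM sM] Pref_reps[OF p_Pref] rl]
  proof (rule run_mono, elim conjE)
    fix t N'
    assume t: "t \<le> 10 + 60 * card ({y. suffix p y} \<inter> Pref D)"
      and k: "keeps {rTop, rNod, rSta, rPtr, rNum} {aStack, OutHead, OutNext} ?M N'"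
      and o: "\<forall>a\<in>{OutHead, OutNext}. cells N' a = (\<lambda>s. if s \<noteq> 0 \<and> s \<in> cells ?M StateOf ` nd ` {y \<in> reps D. suffix p y} \<and>
        cells ?M a s = regs ?M rFrom then regs ?M rTo else cells ?M a s)"
    have o': "cells N' a (sa s) = (if suffix p s \<and> cells N a (sa s) = sa p then ?h else cells N a (sa s))"
      if "a = OutHead \<or> a = OutNext" "s \<in> Pref D" for a s
      using o mem[OF that(2)] sa_pos[OF that(2)] that(1) by auto
    have "cells N' OutHead (sa s) = out_addr \<nu> (top_out D' s)" if "s \<in> Pref D'" for s
    proof -
      have s: "s \<in> Pref D" using Pref_D'_sub[OF that] .
      have "cells N OutHead (sa s) = out_addr \<nu> (top_out D s)" using initial_outputs(1)[OF s] same(3) by simp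
      then show ?thesis using o'[OF _ s] oa[of s] tp[of s] tD'[of s] by auto
    qed
    moreover have "cells N' OutNext (sa q) = out_addr \<nu> (top_out D' (tl q))" if "q \<in> D'" for q
    proof -
      have q: "q \<in> D" using that by (simp add: D')
      then have qP: "q \<in> Pref D" by (auto simp: Pref_def)
      have "suffix p q" if "top_out D (tl q) = p" using tp[OF that] suffix_order.trans suffix_tl by blast
      moreover have "cells N OutNext (sa q) = out_addr \<nu> (top_out D (tl q))" using initial_outputs(2)[OF q] same(4) by simp
      ultimately show ?thesis using o'[OF _ qP] oa[of "tl q"] tD'[of "tl q"] by auto
    qed
    moreover have "t \<le> 70 + 60 * u_o D D'" using t card by simp
    moreover have "keeps {rFrom, rTo, rLast, rTop, rNod, rSta, rPtr, rNum} {aStack, OutHead, OutNext} N N'"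
      using k by (auto simp: keeps_def)
    ultimately show "t \<le> 70 + 60 * u_o D D' \<and> ?Q N'" by blast
  qed
  then have r: "run redirect_below ?M (\<lambda>t N'. 1 + (1 + (1 + (t + 1))) \<le> 80 + 60 * u_o D D' \<and> ?Q N')"
    by (rule run_mono) auto
  have "cells N OutNext (sa p) = ?h" "cells N NodeOf (sa p) = nd p"
    using same(2,4) initial_outputs(2)[OF pD] NodeOf_M0[OF p_Pref] by simp_all
  moreover have "aval (Var rFrom) N = regs N rFrom" for N by simp
  ultimately show ?thesis unfolding retract_def
    using st base_regs(1)[OF b] r by simp
qed

text \<open>The removed words are the prefixes of \<open>W\<close> longer than \<open>i0\<close>, so
  the edge of the path at depth \<open>i0\<close> is the only one that leaves the surviving
  trie.\<close>

lemma run_prune: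
  assumes loc: "located N" and chl: "ac_children N = ac_children M0"
  shows "run prune N (\<lambda>t N'. t \<le> 3 \<and> keeps {} {AcChild False, AcChild True} N N' \<and>
    trie (code_words L D') a (ac_children N') (regs M0 FreeId))"
proof -
  note sub = code_words_sub
  have nil: "[] \<in> code_words L D'" by (simp add: code_words_def)
  from loc show ?thesis unfolding located_def
  proof (elim disjE exE conjE)
    assume all: "regs N rCut = 0" "W \<in> code_words L D'"
    have "code_words L D' = code_words L D"
    proof (intro equalityI sub subsetI)
      fix \<beta> assume "\<beta> \<in> code_words L D"
      then show "\<beta> \<in> code_words L D'"
        using code_words_removed[of \<beta>] code_words_take[of "length W" W D'] all(2) by fastforce
    qed
    then show ?thesis using all T chl by (simp add: prune_def)
  next
    fix i0
    assume some: "i0 < length W" "regs N rCut = a (take i0 W)" "regs N rBit = (if W ! i0 then 1 else 0)"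
      "\<forall>i\<le>length W. take i W \<in> code_words L D' \<longleftrightarrow> i \<le> i0"
    let ?\<beta> = "take i0 W" and ?b = "W ! i0"
    have bT: "?\<beta> \<in> code_words L D'" using some(1,4) by simp
    have nT: "?\<beta> @ [?b] \<notin> code_words L D'"
      using some(1) some(4)[rule_format, of "Suc i0"] by (simp add: take_Suc_conv_app_nth)
    have edge: "\<gamma> = ?\<beta> \<and> c = ?b"
      if g: "\<gamma> \<in> code_words L D'" "\<gamma> @ [c] \<in> code_words L D" "\<gamma> @ [c] \<notin> code_words L D'" for \<gamma> c
    proof -
      obtain i where i: "i \<le> length W" "\<gamma> @ [c] = take i W" using code_words_removed[OF g(2,3)] by blast
      then have "0 < i" by (cases i) auto
      then obtain l where l: "i = Suc l" using gr0_implies_Suc by blast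
      then have gl: "\<gamma> = take l W" "c = W ! l" using i by (simp_all add: take_Suc_conv_app_nth)
      have "l \<le> i0" using g(1) gl(1) some(4) i(1) l by simp
      moreover have "\<not> i \<le> i0" using g(3) i some(4) by simp
      ultimately have "l = i0" using l by simp
      then show ?thesis using gl by simp
    qed
    let ?ch = "\<lambda>c v. if c = ?b \<and> v = a ?\<beta> then 0 else cells M0 (AcChild c) v"
    have tr: "trie (code_words L D') a ?ch (regs M0 FreeId)"
      by (rule trie_prune[OF T sub nil _ bT nT edge]) (auto intro: code_words_closed)
    have pos: "0 < regs N rCut" using some(2) T_addr(1)[OF W_T] by simp
    let ?M = "N\<lparr>cells := (cells N)(AcChild ?b := (cells N (AcChild ?b))(a ?\<beta> := 0))\<rparr>"
    have "cells N (AcChild c) = cells M0 (AcChild c)" for c using chl by metis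
    then have chM: "ac_children ?M = ?ch" by (auto simp: fun_eq_iff)
    have "run prune N (\<lambda>t N'. t \<le> 3 \<and> N' = ?M)"
      using pos some(2,3) by (cases ?b) (simp_all add: prune_def)
    then show ?thesis by (rule run_mono) (use tr chM in \<open>auto simp: keeps_def\<close>)
  qed
qed

end

text \<open>The address map \<open>a\<close> of the old trie serves the new one as well, restricted
  to the surviving words; \<open>FreeId\<close> does not change.\<close>

lemma (in update_setup) delete_correct:
  assumes pD: "p \<in> D"
  shows "\<exists>t M' \<nu>'. exec delete_com M0 t M' \<and>
     t \<le> 500 * (L * length p + u_f D (D - {p}) + u_o D (D - {p})) \<and>
     represents_ac \<sigma> (D - {p}) \<nu>' M' \<and> (\<forall>s \<in> Pref D \<inter> Pref (D - {p}). \<nu>' (s, []) = \<nu> (s, [])) \<and>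
     represents_dawg \<sigma> D \<mu> M'"
proof -
  define D' where "D' = D - {p}"
  obtain a where a: "trie (code_words L D) a (ac_children M0) (regs M0 FreeId)"
    "\<And>v w. (v, w) \<in> branch_keys L (Pref D) (goto_edges D) \<Longrightarrow> a (bits L v @ w) = \<nu> (v, w)"
    using initial_trie by metis
  interpret deletion \<sigma> D p \<nu> \<mu> M0 a D'
  proof
    show "D' = D - {p}" "p \<in> D" "trie (code_words L D) a (ac_children M0) (regs M0 FreeId)"
      using a(1) pD by (simp_all add: D'_def)
    show "a (bits L s) = \<nu> (s, [])" if "s \<in> Pref D" for s
      using a(2)[of s "[]"] that by (simp add: branch_keys_def)
  qed
  obtain t1 M1 where e1: "exec locate M0 t1 M1" and t1: "t1 \<le> 40 * L * length p + 20"
    and k1: "keeps {rCur, rIdx, rCut, rBit, rKeep, rChr, rCnt} {aState} M0 M1"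
    and s1: "\<forall>i\<le>length p. cells M1 aState i = sa (take i p)" and l1: "located M1"
    using run_locate by (elim runE conjE)
  have b1: "base M1" by (rule base_keeps[OF base_M0 k1]) auto
  have c1: "cells M1 StateOf = cells M0 StateOf" "cells M1 NodeOf = cells M0 NodeOf" "cells M1 Flink = cells M0 Flink"
    using k1 by (simp_all add: keeps_def)
  obtain t2 M2 where e2: "exec relink_removed M1 t2 M2" and t2: "t2 \<le> 172 * length p + 72 * u_f D D' + 3"
    and k2: "keeps {rIdx, rTo, rTop, rNod, rSta, rPtr, rNum} {aStack, Flink} M1 M2"
    and f2: "\<forall>s\<in>Pref D'. s \<noteq> [] \<longrightarrow> cells M2 Flink (sa s) = sa (flink D' s)"
    using run_relink_removed[OF b1 l1 s1 c1] by (elim runE conjE)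
  have b2: "base M2" by (rule base_keeps[OF b1 k2]) auto
  have c2: "cells M2 aState (length p) = sa p" "cells M2 StateOf = cells M0 StateOf" "cells M2 NodeOf = cells M0 NodeOf"
    "cells M2 OutHead = cells M0 OutHead" "cells M2 OutNext = cells M0 OutNext"
    using k1 k2 s1 by (simp_all add: keeps_def)
  obtain t3 M3 where e3: "exec retract M2 t3 M3" and t3: "t3 \<le> 80 + 60 * u_o D D'"
    and k3: "keeps {rFrom, rTo, rLast, rTop, rNod, rSta, rPtr, rNum} {aStack, OutHead, OutNext} M2 M3"
    and o3: "\<forall>s\<in>Pref D'. cells M3 OutHead (sa s) = out_addr \<nu> (top_out D' s)"
      "\<forall>q\<in>D'. cells M3 OutNext (sa q) = out_addr \<nu> (top_out D' (tl q))"
    using run_retract[OF b2 c2] by (elim runE conjE)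
  have b3: "base M3" by (rule base_keeps[OF b2 k3]) auto
  have l3: "located M3" using l1 k2 k3 by (simp add: located_def keeps_def)
  have ch3: "ac_children M3 = ac_children M0" using k1 k2 k3 by (simp add: keeps_def)
  obtain t4 M4 where e4: "exec prune M3 t4 M4" and t4: "t4 \<le> 3"
    and k4: "keeps {} {AcChild False, AcChild True} M3 M4"
    and T4: "trie (code_words L D') a (ac_children M4) (regs M0 FreeId)"
    using run_prune[OF l3 ch3] by (elim runE conjE)
  have b4: "base M4" by (rule base_keeps[OF b3 k4]) auto
  let ?\<nu> = "\<lambda>(v, w). a (bits L v @ w)"
  have free: "regs M4 FreeId = regs M0 FreeId" using k1 k2 k3 k4 by (simp add: keeps_def)
  have tP: "top_out D' s \<in> Pref D" for s using longest(1)[of "insert [] D'" s] by (auto simp: Pref_def D')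
  have fP: "flink D' s \<in> Pref D" if "s \<noteq> []" for s using flink_props(1)[OF that] Pref_D'_sub by blast
  have "represents_ac \<sigma> D' ?\<nu> M4"
  proof (rule represents_acI[OF _ _ _ b4])
    show "finite D'" "[] \<notin> D'" using fin Nil_D by (simp_all add: D')
    show "set q \<subseteq> {..<2 ^ L}" if "q \<in> D'" for q using chars(1) that by (simp add: D')
    show "trie (code_words L D') a (ac_children M4) (regs M4 FreeId)" using T4 free by simp
    show "a [] = \<nu> ([], [])" using a_\<nu>[of "[]"] by simp
    show "cells M4 Flink (a (bits L s)) = a (bits L (flink D' s))" if "s \<in> Pref D'" "s \<noteq> []" for s
      using f2 that k3 k4 a_\<nu>[OF Pref_D'_sub[OF that(1)]] a_\<nu>[OF fP[OF that(2)]] by (simp add: keeps_def)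
    show "cells M4 OutHead (a (bits L s)) = (if top_out D' s = [] then 0 else a (bits L (top_out D' s)))"
      if "s \<in> Pref D'" for s
      using o3(1) that k4 a_\<nu>[OF Pref_D'_sub[OF that]] a_\<nu>[OF tP] by (simp add: keeps_def out_addr_def)
    show "cells M4 OutNext (a (bits L q)) = (if top_out D' (tl q) = [] then 0 else a (bits L (top_out D' (tl q))))"
      if q: "q \<in> D'" for q
    proof -
      have "q \<in> Pref D'" using q by (auto simp: Pref_def)
      then show ?thesis using o3(2) q k4 a_\<nu>[OF Pref_D'_sub] a_\<nu>[OF tP] by (simp add: keeps_def out_addr_def)
    qed
  qed
  moreover have "\<forall>s\<in>Pref D \<inter> Pref D'. ?\<nu> (s, []) = \<nu> (s, [])" using a_\<nu> by simp
  moreover have "exec delete_com M0 (t1 + (t2 + (t3 + (t4 + 1)))) M4"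
    unfolding delete_com_def block.simps
    by (intro exec.Seq[OF e1] exec.Seq[OF e2] exec.Seq[OF e3] exec.Seq[OF e4] exec.Skip)
  moreover have "t1 + (t2 + (t3 + (t4 + 1))) \<le> 500 * (L * length p + u_f D D' + u_o D D')"
  proof -
    have "1 \<le> L" "1 \<le> length p" using L_pos len_p by linarith+
    then have "length p \<le> L * length p" "1 \<le> L * length p" using mult_le_mono1[of 1 L "length p"] by auto
    moreover define m where "m = L * length p"
    ultimately have "length p \<le> m" "1 \<le> m" by simp_all
    then show ?thesis using t1 t2 t3 t4 unfolding mult.assoc m_def[symmetric] by simp
  qed
  ultimately show ?thesis using dawg_base[OF b4] unfolding D'_def by blast
qed

text \<open>\<open>1000 = 2 * 500\<close>, where the factor 2 is that of
  \<open>code_len_le\<close>.\<close>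

lemma update_bound_ge:
  assumes "t \<le> 500 * (code_len \<sigma> * length p + u_f D D' + u_o D D')"
  shows "real t \<le> 1000 * update_bound \<sigma> D p D'"
proof -
  have "real t \<le> 500 * (real (code_len \<sigma>) * real (length p) + real (u_f D D') + real (u_o D D'))"
    using assms by (metis (no_types, lifting) of_nat_add of_nat_le_iff of_nat_mult of_nat_numeral)
  moreover have "real (code_len \<sigma>) * real (length p) \<le> 2 * (real (length p) * max 1 (log 2 (real \<sigma>)))"
    using mult_right_mono[OF code_len_le[of \<sigma>], of "real (length p)"] by (simp add: mult_ac)
  ultimately show ?thesis unfolding update_bound_def by (simp add: algebra_simps)
qed

theorem theorem2:
  shows "(\<exists>ins K. \<forall>\<sigma> D p.
            dictionary \<sigma> D \<and> p \<noteq> [] \<and> set p \<subseteq> {..<\<sigma>} \<longrightarrow>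
            updates_ac ins \<sigma> D p (D \<union> {p}) (K * update_bound \<sigma> D p (D \<union> {p})))
       \<and> (\<exists>del K. \<forall>\<sigma> D p.
            dictionary \<sigma> D \<and> p \<in> D \<longrightarrow>
            updates_ac del \<sigma> D p (D - {p}) (K * update_bound \<sigma> D p (D - {p})))"
proof (intro conjI exI allI impI)
  fix \<sigma> D p
  assume p: "dictionary \<sigma> D \<and> p \<noteq> [] \<and> set p \<subseteq> {..<\<sigma>}"
  \<comment> \<open>Here the witnesses are fixed: the program and the constant 1000 are the same for
    all \<open>\<sigma>\<close>, \<open>D\<close> and \<open>p\<close>.\<close>
  show "updates_ac insert_com \<sigma> D p (D \<union> {p}) (1000 * update_bound \<sigma> D p (D \<union> {p}))"
    unfolding updates_ac_def
  proof (intro allI impI)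
    fix M \<nu> \<mu>
    assume "represents_ac \<sigma> D \<nu> M \<and> represents_dawg \<sigma> D \<mu> M \<and> cross_linked D \<nu> \<mu> M \<and> pattern_stored p M"
    then interpret update_setup \<sigma> D p \<nu> \<mu> M using p by unfold_locales auto
    show "\<exists>t M' \<nu>'. exec insert_com M t M' \<and> real t \<le> 1000 * update_bound \<sigma> D p (D \<union> {p}) \<and>
       represents_ac \<sigma> (D \<union> {p}) \<nu>' M' \<and> (\<forall>s \<in> Pref D \<inter> Pref (D \<union> {p}). \<nu>' (s, []) = \<nu> (s, [])) \<and>
       represents_dawg \<sigma> D \<mu> M'"
      using insert_correct update_bound_ge unfolding L_def by blast
  qed
next
  fix \<sigma> D p
  assume p: "dictionary \<sigma> D \<and> p \<in> D"
  show "updates_ac delete_com \<sigma> D p (D - {p}) (1000 * update_bound \<sigma> D p (D - {p}))"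
    unfolding updates_ac_def
  proof (intro allI impI)
    fix M \<nu> \<mu>
    assume "represents_ac \<sigma> D \<nu> M \<and> represents_dawg \<sigma> D \<mu> M \<and> cross_linked D \<nu> \<mu> M \<and> pattern_stored p M"
    then interpret update_setup \<sigma> D p \<nu> \<mu> M using p by unfold_locales (auto simp: dictionary_def)
    show "\<exists>t M' \<nu>'. exec delete_com M t M' \<and> real t \<le> 1000 * update_bound \<sigma> D p (D - {p}) \<and>
       represents_ac \<sigma> (D - {p}) \<nu>' M' \<and> (\<forall>s \<in> Pref D \<inter> Pref (D - {p}). \<nu>' (s, []) = \<nu> (s, [])) \<and>
       represents_dawg \<sigma> D \<mu> M'"
      using delete_correct p update_bound_ge unfolding L_def by blast
  qed
qed

end
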